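(* Let $X=(X_n)_{n\in\mathbb{Z}}$ be the i.i.d. increments of a skip-free to the left random walk, with $\mathbb{P}[X_0=-1]<1$, and let $[T,o]$ be the connected component of $0$ in the record graph of $(\mathbb{Z},X)$, rooted at $o=0$ (self-loops discarded, children of each vertex ordered as integers). If $\mathbb{E}[X_0]<0$, then the distribution of $[T,o]$ is that of the Typically rooted Galton-Watson Tree $TGWT(\pi)$ with offspring distribution $\pi$, where $\pi$ is the distribution of $X_0+1$.
   Context: **Increments.** "I.i.d. increments of a skip-free to the left random walk" means: $X=(X_n)_{n\in\mathbb{Z}}$ is i.i.d., each $X_n$ takes values in $\{-1,0,1,2,\dots\}$, $\mathbb{P}[X_0=-1]>0$ and $\mathbb{E}[X_0]<\infty$. **Record graph.** For an integer-valued sequence $x=(x_n)_{n\in\mathbb{Z}}$ the record map is $R_x(i)=\inf\{j>i:\sum_{l=i}^{j-1}x_l\ge 0\}$ if the infimum exists (the set is non-empty) and $R_x(i)=i$ otherwise. The record graph of $(\mathbb{Z},x)$ is the directed graph on $\mathbb{Z}$ with edges $(i,R_x(i))$ for all $i$ with $R_x(i)\ne i$. **Family Trees.** A Family Tree is a locally finite directed tree in which each vertex has out-degree at most $1$; if there is an edge $v\to u$, then $u$ is the parent of $v$ and $v$ a child of $u$. It is ordered if the children of each vertex are totally ordered. Rooted (ordered) Family Trees are considered up to (order-preserving) root-preserving isomorphism, with the Borel $\sigma$-algebra of the local topology (convergence means that balls of every radius around the root are eventually isomorphic). **$TGWT(\pi)$.** Let $\pi$ be a probability distribution on $\{0,1,2,\dots\}$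 with mean $0<m(\pi)<1$ and let $\hat\pi(k)=k\pi(k)/m(\pi)$ be its size-biased version. $TGWT(\pi)$ is the random rooted ordered Family Tree $[\mathbf{T},\mathbf{o}]$ built as follows. (1) Add a parent to $\mathbf{o}$ with probability $m(\pi)$; iterate independently for that parent and all further ancestors, so the number $N$ of ancestors satisfies $\mathbb{P}[N=n]=m(\pi)^n(1-m(\pi))$, $n\geq 0$. (2) To each ancestor of $\mathbf{o}$, independently, attach $Z-1$ additional children, where $Z$ has distribution $\hat\pi$. (3) To each of these new children and to $\mathbf{o}$ itself, attach independent ordered Galton-Watson trees with offspring distribution $\pi$. The order among the children of every vertex is uniform (in particular, the position, among the children of an ancestor of $\mathbf{o}$, of the child that is $\mathbf{o}$ or an ancestor of $\mathbf{o}$ is uniform), independently. *)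

theory Defs
  imports "HOL-Probability.Probability" "HOL-Combinatorics.Multiset_Permutations"
begin

section \<open>Rooted ordered Family Trees\<close>

text \<open>Arcs point from children to parents; \<open>sib\<close> relates siblings only and orders the children of
  each vertex.\<close>

record 'v rotree =
  verts :: "'v set"
  arcs :: "('v \<times> 'v) set"
  sib :: "('v \<times> 'v) set"
  the_root :: 'v

definition children :: "'v rotree \<Rightarrow> 'v \<Rightarrow> 'v set" where
  "children T v = {u. (u, v) \<in> arcs T}"

definition adj :: "'v rotree \<Rightarrow> ('v \<times> 'v) set" where
  "adj T = arcs T \<union> (arcs T)\<inverse>"

text \<open>When every out-degree is at most 1, a cycle of the underlying undirected graph is a directed
  cycle, so being a tree amounts to connectedness together with \<^const>\<open>acyclic\<close>.\<close>

definition family_tree :: "'v rotree \<Rightarrow> bool" where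
  "family_tree T \<longleftrightarrow>
     the_root T \<in> verts T \<and> arcs T \<subseteq> verts T \<times> verts T \<and>
     single_valued (arcs T) \<and> acyclic (arcs T) \<and>
     (\<forall>v\<in>verts T. (the_root T, v) \<in> (adj T)\<^sup>*) \<and>
     (\<forall>v\<in>verts T. finite (children T v)) \<and>
     sib T \<subseteq> {(u, w). \<exists>v. u \<in> children T v \<and> w \<in> children T v} \<and>
     (\<forall>v\<in>verts T. linear_order_on (children T v) (Restr (sib T) (children T v)))"

definition rotree_iso :: "'v rotree \<Rightarrow> 'w rotree \<Rightarrow> bool" (infix "\<simeq>" 50) where
  "T \<simeq> S \<longleftrightarrow> (\<exists>f. bij_betw f (verts T) (verts S) \<and> f (the_root T) = the_root S \<and>
     (\<forall>u\<in>verts T. \<forall>v\<in>verts T. (u, v) \<in> arcs T \<longleftrightarrow> (f u, f v) \<in> arcs S) \<and>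
     (\<forall>u\<in>verts T. \<forall>v\<in>verts T. (u, v) \<in> sib T \<longleftrightarrow> (f u, f v) \<in> sib S))"

definition root_ball :: "nat \<Rightarrow> 'v rotree \<Rightarrow> 'v rotree" where
  "root_ball r T =
     (let B = {v. \<exists>n\<le>r. (the_root T, v) \<in> adj T ^^ n}
      in \<lparr>verts = B, arcs = Restr (arcs T) B, sib = Restr (sib T) B, the_root = the_root T\<rparr>)"

lemma root_ball_simps:
  "verts (root_ball r T) = {v. \<exists>n\<le>r. (the_root T, v) \<in> adj T ^^ n}"
  "arcs (root_ball r T) = Restr (arcs T) (verts (root_ball r T))"
  "sib (root_ball r T) = Restr (sib T) (verts (root_ball r T))"
  "the_root (root_ball r T) = the_root T"
  by (simp_all add: root_ball_def Let_def)

lemma rotree_iso_refl: "T \<simeq> T"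
  unfolding rotree_iso_def by (rule exI[of _ id]) auto

lemma rotree_iso_sym:
  assumes "T \<simeq> S" "the_root T \<in> verts T"
  shows "S \<simeq> T"
proof -
  obtain f where f: "bij_betw f (verts T) (verts S)" "f (the_root T) = the_root S"
     "\<And>u v. u \<in> verts T \<Longrightarrow> v \<in> verts T \<Longrightarrow> (u, v) \<in> arcs T \<longleftrightarrow> (f u, f v) \<in> arcs S"
     "\<And>u v. u \<in> verts T \<Longrightarrow> v \<in> verts T \<Longrightarrow> (u, v) \<in> sib T \<longleftrightarrow> (f u, f v) \<in> sib S"
    using assms(1) unfolding rotree_iso_def by blast
  let ?g = "inv_into (verts T) f"
  have g: "?g u \<in> verts T" "f (?g u) = u" if "u \<in> verts S" for u
    using that f(1) by (auto simp: bij_betw_def inv_into_into f_inv_into_f)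
  have "bij_betw ?g (verts S) (verts T)"
    using f(1) by (rule bij_betw_inv_into)
  moreover have "?g (the_root S) = the_root T"
    using f(1,2) assms(2) by (metis bij_betw_inv_into_left)
  ultimately show ?thesis
    unfolding rotree_iso_def using g f(3,4) by (intro exI[of _ ?g]) auto
qed

lemma rotree_iso_trans:
  assumes "T \<simeq> S" "S \<simeq> R"
  shows "T \<simeq> R"
proof -
  obtain f where f: "bij_betw f (verts T) (verts S)" "f (the_root T) = the_root S"
     "\<And>u v. u \<in> verts T \<Longrightarrow> v \<in> verts T \<Longrightarrow> (u, v) \<in> arcs T \<longleftrightarrow> (f u, f v) \<in> arcs S"
     "\<And>u v. u \<in> verts T \<Longrightarrow> v \<in> verts T \<Longrightarrow> (u, v) \<in> sib T \<longleftrightarrow> (f u, f v) \<in> sib S"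
    using assms(1) unfolding rotree_iso_def by blast
  obtain g where g: "bij_betw g (verts S) (verts R)" "g (the_root S) = the_root R"
     "\<And>u v. u \<in> verts S \<Longrightarrow> v \<in> verts S \<Longrightarrow> (u, v) \<in> arcs S \<longleftrightarrow> (g u, g v) \<in> arcs R"
     "\<And>u v. u \<in> verts S \<Longrightarrow> v \<in> verts S \<Longrightarrow> (u, v) \<in> sib S \<longleftrightarrow> (g u, g v) \<in> sib R"
    using assms(2) unfolding rotree_iso_def by blast
  have "f u \<in> verts S" if "u \<in> verts T" for u
    using that f(1) by (auto simp: bij_betw_def)
  then show ?thesis
    unfolding rotree_iso_def using f g bij_betw_trans[OF f(1) g(1)]
    by (intro exI[of _ "g \<circ> f"]) auto
qed

lemma family_tree_iso:
  assumes T: "family_tree T" and iso: "T \<simeq> S"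
    and S: "arcs S \<subseteq> verts S \<times> verts S" "sib S \<subseteq> verts S \<times> verts S"
  shows "family_tree S"
proof -
  obtain f where f: "bij_betw f (verts T) (verts S)" "f (the_root T) = the_root S"
     "\<And>u v. u \<in> verts T \<Longrightarrow> v \<in> verts T \<Longrightarrow> (u, v) \<in> arcs T \<longleftrightarrow> (f u, f v) \<in> arcs S"
     "\<And>u v. u \<in> verts T \<Longrightarrow> v \<in> verts T \<Longrightarrow> (u, v) \<in> sib T \<longleftrightarrow> (f u, f v) \<in> sib S"
    using iso unfolding rotree_iso_def by blast
  define g where "g = inv_into (verts T) f"
  have g: "g y \<in> verts T" "f (g y) = y" if "y \<in> verts S" for y
    using that f(1) by (auto simp: bij_betw_def inv_into_into f_inv_into_f g_def)
  have img: "f u \<in> verts S" if "u \<in> verts T" for u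
    using that f(1) by (auto simp: bij_betw_def)
  have gf: "g (f u) = u" if "u \<in> verts T" for u
    using that f(1) unfolding g_def by (rule bij_betw_inv_into_left[rotated])
  have AT: "arcs T \<subseteq> verts T \<times> verts T" and sv: "single_valued (arcs T)" and ac: "acyclic (arcs T)"
    and conn: "\<And>v. v \<in> verts T \<Longrightarrow> (the_root T, v) \<in> (adj T)\<^sup>*"
    and fin: "\<And>v. v \<in> verts T \<Longrightarrow> finite (children T v)"
    and sib: "sib T \<subseteq> {(u, w). \<exists>v. u \<in> children T v \<and> w \<in> children T v}"
    and lin: "\<And>v. v \<in> verts T \<Longrightarrow> linear_order_on (children T v) (Restr (sib T) (children T v))"
    and rT: "the_root T \<in> verts T"
    using T unfolding family_tree_def by auto
  have arcg: "(x, y) \<in> arcs S \<longleftrightarrow> x \<in> verts S \<and> y \<in> verts S \<and> (g x, g y) \<in> arcs T" for x y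
    using f(3)[of "g x" "g y"] g S by auto
  have sibg: "(x, y) \<in> sib S \<longleftrightarrow> x \<in> verts S \<and> y \<in> verts S \<and> (g x, g y) \<in> sib T" for x y
    using f(4)[of "g x" "g y"] g S by auto
  have ch: "children S y = f ` children T (g y)" if "y \<in> verts S" for y
  proof
    show "children S y \<subseteq> f ` children T (g y)"
      using g(2) by (fastforce simp: children_def arcg image_iff)
    show "f ` children T (g y) \<subseteq> children S y"
      using AT that by (auto simp: children_def arcg img gf subset_iff)
  qed
  have chV: "children T v \<subseteq> verts T" for v using AT by (auto simp: children_def)
  have ginj: "x = y" if "g x = g y" "x \<in> verts S" "y \<in> verts S" for x y
    using that g(2) by metis
  have "single_valued (arcs S)"
  proof (rule single_valuedI)
    fix x y z assume "(x, y) \<in> arcs S" "(x, z) \<in> arcs S"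
    then show "y = z" using single_valuedD[OF sv, of "g x" "g y" "g z"] ginj[of y z] by (simp add: arcg)
  qed
  moreover have "acyclic (arcs S)"
    unfolding acyclic_def
  proof (intro allI notI)
    fix x assume "(x, x) \<in> (arcs S)\<^sup>+"
    moreover have "(g x, g y) \<in> (arcs T)\<^sup>+" if "(x, y) \<in> (arcs S)\<^sup>+" for x y
      using that by (induction) (auto simp: arcg intro: trancl_into_trancl)
    ultimately show False using ac by (auto simp: acyclic_def)
  qed
  moreover have "\<forall>y\<in>verts S. (the_root S, y) \<in> (adj S)\<^sup>*"
  proof
    fix y assume y: "y \<in> verts S"
    have "(the_root T, v) \<in> (adj T)\<^sup>* \<Longrightarrow> (the_root S, f v) \<in> (adj S)\<^sup>*" for v
    proof (induction rule: rtrancl_induct)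
      case base
      then show ?case using f(2) by simp
    next
      case (step u v)
      have "u \<in> verts T" "v \<in> verts T" using step.hyps(2) AT by (auto simp: adj_def)
      then have "(f u, f v) \<in> adj S"
        using step.hyps(2) f(3)[of u v] f(3)[of v u] by (simp add: adj_def)
      then show ?case using step.IH by (rule rtrancl_into_rtrancl[rotated])
    qed
    then show "(the_root S, y) \<in> (adj S)\<^sup>*" using conn[OF g(1)[OF y]] g(2)[OF y] by metis
  qed
  moreover have "\<forall>y\<in>verts S. finite (children S y)"
    using ch fin g(1) by simp
  moreover have "sib S \<subseteq> {(u, w). \<exists>v. u \<in> children S v \<and> w \<in> children S v}"
  proof
    fix p assume p: "p \<in> sib S"
    obtain x y where [simp]: "p = (x, y)" by (cases p)
    have xy: "x \<in> verts S" "y \<in> verts S" "(g x, g y) \<in> sib T" using p sibg by auto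
    then obtain v where v: "(g x, v) \<in> arcs T" "(g y, v) \<in> arcs T"
      using sib by (auto simp: children_def)
    then have "v \<in> verts T" using AT by auto
    then have "(x, f v) \<in> arcs S" "(y, f v) \<in> arcs S"
      using v xy by (auto simp: arcg img gf)
    then show "p \<in> {(u, w). \<exists>v. u \<in> children S v \<and> w \<in> children S v}"
      by (auto simp: children_def)
  qed
  moreover have "\<forall>y\<in>verts S. linear_order_on (children S y) (Restr (sib S) (children S y))"
  proof
    fix y assume y: "y \<in> verts S"
    define R where "R = Restr (sib T) (children T (g y))"
    define Q where "Q = Restr (sib S) (children S y)"
    have L: "linear_order_on (children T (g y)) R" using lin g(1)[OF y] by (simp add: R_def)
    then have L': "trans R" "antisym R" "refl_on (children T (g y)) R" "total_on (children T (g y)) R"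
      by (simp_all add: order_on_defs)
    have mem: "(a, b) \<in> Q \<longleftrightarrow> a \<in> verts S \<and> b \<in> verts S \<and> (g a, g b) \<in> R" for a b
      using y unfolding children_def Q_def R_def by (auto simp: sibg arcg)
    have memc: "a \<in> children S y \<longleftrightarrow> a \<in> verts S \<and> g a \<in> children T (g y)" for a
      using y by (auto simp: children_def arcg)
    have "trans Q"
      by (rule transI) (use transD[OF L'(1)] in \<open>simp add: mem; blast\<close>)
    moreover have "antisym Q"
    proof (rule antisymI)
      fix a b assume "(a, b) \<in> Q" "(b, a) \<in> Q"
      then show "a = b" using antisymD[OF L'(2), of "g a" "g b"] ginj[of a b] by (simp add: mem)
    qed
    moreover have "refl_on (children S y) Q"
      by (rule refl_onI) (use refl_onD[OF L'(3)] in \<open>simp add: mem memc\<close>)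
    moreover have "total_on (children S y) Q"
    proof (rule total_onI)
      fix a b assume "a \<in> children S y" "b \<in> children S y" "a \<noteq> b"
      then show "(a, b) \<in> Q \<or> (b, a) \<in> Q"
        using ginj[of a b] L'(4) by (auto simp: mem memc total_on_def)
    qed
    moreover have "Q \<subseteq> children S y \<times> children S y" by (auto simp: Q_def)
    ultimately show "linear_order_on (children S y) (Restr (sib S) (children S y))"
      unfolding order_on_defs Q_def by blast
  qed
  ultimately show ?thesis
    unfolding family_tree_def using S(1) img[OF rT] f(2) by simp
qed

lemma countable_verts:
  assumes "family_tree T"
  shows "countable (verts T)"
proof -
  have fin: "finite (adj T `` {v})" for v
  proof (cases "v \<in> verts T")
    case True
    have "adj T `` {v} = arcs T `` {v} \<union> children T v"
      by (auto simp: adj_def children_def)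
    moreover have "finite (arcs T `` {v})"
    proof -
      have sv: "single_valued (arcs T)" using assms by (simp add: family_tree_def)
      have "arcs T `` {v} \<subseteq> {u}" if "(v, u) \<in> arcs T" for u
        using single_valuedD[OF sv that] by blast
      then show ?thesis by (cases "\<exists>u. (v, u) \<in> arcs T") (auto intro: finite_subset)
    qed
    ultimately show ?thesis using assms True by (simp add: family_tree_def)
  next
    case False
    then have "adj T `` {v} = {}" using assms by (auto simp: family_tree_def adj_def)
    then show ?thesis by simp
  qed
  have "finite {v. (the_root T, v) \<in> adj T ^^ n}" for n
  proof (induction n)
    case 0
    then show ?case by simp
  next
    case (Suc n)
    have "{v. (the_root T, v) \<in> adj T ^^ Suc n} = (\<Union>w\<in>{w. (the_root T, w) \<in> adj T ^^ n}. adj T `` {w})"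
      by auto
    then show ?case using Suc fin by simp
  qed
  then have "countable (\<Union>n. {v. (the_root T, v) \<in> adj T ^^ n})"
    by (intro countable_UN) (auto intro: countable_finite)
  moreover have "verts T \<subseteq> (\<Union>n. {v. (the_root T, v) \<in> adj T ^^ n})"
    using assms by (auto simp: family_tree_def rtrancl_power)
  ultimately show ?thesis by (rule countable_subset[rotated])
qed

lemma nat_representative:
  assumes "family_tree T"
  shows "\<exists>S :: nat rotree. family_tree S \<and> T \<simeq> S"
proof -
  let ?f = "to_nat_on (verts T)"
  define S where "S = \<lparr>verts = ?f ` verts T, arcs = map_prod ?f ?f ` arcs T,
    sib = map_prod ?f ?f ` sib T, the_root = ?f (the_root T)\<rparr>"
  have inj: "inj_on ?f (verts T)"
    using countable_verts[OF assms] by (rule inj_on_to_nat_on)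
  have A: "arcs T \<subseteq> verts T \<times> verts T" using assms by (simp add: family_tree_def)
  have B: "sib T \<subseteq> verts T \<times> verts T"
    using assms A by (fastforce simp: family_tree_def children_def)
  have "T \<simeq> S"
    unfolding rotree_iso_def
  proof (intro exI[of _ ?f] conjI ballI)
    show "bij_betw ?f (verts T) (verts S)" using inj by (simp add: bij_betw_def S_def)
    fix u v assume uv: "u \<in> verts T" "v \<in> verts T"
    have *: "(u, v) \<in> r \<longleftrightarrow> (?f u, ?f v) \<in> map_prod ?f ?f ` r" if "r \<subseteq> verts T \<times> verts T" for r
    proof
      assume "(?f u, ?f v) \<in> map_prod ?f ?f ` r"
      then obtain a b where ab: "(a, b) \<in> r" "?f u = ?f a" "?f v = ?f b" by auto
      then have "a \<in> verts T" "b \<in> verts T" using that by auto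
      then show "(u, v) \<in> r" using ab inj_onD[OF inj] uv by metis
    qed (rule map_prod_imageI)
    show "(u, v) \<in> arcs T \<longleftrightarrow> (?f u, ?f v) \<in> arcs S" using *[OF A] by (simp add: S_def)
    show "(u, v) \<in> sib T \<longleftrightarrow> (?f u, ?f v) \<in> sib S" using *[OF B] by (simp add: S_def)
  qed (simp add: S_def)
  moreover have "arcs S \<subseteq> verts S \<times> verts S" "sib S \<subseteq> verts S \<times> verts S"
    using A B by (auto simp: S_def)
  ultimately show ?thesis using family_tree_iso[OF assms] by blast
qed

lemma root_ball_idem:
  assumes "r \<le> s"
  shows "root_ball r (root_ball s T) = root_ball r T"
proof -
  let ?B = "\<lambda>k. {v. \<exists>n\<le>k. (the_root T, v) \<in> adj T ^^ n}"
  let ?S = "root_ball s T"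
  have adjS: "adj ?S = Restr (adj T) (?B s)"
    by (auto simp: root_ball_def adj_def Let_def)
  have rootS: "the_root ?S = the_root T"
    by (simp add: root_ball_def Let_def)
  have 1: "(the_root T, v) \<in> adj ?S ^^ n" if "(the_root T, v) \<in> adj T ^^ n" "n \<le> s" for n v
    using that
  proof (induction n arbitrary: v)
    case 0
    then show ?case by simp
  next
    case (Suc n)
    then obtain w where w: "(the_root T, w) \<in> adj T ^^ n" "(w, v) \<in> adj T" by auto
    have "(the_root T, w) \<in> adj ?S ^^ n" using Suc.IH w(1) Suc.prems by simp
    moreover have "w \<in> ?B s" using w(1) Suc.prems(2) by (auto intro!: exI[of _ n])
    moreover have "v \<in> ?B s" using Suc.prems by blast
    ultimately show ?case using w(2) adjS by auto
  qed
  have 2: "(the_root T, v) \<in> adj T ^^ n" if "(the_root T, v) \<in> adj ?S ^^ n" for n v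
    using that
  proof (induction n arbitrary: v)
    case 0
    then show ?case by simp
  next
    case (Suc n)
    then obtain w where "(the_root T, w) \<in> adj ?S ^^ n" "(w, v) \<in> adj ?S" by auto
    then show ?case using Suc.IH adjS by auto
  qed
  have B: "verts (root_ball r ?S) = verts (root_ball r T)"
  proof -
    have "(\<exists>n\<le>r. (the_root T, v) \<in> adj ?S ^^ n) \<longleftrightarrow> (\<exists>n\<le>r. (the_root T, v) \<in> adj T ^^ n)" for v
      using 1 2 assms by (meson order_trans)
    then show ?thesis by (simp add: rootS root_ball_simps)
  qed
  have sub: "verts (root_ball r T) \<subseteq> verts ?S"
    using assms by (auto simp: root_ball_simps intro: order_trans)
  show ?thesis
    using sub B rootS by (intro rotree.equality) (auto simp: root_ball_simps(2-4) simp del: root_ball_simps(1))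
qed

lemma rotree_iso_root_ball:
  assumes "T \<simeq> S" "the_root T \<in> verts T" "arcs T \<subseteq> verts T \<times> verts T" "arcs S \<subseteq> verts S \<times> verts S"
  shows "root_ball r T \<simeq> root_ball r S"
proof -
  obtain f where f: "bij_betw f (verts T) (verts S)" "f (the_root T) = the_root S"
     "\<And>u v. u \<in> verts T \<Longrightarrow> v \<in> verts T \<Longrightarrow> (u, v) \<in> arcs T \<longleftrightarrow> (f u, f v) \<in> arcs S"
     "\<And>u v. u \<in> verts T \<Longrightarrow> v \<in> verts T \<Longrightarrow> (u, v) \<in> sib T \<longleftrightarrow> (f u, f v) \<in> sib S"
    using assms(1) unfolding rotree_iso_def by blast
  have adj: "(u, v) \<in> adj T \<longleftrightarrow> (f u, f v) \<in> adj S" if "u \<in> verts T" "v \<in> verts T" for u v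
    using f(3) that by (auto simp: adj_def)
  have adjV: "adj T \<subseteq> verts T \<times> verts T" "adj S \<subseteq> verts S \<times> verts S"
    using assms(3,4) by (auto simp: adj_def)
  have img: "f u \<in> verts S" if "u \<in> verts T" for u
    using that f(1) by (auto simp: bij_betw_def)
  have fwd: "v \<in> verts T \<and> (the_root S, f v) \<in> adj S ^^ n" if "(the_root T, v) \<in> adj T ^^ n" for n v
    using that
  proof (induction n arbitrary: v)
    case 0
    then show ?case using f(2) assms(2) by simp
  next
    case (Suc n)
    then obtain w where w: "(the_root T, w) \<in> adj T ^^ n" "(w, v) \<in> adj T" by auto
    then show ?case using Suc.IH[OF w(1)] adjV adj[of w v] by auto
  qed
  have bwd: "\<exists>v. f v = y \<and> v \<in> verts T \<and> (the_root T, v) \<in> adj T ^^ n"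
    if "(the_root S, y) \<in> adj S ^^ n" for n y
    using that
  proof (induction n arbitrary: y)
    case 0
    then show ?case using f(2) assms(2) by auto
  next
    case (Suc n)
    then obtain z where z: "(the_root S, z) \<in> adj S ^^ n" "(z, y) \<in> adj S" by auto
    obtain w where w: "f w = z" "w \<in> verts T" "(the_root T, w) \<in> adj T ^^ n"
      using Suc.IH[OF z(1)] by blast
    obtain v where v: "v \<in> verts T" "f v = y"
      using z(2) adjV(2) f(1) unfolding bij_betw_def by (metis image_iff mem_Sigma_iff subsetD)
    then show ?case using w z(2) adj[of w v] by auto
  qed
  let ?BT = "{v. \<exists>n\<le>r. (the_root T, v) \<in> adj T ^^ n}"
  let ?BS = "{v. \<exists>n\<le>r. (the_root S, v) \<in> adj S ^^ n}"
  have sub: "?BT \<subseteq> verts T" using fwd by blast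
  have image: "f ` ?BT = ?BS" using fwd bwd by blast
  have "inj_on f ?BT" using f(1) sub by (auto simp: bij_betw_def intro: inj_on_subset)
  then have "bij_betw f ?BT ?BS" using image by (simp add: bij_betw_def)
  moreover have "f u \<in> ?BS" if "u \<in> ?BT" for u using that image by blast
  ultimately show ?thesis
    unfolding rotree_iso_def root_ball_def Let_def
    using f(2-4) sub by (intro exI[of _ f]) (simp add: subset_iff)
qed

lemma root_ball_iso_mono:
  assumes "root_ball s T \<simeq> root_ball s S" "r \<le> s"
  shows "root_ball r T \<simeq> root_ball r S"
proof -
  have *: "the_root (root_ball s T) \<in> verts (root_ball s T)"
    "arcs (root_ball s T) \<subseteq> verts (root_ball s T) \<times> verts (root_ball s T)" for T :: "'c rotree"
    by (auto simp: root_ball_def Let_def intro: exI[of _ 0])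
  show ?thesis
    using rotree_iso_root_ball[OF assms(1) * *(2), of r] by (simp add: root_ball_idem assms(2))
qed

subsection \<open>Isomorphism classes and the local topology\<close>

text \<open>A Family Tree is connected and locally finite, hence countable: every isomorphism class has a
  representative with vertices in \<^typ>\<open>nat\<close>.\<close>

quotient_type ftree = "nat rotree" / partial:
  "\<lambda>T S. family_tree T \<and> family_tree S \<and> T \<simeq> S"
proof (rule part_equivpI)
  show "\<exists>T::nat rotree. family_tree T \<and> family_tree T \<and> T \<simeq> T"
    by (intro exI[of _ "\<lparr>verts = {0}, arcs = {}, sib = {}, the_root = 0\<rparr>"])
       (auto simp: family_tree_def children_def adj_def rotree_iso_refl acyclic_def)
qed (auto simp: symp_def transp_def family_tree_def intro: rotree_iso_sym rotree_iso_trans)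

definition iso_class :: "'v rotree \<Rightarrow> ftree" where
  "iso_class T = abs_ftree (SOME S. family_tree S \<and> T \<simeq> S)"

lemma iso_class_eq_iff:
  assumes T: "family_tree T" and S: "family_tree S"
  shows "iso_class T = iso_class S \<longleftrightarrow> T \<simeq> S"
proof -
  have rT: "the_root T \<in> verts T" and rS: "the_root S \<in> verts S"
    using T S by (auto simp: family_tree_def)
  let ?A = "SOME R :: nat rotree. family_tree R \<and> T \<simeq> R"
  let ?B = "SOME R :: nat rotree. family_tree R \<and> S \<simeq> R"
  have A: "family_tree ?A" "T \<simeq> ?A"
    using someI_ex[OF nat_representative[OF T]] by blast+
  have B: "family_tree ?B" "S \<simeq> ?B"
    using someI_ex[OF nat_representative[OF S]] by blast+
  have rA: "the_root ?A \<in> verts ?A" using A(1) by (simp only: family_tree_def)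
  have "iso_class T = iso_class S \<longleftrightarrow> ?A \<simeq> ?B"
    unfolding iso_class_def
    using Quotient3_rel[OF Quotient3_ftree, of ?A ?B] A(1) B(1) rotree_iso_refl[of ?A] rotree_iso_refl[of ?B]
    by blast
  also have "\<dots> \<longleftrightarrow> T \<simeq> S"
  proof
    assume "?A \<simeq> ?B"
    then show "T \<simeq> S"
      by (rule rotree_iso_trans[OF rotree_iso_trans[OF A(2)] rotree_iso_sym[OF B(2) rS]])
  next
    assume "T \<simeq> S"
    then show "?A \<simeq> ?B"
      by (rule rotree_iso_trans[OF rotree_iso_trans[OF rotree_iso_sym[OF A(2) rT]] B(2)])
  qed
  finally show ?thesis .
qed

instantiation ftree :: topological_space
begin

definition open_ftree :: "ftree set \<Rightarrow> bool" where
  "open_ftree U \<longleftrightarrow> (\<forall>t\<in>U. \<exists>r. \<forall>s.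
     root_ball r (rep_ftree s) \<simeq> root_ball r (rep_ftree t) \<longrightarrow> s \<in> U)"

instance
proof
  fix U V :: "ftree set"
  assume U: "open U" and V: "open V"
  show "open (U \<inter> V)"
    unfolding open_ftree_def
  proof
    fix t assume t: "t \<in> U \<inter> V"
    obtain r1 where r1: "\<And>s. root_ball r1 (rep_ftree s) \<simeq> root_ball r1 (rep_ftree t) \<Longrightarrow> s \<in> U"
      using U t unfolding open_ftree_def by blast
    obtain r2 where r2: "\<And>s. root_ball r2 (rep_ftree s) \<simeq> root_ball r2 (rep_ftree t) \<Longrightarrow> s \<in> V"
      using V t unfolding open_ftree_def by blast
    show "\<exists>r. \<forall>s. root_ball r (rep_ftree s) \<simeq> root_ball r (rep_ftree t) \<longrightarrow> s \<in> U \<inter> V"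
      by (intro exI[of _ "max r1 r2"] allI impI IntI r1 r2)
        (erule root_ball_iso_mono, simp)+
  qed
next
  fix K :: "ftree set set"
  assume K: "\<forall>U\<in>K. open U"
  show "open (\<Union>K)"
    unfolding open_ftree_def
  proof
    fix t assume "t \<in> \<Union>K"
    then obtain U where "U \<in> K" "t \<in> U" by blast
    then have "\<exists>r. \<forall>s. root_ball r (rep_ftree s) \<simeq> root_ball r (rep_ftree t) \<longrightarrow> s \<in> U"
      using K unfolding open_ftree_def by blast
    then show "\<exists>r. \<forall>s. root_ball r (rep_ftree s) \<simeq> root_ball r (rep_ftree t) \<longrightarrow> s \<in> \<Union>K"
      using \<open>U \<in> K\<close> by (meson UnionI)
  qed
qed (simp add: open_ftree_def)

end


section \<open>The record graph\<close>

definition record_map :: "(int \<Rightarrow> int) \<Rightarrow> int \<Rightarrow> int" where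
  "record_map x i =
     (if \<exists>j>i. 0 \<le> (\<Sum>l\<in>{i..<j}. x l) then Inf {j. i < j \<and> 0 \<le> (\<Sum>l\<in>{i..<j}. x l)} else i)"

definition record_arcs :: "(int \<Rightarrow> int) \<Rightarrow> (int \<times> int) set" where
  "record_arcs x = {(i, record_map x i) | i. record_map x i \<noteq> i}"

definition record_tree :: "(int \<Rightarrow> int) \<Rightarrow> int rotree" where
  "record_tree x =
     (let V = {v. (0, v) \<in> (record_arcs x \<union> (record_arcs x)\<inverse>)\<^sup>*};
          E = Restr (record_arcs x) V
      in \<lparr>verts = V, arcs = E, sib = {(u, w). u \<le> w \<and> (\<exists>v. (u, v) \<in> E \<and> (w, v) \<in> E)}, the_root = 0\<rparr>)"

lemma family_tree_record_tree: "family_tree (record_tree x)"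
proof -
  define V where "V = {v. (0, v) \<in> (record_arcs x \<union> (record_arcs x)\<inverse>)\<^sup>*}"
  define E where "E = Restr (record_arcs x) V"
  have T: "record_tree x = \<lparr>verts = V, arcs = E,
      sib = {(u, w). u \<le> w \<and> (\<exists>v. (u, v) \<in> E \<and> (w, v) \<in> E)}, the_root = 0\<rparr>"
    by (simp add: record_tree_def V_def E_def Let_def)
  have R: "i < j \<and> 0 \<le> sum x {i..<j} \<and> (\<forall>k. i < k \<longrightarrow> k < j \<longrightarrow> sum x {i..<k} < 0)"
    if "(i, j) \<in> record_arcs x" for i j
  proof -
    let ?J = "{j. i < j \<and> 0 \<le> sum x {i..<j}}"
    have j: "j = record_map x i" "j \<noteq> i" using that by (auto simp: record_arcs_def)
    then have ex: "?J \<noteq> {}" by (auto simp: record_map_def split: if_splits)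
    have bdd: "bdd_below ?J" by (rule bdd_belowI[of _ i]) auto
    have jI: "j = Inf ?J" using j ex by (auto simp: record_map_def split: if_splits)
    obtain k where "k \<in> ?J" "k < Inf ?J + 1"
      using cInf_lessD[OF ex, of "Inf ?J + 1"] by auto
    moreover have "Inf ?J \<le> k" using cInf_lower[OF \<open>k \<in> ?J\<close> bdd] .
    ultimately have "k = Inf ?J" by linarith
    with \<open>k \<in> ?J\<close> have "Inf ?J \<in> ?J" by metis
    moreover have "sum x {i..<k} < 0" if "i < k" "k < Inf ?J" for k
    proof (rule ccontr)
      assume "\<not> sum x {i..<k} < 0"
      then have "k \<in> ?J" using that(1) by simp
      then have "Inf ?J \<le> k" by (rule cInf_lower[OF _ bdd])
      then show False using that(2) by simp
    qed
    ultimately show ?thesis using jI by auto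
  qed
  have sv: "single_valued E" by (auto simp: E_def record_arcs_def single_valued_def)
  have lt: "E \<subseteq> {(i, j). i < j}" using R by (auto simp: E_def)
  have "acyclic E"
  proof -
    have "i < j" if "(i, j) \<in> E\<^sup>+" for i j
      using that lt by induction auto
    then show ?thesis by (auto simp: acyclic_def)
  qed
  moreover have "(0, v) \<in> (E \<union> E\<inverse>)\<^sup>*" if "v \<in> V" for v
  proof -
    have "(0, v) \<in> (record_arcs x \<union> (record_arcs x)\<inverse>)\<^sup>*" using that by (simp add: V_def)
    then show ?thesis
    proof (induction rule: rtrancl_induct)
      case (step u v)
      have "u \<in> V" "v \<in> V" using step.hyps by (auto simp: V_def intro: rtrancl_into_rtrancl)
      then have "(u, v) \<in> E \<union> E\<inverse>" using step.hyps by (auto simp: E_def)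
      then show ?case using step.IH by (rule rtrancl_into_rtrancl[rotated])
    qed simp
  qed
  moreover have fin: "finite {u. (u, j) \<in> E}" for j
  proof (rule finite_imageD)
    let ?s = "\<lambda>i. sum x {i..<j}"
    have "?s ` {u. (u, j) \<in> E} \<subseteq> {0..x (j - 1)}"
    proof safe
      fix i assume "(i, j) \<in> E"
      then have i: "(i, j) \<in> record_arcs x" by (simp add: E_def)
      have "i < j" using R[OF i] by simp
      then have "{i..<j} = insert (j - 1) {i..<j - 1}" by auto
      then have "?s i = x (j - 1) + sum x {i..<j - 1}" by simp
      moreover have "sum x {i..<j - 1} \<le> 0"
        using R[OF i] \<open>i < j\<close> by (cases "i = j - 1") (auto simp: less_le)
      ultimately show "?s i \<in> {0..x (j - 1)}" using R[OF i] by simp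
    qed
    then show "finite (?s ` {u. (u, j) \<in> E})" by (rule finite_subset) simp
    have "?s i < ?s k" if "(i, j) \<in> E" "(k, j) \<in> E" "i < k" for i k
    proof -
      have "(i, j) \<in> record_arcs x" "(k, j) \<in> record_arcs x" using that by (auto simp: E_def)
      then have "k < j" "sum x {i..<k} < 0" using R that(3) by blast+
      moreover have "{i..<j} = {i..<k} \<union> {k..<j}" using \<open>k < j\<close> that(3) by auto
      ultimately show ?thesis by (simp add: sum.union_disjoint)
    qed
    then show "inj_on ?s {u. (u, j) \<in> E}"
      unfolding inj_on_def by (metis less_irrefl linorder_neqE mem_Collect_eq)
  qed
  moreover have "linear_order_on {u. (u, v) \<in> E} (Restr {(u, w). u \<le> w \<and> (\<exists>v. (u, v) \<in> E \<and> (w, v) \<in> E)} {u. (u, v) \<in> E})" for v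
    by (auto simp: order_on_defs refl_on_def trans_def antisym_def total_on_def)
  moreover have "0 \<in> V" "E \<subseteq> V \<times> V" by (auto simp: V_def E_def)
  ultimately show ?thesis
    unfolding family_tree_def T using sv by (auto simp: children_def adj_def)
qed

definition skip_free_left_increments :: "'a measure \<Rightarrow> (int \<Rightarrow> 'a \<Rightarrow> int) \<Rightarrow> bool" where
  "skip_free_left_increments M X \<longleftrightarrow>
     prob_space M \<and>
     prob_space.indep_vars M (\<lambda>_. count_space UNIV) X UNIV \<and>
     (\<forall>n. distr M (count_space UNIV) (X n) = distr M (count_space UNIV) (X 0)) \<and>
     (\<forall>n. \<forall>\<omega>\<in>space M. -1 \<le> X n \<omega>) \<and>
     measure M {\<omega>\<in>space M. X 0 \<omega> = -1} > 0 \<and>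
     integrable M (\<lambda>\<omega>. real_of_int (X 0 \<omega>))"


section \<open>The typically rooted Galton-Watson tree\<close>

definition offspring_mean :: "nat pmf \<Rightarrow> real" where
  "offspring_mean \<pi> = measure_pmf.expectation \<pi> real"

definition size_biased :: "nat pmf \<Rightarrow> nat pmf" where
  "size_biased \<pi> = embed_pmf (\<lambda>k. real k * pmf \<pi> k / offspring_mean \<pi>)"

text \<open>A number \<open>k\<close> of children with law \<open>\<mu>\<close>, labelled \<open>0, \<dots>, k - 1\<close>, put in uniform order.\<close>

definition ordered_children :: "nat pmf \<Rightarrow> nat list pmf" where
  "ordered_children \<mu> = bind_pmf \<mu> (\<lambda>k. pmf_of_set (permutations_of_set {..<k}))"

text \<open>The vertex \<open>(0, [])\<close> is the root and \<open>(a, [])\<close> is its \<open>a\<close>-th ancestor; \<open>(a, u)\<close> with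
  \<open>u \<noteq> []\<close> is the Ulam-Harris address \<open>u\<close> below \<open>(a, [])\<close>. The child with label 0 of an ancestor
  \<open>(a, [])\<close> is the previous vertex \<open>(a - 1, [])\<close> of the ancestral line, its other labels are the
  additional children.\<close>

type_synonym tgw_vertex = "nat \<times> nat list"

definition tgw_child :: "tgw_vertex \<Rightarrow> nat \<Rightarrow> tgw_vertex" where
  "tgw_child v l = (case v of (a, u) \<Rightarrow>
     if 0 < a \<and> u = [] \<and> l = 0 then (a - 1, []) else (a, u @ [l]))"

text \<open>\<open>n\<close> is the number of ancestors of the root, \<open>c v\<close> the list of the labels of the children of
  \<open>v\<close> in increasing order of these children.\<close>

inductive_set tgw_verts :: "nat \<Rightarrow> (tgw_vertex \<Rightarrow> nat list) \<Rightarrow> tgw_vertex set"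
  for n :: nat and c :: "tgw_vertex \<Rightarrow> nat list" where
  ancestor: "a \<le> n \<Longrightarrow> (a, []) \<in> tgw_verts n c"
| child: "v \<in> tgw_verts n c \<Longrightarrow> l \<in> set (c v) \<Longrightarrow> tgw_child v l \<in> tgw_verts n c"

definition tgw_tree :: "nat \<Rightarrow> (tgw_vertex \<Rightarrow> nat list) \<Rightarrow> tgw_vertex rotree" where
  "tgw_tree n c =
     \<lparr>verts = tgw_verts n c,
      arcs = {(tgw_child v l, v) | v l. v \<in> tgw_verts n c \<and> l \<in> set (c v)},
      sib = {(tgw_child v (c v ! i), tgw_child v (c v ! j)) | v i j.
               v \<in> tgw_verts n c \<and> i \<le> j \<and> j < length (c v)},
      the_root = (0, [])\<rparr>"

lemma tgw_child_eq_iff: "tgw_child v l = tgw_child w m \<longleftrightarrow> v = w \<and> l = m"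
  by (cases v; cases w) (auto simp: tgw_child_def split: if_splits)

lemma family_tree_tgw_tree:
  assumes c: "\<And>v. distinct (c v)" and spine: "\<And>a. 0 < a \<Longrightarrow> a \<le> n \<Longrightarrow> 0 \<in> set (c (a, []))"
  shows "family_tree (tgw_tree n c)"
proof -
  let ?T = "tgw_tree n c"
  have inj: "inj (tgw_child v)" for v by (auto simp: inj_def tgw_child_eq_iff)
  have V: "verts ?T = tgw_verts n c" and r: "the_root ?T = (0, [])" by (simp_all add: tgw_tree_def)
  have arc: "(x, v) \<in> arcs ?T \<longleftrightarrow> v \<in> tgw_verts n c \<and> (\<exists>l\<in>set (c v). x = tgw_child v l)" for x v
    by (cases v) (auto simp: tgw_tree_def)
  have ch: "children ?T v = (if v \<in> tgw_verts n c then tgw_child v ` set (c v) else {})" for v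
    by (auto simp: children_def arc)
  have "arcs ?T \<subseteq> verts ?T \<times> verts ?T"
  proof (rule subsetI)
    fix p assume p: "p \<in> arcs ?T"
    obtain x v where [simp]: "p = (x, v)" by (cases p)
    then obtain l where "v \<in> tgw_verts n c" "l \<in> set (c v)" "x = tgw_child v l"
      using p arc by blast
    then show "p \<in> verts ?T \<times> verts ?T" by (simp add: V tgw_verts.child)
  qed
  moreover have "single_valued (arcs ?T)"
  proof (rule single_valuedI)
    fix x v w assume "(x, v) \<in> arcs ?T" "(x, w) \<in> arcs ?T"
    then show "v = w" unfolding arc using tgw_child_eq_iff by blast
  qed
  moreover have "acyclic (arcs ?T)"
  proof -
    define g :: "tgw_vertex \<Rightarrow> int" where "g v = int (fst v) - int (length (snd v))" for v
    have lt: "g x < g v" if "(x, v) \<in> arcs ?T" for x v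
      using that by (cases v) (auto simp: arc g_def tgw_child_def split: if_splits)
    have "g x < g v" if "(x, v) \<in> (arcs ?T)\<^sup>+" for x v
      using that by induction (auto dest: lt intro: less_trans)
    then show ?thesis by (fastforce simp: acyclic_def)
  qed
  moreover have "(the_root ?T, v) \<in> (adj ?T)\<^sup>*" if "v \<in> tgw_verts n c" for v
    using that
  proof induction
    case (ancestor a)
    then show ?case
    proof (induction a)
      case (Suc a)
      have "((a, []), (Suc a, [])) \<in> arcs ?T"
        using spine[of "Suc a"] Suc.prems tgw_verts.ancestor[OF Suc.prems, of c]
        by (auto simp: arc tgw_child_def intro!: bexI[of _ 0])
      then have "((a, []), (Suc a, [])) \<in> adj ?T" by (simp add: adj_def)
      then show ?case using Suc.IH Suc.prems by (auto intro: rtrancl_into_rtrancl)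
    qed (simp add: r)
  next
    case (child v l)
    then have "(v, tgw_child v l) \<in> adj ?T" by (auto simp: adj_def arc)
    then show ?case using child.IH by (rule rtrancl_into_rtrancl[rotated])
  qed
  moreover have "finite (children ?T v)" for v by (simp add: ch)
  moreover have "sib ?T \<subseteq> {(u, w). \<exists>v. u \<in> children ?T v \<and> w \<in> children ?T v}"
  proof safe
    fix x y assume "(x, y) \<in> sib ?T"
    then obtain v i j where *: "v \<in> tgw_verts n c" "i \<le> j" "j < length (c v)"
      "x = tgw_child v (c v ! i)" "y = tgw_child v (c v ! j)"
      by (auto simp: tgw_tree_def)
    then have "x \<in> children ?T v" "y \<in> children ?T v" by (auto simp: ch)
    then show "\<exists>v. x \<in> children ?T v \<and> y \<in> children ?T v" by blast
  qed
  moreover have "linear_order_on (children ?T v) (Restr (sib ?T) (children ?T v))"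
    if v: "v \<in> tgw_verts n c" for v
  proof -
    let ?h = "\<lambda>i. tgw_child v (c v ! i)"
    let ?N = "length (c v)"
    define Q where "Q = Restr (sib ?T) (children ?T v)"
    have "set (c v) = (!) (c v) ` {..<?N}" by (auto simp: in_set_conv_nth)
    then have C: "children ?T v = ?h ` {..<?N}"
      using v by (simp add: ch image_image)
    have sib: "p \<in> sib ?T \<longleftrightarrow> (\<exists>v i j. p = (tgw_child v (c v ! i), tgw_child v (c v ! j)) \<and>
        v \<in> tgw_verts n c \<and> i \<le> j \<and> j < length (c v))" for p
      by (simp add: tgw_tree_def)
    have hinj: "?h i = ?h j \<longleftrightarrow> i = j" if "i < ?N" "j < ?N" for i j
      using that c by (simp add: tgw_child_eq_iff nth_eq_iff_index_eq)
    have mem: "(?h i, ?h j) \<in> Q \<longleftrightarrow> i \<le> j" if ij: "i < ?N" "j < ?N" for i j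
    proof
      assume "(?h i, ?h j) \<in> Q"
      then obtain w k m where w: "?h i = tgw_child w (c w ! k)" "?h j = tgw_child w (c w ! m)"
        "k \<le> m" "m < length (c w)"
        unfolding Q_def Int_iff sib by blast
      then have "w = v" by (simp add: tgw_child_eq_iff)
      then have "i = k" "j = m" using w ij hinj[of i k] hinj[of j m] by simp_all
      then show "i \<le> j" using w by simp
    next
      assume "i \<le> j"
      then have "(?h i, ?h j) \<in> sib ?T" unfolding sib using ij v by blast
      then show "(?h i, ?h j) \<in> Q" using ij by (simp add: Q_def C)
    qed
    have Qsub: "Q \<subseteq> children ?T v \<times> children ?T v" by (auto simp: Q_def)
    have "trans Q"
    proof (rule transI)
      fix x y z assume a: "(x, y) \<in> Q" "(y, z) \<in> Q"
      then obtain i j k where "x = ?h i" "y = ?h j" "z = ?h k" "i < ?N" "j < ?N" "k < ?N"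
        using Qsub C by blast
      with a mem show "(x, z) \<in> Q" by auto
    qed
    moreover have "antisym Q"
    proof (rule antisymI)
      fix x y assume a: "(x, y) \<in> Q" "(y, x) \<in> Q"
      then obtain i j where "x = ?h i" "y = ?h j" "i < ?N" "j < ?N"
        using Qsub C by blast
      with a show "x = y" by (simp add: mem)
    qed
    moreover have "refl_on (children ?T v) Q"
      by (rule refl_onI) (auto simp: C mem)
    moreover have "total_on (children ?T v) Q"
      by (rule total_onI) (auto simp: C mem)
    ultimately show ?thesis using Qsub unfolding order_on_defs Q_def by blast
  qed
  ultimately show ?thesis
    unfolding family_tree_def V r by (auto intro: tgw_verts.ancestor)
qed

definition TGWT :: "nat pmf \<Rightarrow> ftree measure" where
  "TGWT \<pi> = distr
     (measure_pmf (geometric_pmf (1 - offspring_mean \<pi>)) \<Otimes>\<^sub>M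
      (\<Pi>\<^sub>M (a, u)\<in>UNIV. measure_pmf (ordered_children (if 0 < a \<and> u = [] then size_biased \<pi> else \<pi>))))
     borel (\<lambda>(n, c). iso_class (tgw_tree n c))"

end

theory Submission
  imports Defs
begin

text \<open>Since \<open>m < 1\<close>, the tree \<open>TGWT(\<pi>)\<close> is almost surely finite, so its law is determined by the masses
  of finite trees. A finite ordered tree with a marked vertex is coded by the word \<open>w\<close> of its offspring
  numbers in depth-first order, last child first, and the index \<open>k\<close> of the marked vertex in that order.

  Under \<open>TGWT(\<pi>)\<close> the mass of \<open>(w, k)\<close> is at most \<open>(1 - m) \<Prod> \<pi>(w\<^sub>i)\<close>: at a spine vertex with \<open>d\<close> children the
  size bias \<open>d / m\<close> is cancelled by the probability \<open>1 / d\<close> of a prescribed position of the spine child and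
  by the factor \<open>m\<close> paid for that generation.

  On the other side, the increments read from right to left are offspring numbers minus one in
  depth-first order: if \<open>x\<^bsub>k-1-i\<^esub> = w\<^sub>i - 1\<close> for all \<open>i\<close> and the walk started at \<open>k\<close> stays negative, then the
  component of 0 is the tree coded by \<open>(w, k)\<close>. By time reversal and Kraft's inequality the walk ever
  becomes nonnegative with probability at most \<open>\<Sum>\<^sub>a (a + 1) P(X\<^sub>0 = a) = m\<close>, so these disjoint events
  have probability at least \<open>(1 - m) \<Prod> \<pi>(w\<^sub>i)\<close>. Hence the law of the record tree dominates \<open>TGWT(\<pi>)\<close>, and
  two comparable probability measures coincide.\<close>

subsection \<open>Lukasiewicz words\<close>

text \<open>The estimates are deliberately one-sided. Under TGWT a union bound over codes gives the
  upper bound, while for the walk the uniqueness of codes turns the sum into the probability of a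
  disjoint union. Almost sure finiteness is proved for TGWT alone; the component of 0 inherits it
  through the comparison.

  Words read the last child first because the record graph is explored through decreasing integers:
  the vertex of index \<open>i\<close> becomes the integer \<open>k - i\<close>, and a larger
  integer is a later sibling. The stack height is then the walk read backwards, and "parent" and
  "record" become the same condition on heights.

  The branching property is replaced by cylinders: each estimate concerns an event intersected with
  a cylinder that fixes the labels already read, so that induction on the word only has to reveal
  one fresh label at a time.

  The obstacle is that the spine vertex wanders through the stack while other subtrees are explored.
  The bound for the mass of a word becomes inductive only when it is summed over all stack positions
  and all numbers of ancestors.\<close>

text \<open>The size of the depth-first stack after \<open>i\<close> vertices, started with one vertex.\<close>

definition stack_height :: "nat list \<Rightarrow> nat \<Rightarrow> int" where
  "stack_height w i = 1 + (\<Sum>l<i. int (w ! l) - 1)"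

definition lukasiewicz :: "nat list \<Rightarrow> bool" where
  "lukasiewicz w \<longleftrightarrow> (\<forall>i<length w. 0 < stack_height w i) \<and> stack_height w (length w) = 0"

text \<open>When \<open>j\<close> is popped, its children are pushed onto
  \<open>stack_height w j - 1\<close> older entries. The child with \<open>p\<close> siblings below
  it reaches the top when the height first falls to \<open>stack_height w j + p\<close>. Hence the
  parent of \<open>i\<close> is the last earlier index whose height does not exceed that of
  \<open>i\<close>.\<close>

definition parent_index :: "nat list \<Rightarrow> nat \<Rightarrow> nat \<Rightarrow> bool" where
  "parent_index w j i \<longleftrightarrow>
     j < i \<and> stack_height w j \<le> stack_height w i \<and> (\<forall>l. j < l \<and> l < i \<longrightarrow> stack_height w i < stack_height w l)"

lemma stack_height_0 [simp]: "stack_height w 0 = 1"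
  by (simp add: stack_height_def)

lemma stack_height_Suc: "stack_height w (Suc i) = stack_height w i + int (w ! i) - 1"
  by (simp add: stack_height_def)

text \<open>Index 0 has height 1 and heights inside the word are at least 1, so some earlier index
  is not higher than \<open>i\<close>; the last such index is the parent.\<close>

lemma parent_index_exists:
  assumes w: "lukasiewicz w" and i: "0 < i" "i < length w"
  shows "\<exists>j. parent_index w j i"
proof -
  let ?J = "{j. j < i \<and> stack_height w j \<le> stack_height w i}"
  have "0 < stack_height w i" using w i by (simp add: lukasiewicz_def)
  then have "0 \<in> ?J" using i by simp
  moreover have fin: "finite ?J" by simp
  ultimately have M: "Max ?J \<in> ?J" by (intro Max_in) auto
  have "stack_height w i < stack_height w l" if "Max ?J < l" "l < i" for l
  proof (rule ccontr)
    assume "\<not> stack_height w i < stack_height w l"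
    then have "l \<in> ?J" using that by simp
    then have "l \<le> Max ?J" using fin by (intro Max_ge)
    then show False using that by linarith
  qed
  then show ?thesis using M unfolding parent_index_def by blast
qed

text \<open>The height falls by at most 1 per step and ends at 0, so after \<open>j\<close> it
  cannot jump over the level \<open>stack_height w j + p\<close>: the first index at or below this
  level lies on it. The bound \<open>p < w ! j\<close> takes care of the step out of
  \<open>j\<close> itself.\<close>

lemma child_index_exists:
  assumes w: "lukasiewicz w" and j: "j < length w" and p: "p < w ! j"
  shows "\<exists>i<length w. parent_index w j i \<and> stack_height w i = stack_height w j + int p"
proof -
  let ?Q = "\<lambda>i. j < i \<and> stack_height w i \<le> stack_height w j + int p"
  define i where "i = (LEAST i. ?Q i)"
  have pos: "0 < stack_height w j" using w j by (auto simp: lukasiewicz_def)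
  then have N: "?Q (length w)" using w j by (auto simp: lukasiewicz_def)
  then have Q: "?Q i" unfolding i_def by (rule LeastI)
  have iN: "i \<le> length w" unfolding i_def using N by (rule Least_le)
  have above: "stack_height w j + int p < stack_height w l" if "j < l" "l < i" for l
    using not_less_Least[of l ?Q] that by (simp add: i_def)
  obtain i' where i': "i = Suc i'" using Q by (cases i) auto
  have eq: "stack_height w i = stack_height w j + int p"
  proof (cases "i' = j")
    case True
    then show ?thesis using Q p i' by (simp add: stack_height_Suc)
  next
    case False
    then have "stack_height w j + int p < stack_height w i'" using Q i' by (intro above) auto
    then show ?thesis using Q i' by (simp add: stack_height_Suc)
  qed
  then have "i \<noteq> length w" using w pos by (auto simp: lukasiewicz_def)
  then show ?thesis using eq Q iN above unfolding parent_index_def by (intro exI[of _ i]) auto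
qed

text \<open>Of two children of \<open>j\<close> the later one has strictly smaller height. As later
  indices are smaller integers, this matches the order of the integers with the order of positions
  in the label list.\<close>

lemma parent_index_le_iff:
  assumes "parent_index w j i" "parent_index w j i'"
  shows "i' \<le> i \<longleftrightarrow> stack_height w i \<le> stack_height w i'"
  using assms unfolding parent_index_def by (metis leD leI le_less nat_neq_iff order_refl)

subsection \<open>The record graph along a Lukasiewicz word\<close>

text \<open>The vertex of index \<open>i\<close> is the integer \<open>k - i\<close>, so index
  \<open>k\<close> is 0. The increment just to its left, at \<open>k - 1 - i\<close>, is its
  offspring number minus 1. The second clause says that \<open>k\<close> has no record, so it is the
  top of its component.\<close>

definition encodes :: "(int \<Rightarrow> int) \<Rightarrow> nat list \<Rightarrow> nat \<Rightarrow> bool" where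
  "encodes x w k \<longleftrightarrow> (\<forall>i<length w. x (int k - 1 - int i) = int (w ! i) - 1) \<and>
     (\<forall>j>int k. sum x {int k..<j} < 0)"

lemma record_arcs_iff:
  "(a, b) \<in> record_arcs x \<longleftrightarrow>
     a < b \<and> 0 \<le> sum x {a..<b} \<and> (\<forall>l. a < l \<and> l < b \<longrightarrow> sum x {a..<l} < 0)"
proof -
  let ?J = "{j. a < j \<and> 0 \<le> sum x {a..<j}}"
  have bdd: "bdd_below ?J" by (rule bdd_belowI[of _ a]) auto
  have least: "Inf ?J = b" if b: "b \<in> ?J" "\<And>j. j \<in> ?J \<Longrightarrow> b \<le> j" for b
    using b bdd by (intro cInf_eq_minimum) auto
  show ?thesis
  proof (cases "?J = {}")
    case True
    then have "record_map x a = a" by (auto simp: record_map_def)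
    then show ?thesis using True by (auto simp: record_arcs_def)
  next
    case False
    have ex: "\<exists>j>a. 0 \<le> sum x {a..<j}" using False by auto
    have "\<exists>b. b \<in> ?J \<and> (\<forall>j. j \<in> ?J \<longrightarrow> b \<le> j)"
    proof -
      obtain j0 where "j0 \<in> ?J" using False by blast
      then obtain b where b: "b \<in> ?J" "\<And>j. j \<in> ?J \<Longrightarrow> nat (b - a) \<le> nat (j - a)"
        using ex_has_least_nat[of "\<lambda>j. j \<in> ?J" j0 "\<lambda>j. nat (j - a)"] by blast
      have "b \<le> j" if "j \<in> ?J" for j using b(1) b(2)[OF that] that by (auto simp: nat_le_iff)
      then show ?thesis using b(1) by blast
    qed
    then obtain b0 where b0: "b0 \<in> ?J" "\<And>j. j \<in> ?J \<Longrightarrow> b0 \<le> j" by blast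
    have R: "record_map x a = b0" using ex least[OF b0] by (auto simp: record_map_def)
    show ?thesis
    proof
      assume "(a, b) \<in> record_arcs x"
      then have "b = b0" using R by (auto simp: record_arcs_def)
      then show "a < b \<and> 0 \<le> sum x {a..<b} \<and> (\<forall>l. a < l \<and> l < b \<longrightarrow> sum x {a..<l} < 0)"
        using b0 by (smt (verit) mem_Collect_eq)
    next
      assume *: "a < b \<and> 0 \<le> sum x {a..<b} \<and> (\<forall>l. a < l \<and> l < b \<longrightarrow> sum x {a..<l} < 0)"
      have "b0 \<le> b" using * b0(2) by simp
      moreover have "\<not> b0 < b" using * b0(1) by (auto simp: not_less)
      ultimately have "b0 = b" by simp
      then show "(a, b) \<in> record_arcs x" using R * by (auto simp: record_arcs_def)
    qed
  qed
qed

text \<open>The dictionary between walk and stack: read from right to left, the walk moves like the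
  stack height. A record, being the first nonnegative sum, thereby becomes the comparison of heights
  in \<open>parent_index\<close>.\<close>

lemma sum_encodes:
  assumes "encodes x w k" "j \<le> i" "i \<le> length w"
  shows "sum x {int k - int i..<int k - int j} = stack_height w i - stack_height w j"
  using assms(2,3)
proof (induction i rule: dec_induct)
  case (step i)
  have "{int k - int (Suc i)..<int k - int j} = insert (int k - int (Suc i)) {int k - int i..<int k - int j}"
    using step.hyps by auto
  moreover have "x (int k - int (Suc i)) = int (w ! i) - 1"
    using assms(1) step.prems by (simp add: encodes_def algebra_simps)
  ultimately show ?case using step by (simp add: stack_height_Suc)
qed simp

lemma record_arcs_encodes:
  assumes x: "encodes x w k" and ij: "i < length w" "j < length w"
  shows "(int k - int i, int k - int j) \<in> record_arcs x \<longleftrightarrow> parent_index w j i"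
proof
  assume *: "(int k - int i, int k - int j) \<in> record_arcs x"
  then have "j < i" by (simp add: record_arcs_iff)
  moreover have "stack_height w i < stack_height w l" if "j < l" "l < i" for l
  proof -
    have "sum x {int k - int i..<int k - int l} < 0" using * that by (simp add: record_arcs_iff)
    then show ?thesis using sum_encodes[OF x, of l i] that ij by simp
  qed
  ultimately show "parent_index w j i"
    using * sum_encodes[OF x, of j i] ij by (simp add: parent_index_def record_arcs_iff)
next
  assume *: "parent_index w j i"
  have "sum x {int k - int i..<l} < 0" if l: "int k - int i < l" "l < int k - int j" for l
  proof -
    define l' where "l' = nat (int k - l)"
    have l': "l = int k - int l'" "j < l'" "l' < i" using l by (auto simp: l'_def)
    then have "stack_height w i < stack_height w l'" using * by (simp add: parent_index_def)
    then show ?thesis using sum_encodes[OF x, of l' i] l' ij by simp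
  qed
  then show "(int k - int i, int k - int j) \<in> record_arcs x"
    using * sum_encodes[OF x, of j i] ij by (simp add: record_arcs_iff parent_index_def)
qed

lemma record_arcs_encodes_top:
  assumes x: "encodes x w k"
  shows "(int k, b) \<notin> record_arcs x"
  using assms by (force simp: record_arcs_iff encodes_def)

text \<open>From the left end of the block up to \<open>k - j\<close> the walk loses
  \<open>stack_height w j > 0\<close>. A start further left is still negative when it enters the
  block, so it cannot have its record at \<open>k - j\<close>.\<close>

lemma record_arcs_into_encodes:
  assumes w: "lukasiewicz w" and x: "encodes x w k" and j: "j < length w"
    and a: "(a, int k - int j) \<in> record_arcs x"
  shows "\<exists>i<length w. a = int k - int i"
proof (rule ccontr)
  let ?N = "length w"
  assume neg: "\<not> ?thesis"
  have lt: "a < int k - int j" using a by (simp add: record_arcs_iff)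
  have "a \<le> int k - int ?N"
  proof (rule ccontr)
    assume "\<not> a \<le> int k - int ?N"
    then have "nat (int k - a) < ?N" "a = int k - int (nat (int k - a))" using lt by auto
    then show False using neg by blast
  qed
  have s: "sum x {int k - int ?N..<int k - int j} = - stack_height w j"
    using sum_encodes[OF x, of j ?N] j w by (simp add: lukasiewicz_def)
  have pos: "0 < stack_height w j" using w j by (simp add: lukasiewicz_def)
  show False
  proof (cases "a = int k - int ?N")
    case True
    then show ?thesis using a s pos by (simp add: record_arcs_iff)
  next
    case False
    then have a': "a < int k - int ?N" using \<open>a \<le> _\<close> by simp
    then have "sum x {a..<int k - int ?N} < 0" using a j by (simp add: record_arcs_iff)
    moreover have "sum x {a..<int k - int j} = sum x {a..<int k - int ?N} + sum x {int k - int ?N..<int k - int j}"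
      using a' j by (subst sum.union_disjoint[symmetric]) (auto intro!: sum.cong)
    ultimately show ?thesis using a s pos by (simp add: record_arcs_iff)
  qed
qed

text \<open>The block of integers carrying the word is closed under arcs in both directions;
  conversely, each of its integers, 0 included, climbs to \<open>k\<close> by iterating
  parents.\<close>

lemma verts_record_tree_encodes:
  assumes w: "lukasiewicz w" and x: "encodes x w k" and k: "k < length w"
  shows "verts (record_tree x) = (\<lambda>i. int k - int i) ` {..<length w}" (is "_ = ?f ` ?I")
proof -
  let ?A = "record_arcs x \<union> (record_arcs x)\<inverse>"
  have V: "verts (record_tree x) = {v. (0, v) \<in> ?A\<^sup>*}" by (simp add: record_tree_def Let_def)
  have "v \<in> ?f ` ?I" if "(0, v) \<in> ?A\<^sup>*" for v
    using that
  proof (induction rule: rtrancl_induct)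
    case base
    then show ?case using k by (auto intro!: image_eqI[of _ _ k])
  next
    case (step u v)
    then obtain i where i: "i < length w" "u = int k - int i" by auto
    from step.hyps(2) consider "(u, v) \<in> record_arcs x" | "(v, u) \<in> record_arcs x" by auto
    then show ?case
    proof cases
      case 1
      then have "0 < i" using i record_arcs_encodes_top[OF x] by (cases i) auto
      then obtain j where j: "parent_index w j i" using parent_index_exists[OF w] i by blast
      then have "j < length w" using i by (simp add: parent_index_def)
      with j have "(u, int k - int j) \<in> record_arcs x" using record_arcs_encodes[OF x] i by simp
      with 1 have "v = int k - int j" by (auto simp: record_arcs_def)
      then show ?thesis using \<open>j < length w\<close> by auto
    next
      case 2
      then show ?thesis using record_arcs_into_encodes[OF w x i(1)] i(2) by auto
    qed
  qed
  moreover have up: "(int k - int i, int k) \<in> (record_arcs x)\<^sup>*" if "i < length w" for i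
    using that
  proof (induction i rule: less_induct)
    case (less i)
    show ?case
    proof (cases "i = 0")
      case False
      then obtain j where j: "parent_index w j i" using parent_index_exists[OF w] less.prems by blast
      then have ji: "j < i" by (simp add: parent_index_def)
      then have "(int k - int i, int k - int j) \<in> record_arcs x"
        using j record_arcs_encodes[OF x] less.prems by simp
      then show ?thesis using less.IH[OF ji] ji less.prems by (auto intro: converse_rtrancl_into_rtrancl)
    qed simp
  qed
  have "(0, int k - int i) \<in> ?A\<^sup>*" if "i < length w" for i
  proof -
    have "(0, int k) \<in> ?A\<^sup>*"
      using up[OF k] rtrancl_mono[of "record_arcs x" ?A] by auto
    moreover have "(int k, int k - int i) \<in> ((record_arcs x)\<inverse>)\<^sup>*"
      using up[OF that] by (simp add: rtrancl_converse)
    then have "(int k, int k - int i) \<in> ?A\<^sup>*"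
      using rtrancl_mono[of "(record_arcs x)\<inverse>" ?A] by auto
    ultimately show ?thesis by (rule rtrancl_trans)
  qed
  ultimately show ?thesis unfolding V by auto
qed

text \<open>If \<open>k < k'\<close>, the walk from \<open>k\<close> to \<open>k'\<close> gains
  \<open>stack_height w' (k' - k) - 1\<close>, which is nonnegative, although \<open>k\<close> has
  no record. With \<open>k\<close> fixed, the length is the first time at which the height is 0, and
  the letters are read off \<open>x\<close>. This makes the events of different codes
  disjoint.\<close>

lemma encodes_unique:
  assumes w: "lukasiewicz w" "k < length w" "encodes x w k"
    and w': "lukasiewicz w'" "k' < length w'" "encodes x w' k'"
  shows "w = w' \<and> k = k'"
proof -
  have k_le: "\<not> k < k'" if w: "encodes x w k"
    and w': "lukasiewicz w'" "k' < length w'" "encodes x w' k'" for w w' k k'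
  proof
    assume "k < k'"
    then have "sum x {int k..<int k'} = stack_height w' (k' - k) - 1"
      using sum_encodes[OF w'(3), of 0 "k' - k"] w'(2) by (simp add: of_nat_diff)
    moreover have "0 < stack_height w' (k' - k)" using w' by (simp add: lukasiewicz_def)
    moreover have "sum x {int k..<int k'} < 0" using w \<open>k < k'\<close> by (simp add: encodes_def)
    ultimately show False by simp
  qed
  have k: "k = k'" using k_le[OF w(3) w'] k_le[OF w'(3) w] by simp
  have len_le: "\<not> length w < length w'" if w: "lukasiewicz w" "encodes x w k"
    and w': "lukasiewicz w'" "encodes x w' k" for w w'
  proof
    assume "length w < length w'"
    then have "stack_height w' (length w) = stack_height w (length w)"
      using sum_encodes[OF w(2), of 0 "length w"] sum_encodes[OF w'(2), of 0 "length w"] by simp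
    moreover have "0 < stack_height w' (length w)" using w'(1) \<open>length w < length w'\<close> by (simp add: lukasiewicz_def)
    ultimately show False using w(1) by (simp add: lukasiewicz_def)
  qed
  have len: "length w = length w'"
    using len_le[OF w(1,3), of w'] len_le[of w' w] w w' k by force
  moreover have "w ! i = w' ! i" if "i < length w" for i
  proof -
    have "x (int k - 1 - int i) = int (w ! i) - 1" using w that by (simp add: encodes_def)
    moreover have "x (int k - 1 - int i) = int (w' ! i) - 1" using w' that len k by (simp add: encodes_def)
    ultimately show ?thesis by simp
  qed
  ultimately show ?thesis using k by (simp add: nth_equalityI)
qed

subsection \<open>Depth-first exploration\<close>

text \<open>Stacks have their top first, so \<open>rev\<close> puts the last child on top: this is
  the order of decreasing integers in the record graph.\<close>

definition explore_step :: "(tgw_vertex \<Rightarrow> nat list) \<Rightarrow> tgw_vertex list \<Rightarrow> tgw_vertex list" where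
  "explore_step c vs = (case vs of [] \<Rightarrow> [] | v # vs' \<Rightarrow> map (tgw_child v) (rev (c v)) @ vs')"

fun explores :: "(tgw_vertex \<Rightarrow> nat list) \<Rightarrow> tgw_vertex list \<Rightarrow> nat list \<Rightarrow> bool" where
  "explores c vs [] \<longleftrightarrow> vs = []"
| "explores c vs (d # w) \<longleftrightarrow>
     vs \<noteq> [] \<and> length (c (hd vs)) = d \<and> explores c (explore_step c vs) w"

lemma explores_nth:
  assumes "explores c vs w"
  shows "\<forall>i<length w. (explore_step c ^^ i) vs \<noteq> [] \<and> length (c (hd ((explore_step c ^^ i) vs))) = w ! i"
    and "(explore_step c ^^ length w) vs = []"
proof -
  have "(\<forall>i<length w. (explore_step c ^^ i) vs \<noteq> [] \<and> length (c (hd ((explore_step c ^^ i) vs))) = w ! i)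
      \<and> (explore_step c ^^ length w) vs = []"
    using assms
  proof (induction w arbitrary: vs)
    case (Cons d w)
    then show ?case by (auto simp: less_Suc_eq_0_disj funpow_swap1)
  qed simp
  then show "\<forall>i<length w. (explore_step c ^^ i) vs \<noteq> [] \<and> length (c (hd ((explore_step c ^^ i) vs))) = w ! i"
    and "(explore_step c ^^ length w) vs = []" by auto
qed

definition proper_labels :: "nat \<Rightarrow> (tgw_vertex \<Rightarrow> nat list) \<Rightarrow> bool" where
  "proper_labels n c \<longleftrightarrow> (\<forall>v. distinct (c v)) \<and> (\<forall>a. 0 < a \<and> a \<le> n \<longrightarrow> 0 \<in> set (c (a, [])))"

definition rank :: "tgw_vertex \<Rightarrow> int" where
  "rank v = int (fst v) - int (length (snd v))"

lemma rank_child: "rank (tgw_child v l) = rank v - 1"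
  by (cases v) (auto simp: rank_def tgw_child_def)

locale exploration =
  fixes n :: nat and c :: "tgw_vertex \<Rightarrow> nat list" and w :: "nat list"
  assumes proper: "proper_labels n c" and explores: "explores c [(n, [])] w"
begin

definition stack :: "nat \<Rightarrow> tgw_vertex list" where
  "stack i = (explore_step c ^^ i) [(n, [])]"

definition visited :: "nat \<Rightarrow> tgw_vertex" where
  "visited i = hd (stack i)"

lemma stack_0: "stack 0 = [(n, [])]"
  by (simp add: stack_def)

lemma stack_nonempty: "i < length w \<Longrightarrow> stack i \<noteq> []"
  using explores_nth(1)[OF explores] by (simp add: stack_def)

lemma length_labels: "i < length w \<Longrightarrow> length (c (visited i)) = w ! i"
  using explores_nth(1)[OF explores] by (simp add: stack_def visited_def)

lemma stack_length: "stack (length w) = []"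
  using explores_nth(2)[OF explores] by (simp add: stack_def)

lemma stack_Suc:
  "i < length w \<Longrightarrow> stack (Suc i) = map (tgw_child (visited i)) (rev (c (visited i))) @ tl (stack i)"
  using stack_nonempty[of i]
  by (cases "stack i") (auto simp: explore_step_def stack_def visited_def)

lemma length_stack: "i \<le> length w \<Longrightarrow> int (length (stack i)) = stack_height w i"
proof (induction i)
  case (Suc i)
  then have "int (length (stack i)) = stack_height w i" "stack i \<noteq> []" using stack_nonempty by auto
  then show ?case
    using Suc.prems by (simp add: stack_Suc stack_height_Suc length_labels of_nat_diff Suc_le_eq)
qed (simp add: stack_0)

lemma lukasiewicz: "lukasiewicz w"
  unfolding lukasiewicz_def
proof (intro conjI allI impI)
  fix i assume i: "i < length w"
  have "0 < length (stack i)" using stack_nonempty[OF i] by simp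
  then show "0 < stack_height w i" using length_stack[of i] i by linarith
next
  show "stack_height w (length w) = 0"
    using length_stack[of "length w"] by (simp add: stack_length)
qed

lemma length_w: "0 < length w"
  using explores by (cases w) auto

text \<open>A step pops only the top entry, so the lowest \<open>s\<close> entries survive as long
  as the height exceeds \<open>s\<close>. The bottom is the end of the list, hence
  \<open>rev\<close>.\<close>

lemma stack_bottom:
  assumes "j \<le> i" "i \<le> length w" "\<And>l. j \<le> l \<Longrightarrow> l < i \<Longrightarrow> s < length (stack l)"
  shows "take s (rev (stack i)) = take s (rev (stack j))"
  using assms
proof (induction i rule: dec_induct)
  case (step i)
  obtain v vs where st: "stack i = v # vs"
    using stack_nonempty[of i] step.prems by (cases "stack i") auto
  have "s < length (stack i)" using step.prems(2)[of i] step.hyps by simp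
  then have "take s (rev (stack (Suc i))) = take s (rev (stack i))"
    using step.prems(1) st by (simp add: stack_Suc)
  then show ?case using step by simp
qed simp

text \<open>Just after step \<open>j\<close> the reversed stack consists of
  \<open>stack_height w j - 1\<close> older entries followed by the children of
  \<open>visited j\<close> in their order. Until \<open>i\<close> nothing up to the height of
  \<open>i\<close> is touched, so the top at \<open>i\<close> is the entry at position
  \<open>stack_height w i - 1\<close>, which is child number \<open>p\<close>.\<close>

lemma visited_child:
  assumes ji: "parent_index w j i" and i: "i < length w"
  defines "p \<equiv> nat (stack_height w i - stack_height w j)"
  shows "visited i = tgw_child (visited j) (c (visited j) ! p)" "p < length (c (visited j))"
proof -
  have j: "j < i" "stack_height w j \<le> stack_height w i" and above: "\<And>l. j < l \<Longrightarrow> l < i \<Longrightarrow> stack_height w i < stack_height w l"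
    using ji by (auto simp: parent_index_def)
  let ?h = "\<lambda>i. length (stack i)"
  have h: "int (?h l) = stack_height w l" if "l \<le> i" for l using length_stack that i by simp
  have p: "p = ?h i - ?h j" using h[of i] h[of j] j by (simp add: p_def nat_diff_distrib flip: h)
  have hij: "?h j \<le> ?h i" using h[of i] h[of j] j by linarith
  have "?h i \<le> ?h (Suc j)"
  proof (cases "i = Suc j")
    case False
    then have "stack_height w i < stack_height w (Suc j)" using j by (intro above) auto
    then show ?thesis using h[of i] h[of "Suc j"] j by linarith
  qed simp
  have pos: "0 < ?h j" using stack_nonempty[of j] j i by simp
  have rev_Suc: "rev (stack (Suc j)) = rev (tl (stack j)) @ map (tgw_child (visited j)) (c (visited j))"
    using j i by (simp add: stack_Suc rev_map)
  have "take (?h i) (rev (stack i)) = take (?h i) (rev (stack (Suc j)))"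
  proof (rule stack_bottom)
    fix l assume "Suc j \<le> l" "l < i"
    then show "?h i < ?h l" using above[of l] h[of i] h[of l] by simp
  qed (use j i in auto)
  then have rev_i: "rev (stack i) = take (?h i) (rev (stack (Suc j)))" by simp
  have "?h (Suc j) = ?h j - 1 + length (c (visited j))"
    using j i by (simp add: stack_Suc)
  then show plt: "p < length (c (visited j))"
    using \<open>?h i \<le> ?h (Suc j)\<close> hij pos p by linarith
  have "visited i = rev (stack i) ! (?h i - 1)"
    using stack_nonempty[OF i] by (simp add: visited_def rev_nth hd_conv_nth)
  also have "\<dots> = rev (stack (Suc j)) ! (?h i - 1)"
  proof -
    have "?h i - 1 < ?h i" using hij pos by linarith
    then show ?thesis by (subst rev_i) (rule nth_take)
  qed
  also have "?h i - 1 = length (rev (tl (stack j))) + p"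
  proof -
    have "length (rev (tl (stack j))) = ?h j - 1" by simp
    then show ?thesis using hij pos p by linarith
  qed
  also have "rev (stack (Suc j)) ! \<dots> = tgw_child (visited j) (c (visited j) ! p)"
    using plt by (simp add: rev_Suc nth_append)
  finally show "visited i = tgw_child (visited j) (c (visited j) ! p)" .
qed

lemma visited_0: "visited 0 = (n, [])"
  by (simp add: visited_def stack_0)

text \<open>Parents are visited before their children and rank one higher, so no index but 0 can
  visit the top vertex \<open>(n, [])\<close>.\<close>

lemma rank_visited: "i < length w \<Longrightarrow> 0 < i \<Longrightarrow> rank (visited i) < int n"
proof (induction i rule: less_induct)
  case (less i)
  then obtain j where j: "parent_index w j i" using parent_index_exists[OF lukasiewicz] by blast
  then have "j < i" by (simp add: parent_index_def)
  have "rank (visited i) = rank (visited j) - 1"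
    using visited_child(1)[OF j less.prems(1)] by (simp add: rank_child)
  moreover have "rank (visited j) \<le> int n"
    using less.IH[OF \<open>j < i\<close>] less.prems \<open>j < i\<close> by (cases "j = 0") (auto simp: visited_0 rank_def)
  ultimately show ?case by simp
qed

text \<open>Induction on the later index: equal vertices have equal parents and equal labels. The
  parents then share an index \<open>j\<close>, and distinctness of the labels gives equal offsets,
  hence equal heights, whereas two children of \<open>j\<close> have different heights.\<close>

lemma inj_visited: "inj_on visited {..<length w}"
proof -
  have "visited i \<noteq> visited i'" if "i < i'" "i' < length w" for i i'
    using that
  proof (induction i' arbitrary: i rule: less_induct)
    case (less i')
    show ?case
    proof (cases "i = 0")
      case True
      then have "rank (visited i') < rank (visited i)"
        using rank_visited[of i'] less.prems by (simp add: visited_0 rank_def)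
      then show ?thesis by auto
    next
      case False
      obtain j where j: "parent_index w j i"
        using parent_index_exists[OF lukasiewicz, of i] False less.prems by auto
      obtain j' where j': "parent_index w j' i'"
        using parent_index_exists[OF lukasiewicz, of i'] less.prems by auto
      have lt: "j < i" "j' < i'" using j j' by (auto simp: parent_index_def)
      show ?thesis
      proof
        assume eq: "visited i = visited i'"
        have v: "visited j = visited j'"
          "c (visited j) ! nat (stack_height w i - stack_height w j) = c (visited j') ! nat (stack_height w i' - stack_height w j')"
          using eq visited_child(1)[OF j] visited_child(1)[OF j'] less.prems by (auto simp: tgw_child_eq_iff)
        have jj: "j = j'"
          using less.IH[of j' j] less.IH[of j j'] v(1) lt less.prems
          by (cases j j' rule: linorder_cases) auto
        have "distinct (c (visited j))" using proper unfolding proper_labels_def by blast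
        then have "nat (stack_height w i - stack_height w j) = nat (stack_height w i' - stack_height w j)"
          using v(2) visited_child(2)[OF j] visited_child(2)[OF j'] less.prems jj
          by (simp add: nth_eq_iff_index_eq)
        then have "stack_height w i = stack_height w i'"
          using j j' jj by (simp add: parent_index_def eq_nat_nat_iff)
        moreover have "stack_height w i' < stack_height w i"
          using j' jj lt less.prems by (simp add: parent_index_def)
        ultimately show False by simp
      qed
    qed
  qed
  then show ?thesis by (intro linorder_inj_onI) auto
qed

lemma visited_eq_child_iff:
  assumes i: "i < length w" and j: "j < length w" and l: "p < length (c (visited j))"
  shows "visited i = tgw_child (visited j) (c (visited j) ! p) \<longleftrightarrow>
    parent_index w j i \<and> stack_height w i = stack_height w j + int p"
proof
  assume eq: "visited i = tgw_child (visited j) (c (visited j) ! p)"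
  then have rk: "rank (visited i) = rank (visited j) - 1" by (simp add: rank_child)
  have "rank (visited j) \<le> int n"
    using rank_visited[OF j] by (cases "j = 0") (auto simp: visited_0 rank_def)
  with rk have "0 < i" by (cases "i = 0") (auto simp: visited_0 rank_def)
  then obtain j' where j': "parent_index w j' i"
    using parent_index_exists[OF lukasiewicz] i by blast
  have "j' < length w" using j' i by (simp add: parent_index_def)
  moreover have *: "visited j = visited j'"
    "c (visited j) ! p = c (visited j') ! nat (stack_height w i - stack_height w j')"
    using visited_child(1)[OF j' i] eq by (auto simp: tgw_child_eq_iff)
  ultimately have jj: "j = j'" using inj_onD[OF inj_visited, of j j'] j by simp
  have "distinct (c (visited j))" using proper unfolding proper_labels_def by blast
  then have "p = nat (stack_height w i - stack_height w j)"
    using * jj l visited_child(2)[OF j' i] by (simp add: nth_eq_iff_index_eq)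
  then show "parent_index w j i \<and> stack_height w i = stack_height w j + int p"
    using j' jj by (simp add: parent_index_def)
next
  assume "parent_index w j i \<and> stack_height w i = stack_height w j + int p"
  then show "visited i = tgw_child (visited j) (c (visited j) ! p)"
    using visited_child(1)[of j i] i by simp
qed

lemma tgw_verts_eq: "tgw_verts n c = visited ` {..<length w}"
proof
  have closed: "tgw_child (visited j) l \<in> visited ` {..<length w}"
    if j: "j < length w" and l: "l \<in> set (c (visited j))" for j l
  proof -
    obtain p where p: "p < length (c (visited j))" "l = c (visited j) ! p"
      using l by (metis in_set_conv_nth)
    then obtain i where "i < length w" "parent_index w j i" "stack_height w i = stack_height w j + int p"
      using child_index_exists[OF lukasiewicz j, of p] j by (auto simp: length_labels)
    then show ?thesis using visited_eq_child_iff[OF _ j p(1), of i] p(2) by (metis imageI lessThan_iff)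
  qed
  \<comment> \<open>Descends from the top ancestor: properness supplies label 0, which leads from
    each spine vertex to the next one.\<close>
  have anc: "(n - a, []) \<in> visited ` {..<length w}" if "a \<le> n" for a
    using that
  proof (induction a)
    case 0
    then show ?case using visited_0 length_w by (auto intro!: image_eqI[of _ _ 0])
  next
    case (Suc a)
    then obtain j where j: "j < length w" "visited j = (n - a, [])" by fastforce
    have "0 \<in> set (c (n - a, []))" using proper Suc.prems by (simp add: proper_labels_def)
    then have "tgw_child (n - a, []) 0 \<in> visited ` {..<length w}" using closed[OF j(1)] j(2) by simp
    moreover have "tgw_child (n - a, []) 0 = (n - Suc a, [])" using Suc.prems by (simp add: tgw_child_def)
    ultimately show ?case by simp
  qed
  show "tgw_verts n c \<subseteq> visited ` {..<length w}"
  proof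
    fix v assume "v \<in> tgw_verts n c"
    then show "v \<in> visited ` {..<length w}"
    proof induction
      case (ancestor a)
      then show ?case using anc[of "n - a"] by simp
    next
      case (child v l)
      then show ?case using closed by auto
    qed
  qed
  have "visited i \<in> tgw_verts n c" if "i < length w" for i
    using that
  proof (induction i rule: less_induct)
    case (less i)
    show ?case
    proof (cases "i = 0")
      case True
      then show ?thesis by (simp add: visited_0 tgw_verts.ancestor)
    next
      case False
      then obtain j where j: "parent_index w j i"
        using parent_index_exists[OF lukasiewicz] less.prems by blast
      then have "visited j \<in> tgw_verts n c" using less by (simp add: parent_index_def)
      then show ?thesis
        using visited_child[OF j less.prems] by (metis nth_mem tgw_verts.child)
    qed
  qed
  then show "visited ` {..<length w} \<subseteq> tgw_verts n c" by auto
qed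

lemma record_tree_iso:
  assumes x: "encodes x w k" and k: "k < length w" "visited k = (0, [])"
  shows "record_tree x \<simeq> tgw_tree n c"
proof -
  let ?I = "{..<length w}" and ?z = "\<lambda>i. int k - int i"
  let ?f = "\<lambda>y. visited (nat (int k - y))"
  have V: "verts (record_tree x) = ?z ` ?I"
    by (rule verts_record_tree_encodes[OF lukasiewicz x k(1)])
  have fz: "?f (?z i) = visited i" for i by simp
  have arcT: "(u, v) \<in> arcs (record_tree x) \<longleftrightarrow> (u, v) \<in> record_arcs x"
    if "u \<in> verts (record_tree x)" "v \<in> verts (record_tree x)" for u v
    using that by (auto simp: record_tree_def Let_def)
  have arcsub: "u \<in> verts (record_tree x) \<and> v \<in> verts (record_tree x)" if "(u, v) \<in> arcs (record_tree x)" for u v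
    using that by (auto simp: record_tree_def Let_def)
  have arc: "(?z i, ?z j) \<in> arcs (record_tree x) \<longleftrightarrow> parent_index w j i" if "i \<in> ?I" "j \<in> ?I" for i j
    using that record_arcs_encodes[OF x, of i j] arcT[of "?z i" "?z j"] by (auto simp: V)
  have child: "parent_index w j i \<longleftrightarrow> (\<exists>l\<in>set (c (visited j)). visited i = tgw_child (visited j) l)"
    if "i \<in> ?I" "j \<in> ?I" for i j
    using that visited_child[of j i] visited_eq_child_iff[of i j]
    by (metis in_set_conv_nth lessThan_iff)
  show ?thesis
    unfolding rotree_iso_def
  proof (intro exI[of _ ?f] conjI ballI)
    have "bij_betw ?z ?I (verts (record_tree x))" by (auto simp: V bij_betw_def inj_on_def)
    moreover have "bij_betw (?f \<circ> ?z) ?I (verts (tgw_tree n c))"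
      using inj_visited by (simp add: bij_betw_def tgw_tree_def tgw_verts_eq comp_def)
    ultimately show "bij_betw ?f (verts (record_tree x)) (verts (tgw_tree n c))"
      by (simp add: bij_betw_comp_iff)
    show "?f (the_root (record_tree x)) = the_root (tgw_tree n c)"
      using k by (simp add: record_tree_def tgw_tree_def Let_def)
    fix u v assume uv: "u \<in> verts (record_tree x)" "v \<in> verts (record_tree x)"
    then obtain i i' where i: "i \<in> ?I" "u = ?z i" and i': "i' \<in> ?I" "v = ?z i'"
      by (auto simp: V)
    have "(u, v) \<in> arcs (record_tree x) \<longleftrightarrow> (\<exists>l\<in>set (c (visited i')). visited i = tgw_child (visited i') l)"
      using i i' arc child by simp
    also have "\<dots> \<longleftrightarrow> (visited i, visited i') \<in> arcs (tgw_tree n c)"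
      using i' by (auto simp: tgw_tree_def tgw_verts_eq tgw_child_eq_iff simp del: split_paired_Ex)
    finally show "(u, v) \<in> arcs (record_tree x) \<longleftrightarrow> (?f u, ?f v) \<in> arcs (tgw_tree n c)"
      using i i' by simp
    \<comment> \<open>Larger integers have smaller indices, so \<open>u \<le> v\<close> becomes
      \<open>i' \<le> i\<close>. By \<open>parent_index_le_iff\<close> this compares heights, which
      are positions in the label list up to a shift.\<close>
    have "(u, v) \<in> sib (record_tree x) \<longleftrightarrow> u \<le> v \<and> (\<exists>y. (u, y) \<in> arcs (record_tree x) \<and> (v, y) \<in> arcs (record_tree x))"
      by (simp add: record_tree_def Let_def)
    also have "\<dots> \<longleftrightarrow> i' \<le> i \<and> (\<exists>j\<in>?I. parent_index w j i \<and> parent_index w j i')"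
    proof -
      have "(\<exists>y. (u, y) \<in> arcs (record_tree x) \<and> (v, y) \<in> arcs (record_tree x)) \<longleftrightarrow>
          (\<exists>j\<in>?I. (u, ?z j) \<in> arcs (record_tree x) \<and> (v, ?z j) \<in> arcs (record_tree x))"
      proof -
        have "(\<exists>y. (u, y) \<in> arcs (record_tree x) \<and> (v, y) \<in> arcs (record_tree x)) \<longleftrightarrow>
          (\<exists>y\<in>verts (record_tree x). (u, y) \<in> arcs (record_tree x) \<and> (v, y) \<in> arcs (record_tree x))"
          using arcsub by blast
        then show ?thesis by (simp add: V)
      qed
      then show ?thesis using i i' arc by auto
    qed
    also have "\<dots> \<longleftrightarrow> (visited i, visited i') \<in> sib (tgw_tree n c)"
    proof
      assume "i' \<le> i \<and> (\<exists>j\<in>?I. parent_index w j i \<and> parent_index w j i')"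
      then obtain j where j: "j \<in> ?I" "parent_index w j i" "parent_index w j i'" and le: "i' \<le> i" by blast
      have "stack_height w i \<le> stack_height w i'" using parent_index_le_iff[OF j(2,3)] le by simp
      then have "\<exists>v p q. (visited i, visited i') = (tgw_child v (c v ! p), tgw_child v (c v ! q)) \<and>
          v \<in> tgw_verts n c \<and> p \<le> q \<and> q < length (c v)"
        using visited_child[OF j(2)] visited_child[OF j(3)] i i' j(1)
        by (intro exI[of _ "visited j"] exI[of _ "nat (stack_height w i - stack_height w j)"]
            exI[of _ "nat (stack_height w i' - stack_height w j)"]) (auto simp: tgw_verts_eq)
      then show "(visited i, visited i') \<in> sib (tgw_tree n c)"
        by (simp add: tgw_tree_def del: split_paired_Ex prod.inject)
    next
      assume "(visited i, visited i') \<in> sib (tgw_tree n c)"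
      then obtain j p q where *: "j \<in> ?I" "p \<le> q" "q < length (c (visited j))"
        "visited i = tgw_child (visited j) (c (visited j) ! p)"
        "visited i' = tgw_child (visited j) (c (visited j) ! q)"
        by (auto simp: tgw_tree_def tgw_verts_eq)
      then have "parent_index w j i" "parent_index w j i'" "stack_height w i = stack_height w j + int p"
        "stack_height w i' = stack_height w j + int q"
        using visited_eq_child_iff[of i j p] visited_eq_child_iff[of i' j q] i i' by auto
      then show "i' \<le> i \<and> (\<exists>j\<in>?I. parent_index w j i \<and> parent_index w j i')"
        using parent_index_le_iff[of w j i i'] * by auto
    qed
    finally show "(u, v) \<in> sib (record_tree x) \<longleftrightarrow> (?f u, ?f v) \<in> sib (tgw_tree n c)"
      using i i' by simp
  qed
qed

end

subsection \<open>Products of probability mass functions\<close>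

abbreviation PiM_pmf :: "('i \<Rightarrow> 'b pmf) \<Rightarrow> ('i \<Rightarrow> 'b) measure" where
  "PiM_pmf p \<equiv> \<Pi>\<^sub>M i\<in>UNIV. measure_pmf (p i)"

lemma space_PiM_pmf [simp]: "space (PiM_pmf p) = UNIV"
  by (simp add: space_PiM PiE_def extensional_def)

lemma measurable_PiM_pmf_component [measurable]:
  "(\<lambda>c. c i) \<in> PiM_pmf p \<rightarrow>\<^sub>M count_space UNIV"
proof -
  have "(\<lambda>c. c i) \<in> PiM_pmf p \<rightarrow>\<^sub>M measure_pmf (p i)" by (rule measurable_component_singleton) simp
  then show ?thesis by (simp cong: measurable_cong_sets)
qed

lemma prob_space_PiM_pmf: "prob_space (PiM_pmf p)"
  by (intro prob_space_PiM prob_space_measure_pmf)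

definition cylinder :: "'i set \<Rightarrow> ('i \<Rightarrow> 'b) \<Rightarrow> ('i \<Rightarrow> 'b) set" where
  "cylinder F g = {c. \<forall>i\<in>F. c i = g i}"

definition cylinder_weight :: "('i \<Rightarrow> 'b pmf) \<Rightarrow> 'i set \<Rightarrow> ('i \<Rightarrow> 'b) \<Rightarrow> ennreal" where
  "cylinder_weight p F g = (\<Prod>i\<in>F. ennreal (pmf (p i) (g i)))"

lemma cylinder_weight_empty [simp]: "cylinder_weight p {} g = 1"
  by (simp add: cylinder_weight_def)

lemma cylinder_empty [simp]: "cylinder {} g = UNIV"
  by (simp add: cylinder_def)

lemma cylinder_weight_insert:
  assumes "finite F" "v \<notin> F"
  shows "cylinder_weight p (insert v F) (g(v := s)) = cylinder_weight p F g * ennreal (pmf (p v) s)"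
proof -
  have "(\<Prod>i\<in>F. ennreal (pmf (p i) ((g(v := s)) i))) = (\<Prod>i\<in>F. ennreal (pmf (p i) (g i)))"
    using assms(2) by (intro prod.cong) auto
  then show ?thesis using assms by (simp add: cylinder_weight_def mult.commute)
qed

lemma
  assumes "finite F"
  shows sets_cylinder: "cylinder F g \<in> sets (PiM_pmf p)"
    and emeasure_cylinder: "emeasure (PiM_pmf p) (cylinder F g) = cylinder_weight p F g"
proof -
  have eq: "cylinder F g = prod_emb UNIV (\<lambda>i. measure_pmf (p i)) F (Pi\<^sub>E F (\<lambda>i. {g i}))"
    by (auto simp: cylinder_def prod_emb_def PiE_iff space_PiM)
  show "cylinder F g \<in> sets (PiM_pmf p)"
    unfolding eq using assms by (intro sets_PiM_I) auto
  show "emeasure (PiM_pmf p) (cylinder F g) = cylinder_weight p F g"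
    unfolding eq using assms
    by (subst emeasure_PiM_emb) (auto simp: prob_space_measure_pmf emeasure_pmf_single cylinder_weight_def)
qed

lemma emeasure_UN_le:
  assumes I: "countable I" and X: "\<And>i. i \<in> I \<Longrightarrow> X i \<in> sets M"
  shows "emeasure M (\<Union>i\<in>I. X i) \<le> (\<integral>\<^sup>+i. emeasure M (X i) \<partial>count_space I)"
proof -
  have [measurable]: "(\<Union>i\<in>I. X i) \<in> sets M" using assms by (intro sets.countable_UN') auto
  have "emeasure M (\<Union>i\<in>I. X i) = (\<integral>\<^sup>+x. indicator (\<Union>(X ` I)) x \<partial>M)" by simp
  also have "\<dots> \<le> (\<integral>\<^sup>+x. \<integral>\<^sup>+i. indicator (X i) x \<partial>count_space I \<partial>M)"
  proof (rule nn_integral_mono)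
    fix x
    show "indicator (\<Union>(X ` I)) x \<le> (\<integral>\<^sup>+i. indicator (X i) x \<partial>count_space I :: ennreal)"
    proof (cases "x \<in> (\<Union>i\<in>I. X i)")
      case True
      then obtain j where j: "j \<in> I" "x \<in> X j" by blast
      then have "(indicator (X j) x :: ennreal) \<le> (\<integral>\<^sup>+i. indicator (X i) x \<partial>count_space I)"
        by (intro nn_integral_ge_point)
      then show ?thesis using j True by simp
    qed simp
  qed
  also have "\<dots> = (\<integral>\<^sup>+i. \<integral>\<^sup>+x. indicator (X i) x \<partial>M \<partial>count_space I)"
    using assms by (intro nn_integral_count_space_nn_integral) auto
  also have "\<dots> = (\<integral>\<^sup>+i. emeasure M (X i) \<partial>count_space I)"
    using X by (intro nn_integral_cong) simp
  finally show ?thesis .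
qed

text \<open>Conditioning on one unread coordinate without conditional probabilities: the cylinder is
  split by the value \<open>s\<close> of \<open>c v\<close>, which multiplies its weight by
  \<open>pmf (p v) s\<close>. Since \<open>P\<close> takes \<open>s\<close> as a separate argument,
  a stack depending on \<open>c v\<close> is already fixed when a bound is applied to it.\<close>

lemma emeasure_cylinder_step:
  fixes p :: "'i \<Rightarrow> 'b::countable pmf"
  assumes F: "finite F" "v \<notin> F"
    and P: "\<And>s. {c. P s c} \<in> sets (PiM_pmf p)"
    and B: "\<And>s. s \<in> set_pmf (p v) \<Longrightarrow>
      emeasure (PiM_pmf p) (cylinder (insert v F) (g(v := s)) \<inter> {c. P s c}) \<le>
      cylinder_weight p (insert v F) (g(v := s)) * B s"
  shows "emeasure (PiM_pmf p) (cylinder F g \<inter> {c. P (c v) c}) \<le>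
    cylinder_weight p F g * (\<integral>\<^sup>+s. B s \<partial>measure_pmf (p v))"
proof -
  let ?X = "\<lambda>s. cylinder (insert v F) (g(v := s)) \<inter> {c. P s c}"
  have X: "?X s \<in> sets (PiM_pmf p)" for s
    using F(1) P by (intro sets.Int sets_cylinder) auto
  have "cylinder F g \<inter> {c. P (c v) c} = (\<Union>s. ?X s)"
    using F(2) by (auto simp: cylinder_def)
  then have "emeasure (PiM_pmf p) (cylinder F g \<inter> {c. P (c v) c})
      \<le> (\<integral>\<^sup>+s. emeasure (PiM_pmf p) (?X s) \<partial>count_space UNIV)"
    using emeasure_UN_le[of UNIV ?X "PiM_pmf p"] X by simp
  also have "\<dots> \<le> (\<integral>\<^sup>+s. cylinder_weight p F g * (ennreal (pmf (p v) s) * B s) \<partial>count_space UNIV)"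
  proof (rule nn_integral_mono)
    fix s
    show "emeasure (PiM_pmf p) (?X s) \<le> cylinder_weight p F g * (ennreal (pmf (p v) s) * B s)"
    proof (cases "s \<in> set_pmf (p v)")
      case True
      then show ?thesis using B F by (simp add: cylinder_weight_insert mult.assoc)
    next
      case False
      then have "emeasure (PiM_pmf p) (cylinder (insert v F) (g(v := s))) = 0"
        using F by (simp add: emeasure_cylinder cylinder_weight_insert set_pmf_iff)
      moreover have "emeasure (PiM_pmf p) (?X s) \<le> emeasure (PiM_pmf p) (cylinder (insert v F) (g(v := s)))"
        using F(1) by (intro emeasure_mono sets_cylinder) auto
      ultimately show ?thesis by simp
    qed
  qed
  also have "\<dots> = cylinder_weight p F g * (\<integral>\<^sup>+s. B s \<partial>measure_pmf (p v))"
    by (simp add: nn_integral_cmult nn_integral_measure_pmf)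
  finally show ?thesis .
qed

definition list_weight :: "'b pmf \<Rightarrow> 'b list \<Rightarrow> ennreal" where
  "list_weight \<rho> z = (\<Prod>a\<leftarrow>z. ennreal (pmf \<rho> a))"

lemma list_weight_simps [simp]:
  "list_weight \<rho> [] = 1" "list_weight \<rho> (a # z) = ennreal (pmf \<rho> a) * list_weight \<rho> z"
  by (simp_all add: list_weight_def)

lemma list_weight_rev [simp]: "list_weight \<rho> (rev z) = list_weight \<rho> z"
  by (simp add: list_weight_def rev_map[symmetric])

lemma list_weight_nth: "list_weight \<rho> z = (\<Prod>i<length z. ennreal (pmf \<rho> (z ! i)))"
  by (induction z) (simp_all add: prod.lessThan_Suc_shift del: prod.lessThan_Suc)

subsection \<open>Exploration of random labels\<close>

definition below :: "(tgw_vertex \<times> tgw_vertex) set" where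
  "below = {(v, tgw_child v l) | v l. True}\<^sup>*"

lemma below_refl [simp]: "(v, v) \<in> below"
  by (simp add: below_def)

lemma below_trans: "(u, v) \<in> below \<Longrightarrow> (v, w) \<in> below \<Longrightarrow> (u, w) \<in> below"
  unfolding below_def by (rule rtrancl_trans)

lemma below_child: "(v, tgw_child v l) \<in> below"
  unfolding below_def by (rule r_into_rtrancl) blast

lemma below_rank: "(u, v) \<in> below \<Longrightarrow> rank v \<le> rank u"
  unfolding below_def by (induction rule: rtrancl_induct) (auto simp: rank_child)

lemma not_child_below: "(tgw_child v l, v) \<notin> below"
  using below_rank[of "tgw_child v l" v] by (auto simp: rank_child)

lemma below_child_cases:
  assumes "(u, tgw_child v l) \<in> below"
  shows "u = tgw_child v l \<or> (u, v) \<in> below"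
  using assms unfolding below_def
proof (cases rule: rtranclE)
  case (step y)
  then have "y = v" by (auto simp: tgw_child_eq_iff simp del: split_paired_Ex)
  then show "u = tgw_child v l \<or> (u, v) \<in> {(v, tgw_child v l) | v l. True}\<^sup>*" using step by simp
qed simp

text \<open>While \<open>F\<close> has been explored and \<open>vs\<close> is the stack, the labels still to be read are independent of
  those of \<open>F\<close>, and the subtrees of different stack entries involve different labels.\<close>

definition frontier :: "tgw_vertex set \<Rightarrow> tgw_vertex list \<Rightarrow> bool" where
  "frontier F vs \<longleftrightarrow> finite F \<and> (\<forall>v\<in>set vs. \<forall>f\<in>F. (v, f) \<notin> below) \<and>
     sorted_wrt (\<lambda>u v. (u, v) \<notin> below \<and> (v, u) \<notin> below) vs"

lemma frontier_finite: "frontier F vs \<Longrightarrow> finite F"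
  by (simp add: frontier_def)

lemma frontier_Cons_notin: "frontier F (v # vs) \<Longrightarrow> v \<notin> F"
  by (auto simp: frontier_def)

text \<open>A vertex above a child is that child or lies above \<open>v\<close>, and
  \<open>rank\<close> prevents a child from lying above its parent.\<close>

lemma frontier_step:
  assumes F: "frontier F (v # vs)" and s: "distinct s"
  shows "frontier (insert v F) (map (tgw_child v) (rev s) @ vs)"
proof -
  have F1: "finite F" "\<And>u f. u \<in> insert v (set vs) \<Longrightarrow> f \<in> F \<Longrightarrow> (u, f) \<notin> below"
    and F2: "sorted_wrt (\<lambda>u v. (u, v) \<notin> below \<and> (v, u) \<notin> below) vs"
      "\<And>u. u \<in> set vs \<Longrightarrow> (v, u) \<notin> below \<and> (u, v) \<notin> below"
    using F by (auto simp: frontier_def)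
  have "(tgw_child v l, f) \<notin> below" if "f \<in> F" for l f
    using that F1(2)[of v f] below_trans[OF below_child] by blast
  moreover have "(tgw_child v l, tgw_child v l') \<notin> below" if "l \<noteq> l'" for l l'
    using below_child_cases[of "tgw_child v l" v l'] that not_child_below[of v l]
    by (auto simp: tgw_child_eq_iff)
  then have "sorted_wrt (\<lambda>u v. (u, v) \<notin> below \<and> (v, u) \<notin> below) (map (tgw_child v) (rev s))"
    using s unfolding sorted_wrt_iff_nth_less by (auto simp: rev_nth nth_eq_iff_index_eq)
  moreover have "(tgw_child v l, u) \<notin> below \<and> (u, tgw_child v l) \<notin> below" if "u \<in> set vs" for u l
    using F2(2)[OF that] below_child[of v l] below_trans[OF below_child[of v l], of u]
      below_child_cases[of u v l] by auto
  ultimately show ?thesis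
    using F1 F2 not_child_below[of v] unfolding frontier_def by (auto simp: sorted_wrt_append)
qed

text \<open>The root \<open>(0, [])\<close> counts as off the spine: its offspring law is not size-biased.\<close>

definition off_spine :: "tgw_vertex \<Rightarrow> bool" where
  "off_spine v \<longleftrightarrow> fst v = 0 \<or> snd v \<noteq> []"

lemma off_spine_child: "off_spine v \<Longrightarrow> off_spine (tgw_child v l)"
  by (cases v) (auto simp: off_spine_def tgw_child_def)

lemma snd_child_nonempty: "snd v \<noteq> [] \<Longrightarrow> snd (tgw_child v l) \<noteq> []"
  by (cases v) (auto simp: tgw_child_def)

text \<open>All vertices \<open>(a, [])\<close> with \<open>a > 0\<close> get the size-biased law,
  whatever the actual number of ancestors, so one product space serves every
  \<open>n\<close>.\<close>

definition label_law :: "nat pmf \<Rightarrow> tgw_vertex \<Rightarrow> nat list pmf" where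
  "label_law \<pi> v = ordered_children (if off_spine v then \<pi> else size_biased \<pi>)"

definition rooted_at :: "(tgw_vertex \<Rightarrow> nat list) \<Rightarrow> tgw_vertex list \<Rightarrow> nat list \<Rightarrow> nat \<Rightarrow> bool" where
  "rooted_at c vs w k \<longleftrightarrow> explores c vs w \<and> k < length w \<and> hd ((explore_step c ^^ k) vs) = (0, [])"

lemma rooted_at_Nil [simp]: "\<not> rooted_at c vs [] k"
  by (simp add: rooted_at_def)

lemma explores_Nil_iff [simp]: "explores c [] w \<longleftrightarrow> w = []"
  by (cases w) auto

lemma explores_Cons_Cons: "explores c (v # vs) (d # w) \<longleftrightarrow>
    length (c v) = d \<and> explores c (map (tgw_child v) (rev (c v)) @ vs) w"
  by (simp add: explore_step_def)

declare explores.simps(2) [simp del]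

lemma rooted_at_Cons_0: "rooted_at c (v # vs) (d # w) 0 \<longleftrightarrow> explores c (v # vs) (d # w) \<and> v = (0, [])"
  by (simp add: rooted_at_def)

lemma rooted_at_Cons_Suc: "rooted_at c (v # vs) (d # w) (Suc k) \<longleftrightarrow>
    length (c v) = d \<and> rooted_at c (map (tgw_child v) (rev (c v)) @ vs) w k"
proof -
  have "explore_step c (v # vs) = map (tgw_child v) (rev (c v)) @ vs" by (simp add: explore_step_def)
  then show ?thesis
    unfolding rooted_at_def explores_Cons_Cons by (simp add: funpow_swap1)
qed

lemma rooted_at_empty: "\<not> rooted_at c [] w k"
  by (cases w) (auto simp: rooted_at_def)

text \<open>Below a nonempty address all addresses are nonempty, so the root can no longer come to
  the top of the stack.\<close>

lemma not_rooted_at: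
  assumes "\<forall>v\<in>set vs. snd v \<noteq> []"
  shows "\<not> rooted_at c vs w k"
  using assms
proof (induction w arbitrary: vs k)
  case (Cons d w)
  show ?case
  proof (cases vs)
    case Nil
    then show ?thesis by (simp add: rooted_at_empty)
  next
    case (Cons v vs')
    have "\<forall>u\<in>set (map (tgw_child v) (rev (c v)) @ vs'). snd u \<noteq> []"
      using Cons.prems Cons snd_child_nonempty[of v] by auto
    then have "\<not> rooted_at c (map (tgw_child v) (rev (c v)) @ vs') w k" for k by (rule Cons.IH)
    then show ?thesis
      using Cons.prems Cons by (cases k) (auto simp: rooted_at_Cons_0 rooted_at_Cons_Suc)
  qed
qed simp

section \<open>Measurability of the exploration events\<close>

lemma sets_PiM_pmf_component:
  fixes p :: "'i \<Rightarrow> 'b::countable pmf"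
  assumes "\<And>s. {c. P s c} \<in> sets (PiM_pmf p)"
  shows "{c. P (c v) c} \<in> sets (PiM_pmf p)"
proof -
  have "{c. P (c v) c} = (\<Union>s. cylinder {v} (\<lambda>_. s) \<inter> {c. P s c})"
    by (auto simp: cylinder_def)
  also have "\<dots> \<in> sets (PiM_pmf p)"
    using assms by (auto intro!: sets.Int sets_cylinder)
  finally show ?thesis .
qed

lemma sets_PiM_pmf_Collect_const: "{c. P} \<in> sets (PiM_pmf p)"
  using sets.top[of "PiM_pmf p"] by (cases P) auto

lemma sets_PiM_pmf_Collect_conj:
  "{c. P c} \<in> sets (PiM_pmf p) \<Longrightarrow> {c. Q c} \<in> sets (PiM_pmf p) \<Longrightarrow> {c. P c \<and> Q c} \<in> sets (PiM_pmf p)"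
  by (simp add: Collect_conj_eq sets.Int)

lemma sets_explores: "{c. explores c vs w} \<in> sets (PiM_pmf p)"
proof (induction w arbitrary: vs)
  case Nil
  show ?case by (simp only: explores.simps sets_PiM_pmf_Collect_const)
next
  case (Cons d w)
  show ?case
  proof (cases vs)
    case (Cons v vs')
    show ?thesis
      unfolding Cons explores_Cons_Cons
      by (rule sets_PiM_pmf_component[where P = "\<lambda>s c. length s = d \<and> explores c (map (tgw_child v) (rev s) @ vs') w"])
        (intro sets_PiM_pmf_Collect_conj sets_PiM_pmf_Collect_const Cons.IH)
  qed simp
qed

lemma sets_rooted_at: "{c. rooted_at c vs w k} \<in> sets (PiM_pmf p)"
proof (induction w arbitrary: vs k)
  case (Cons d w)
  show ?case
  proof (cases vs)
    case Nil
    then show ?thesis by (simp add: rooted_at_empty)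
  next
    case (Cons v vs')
    show ?thesis
    proof (cases k)
      case 0
      show ?thesis
        unfolding Cons 0 rooted_at_Cons_0
        by (intro sets_PiM_pmf_Collect_conj sets_PiM_pmf_Collect_const sets_explores)
    next
      case (Suc k')
      show ?thesis
        unfolding Cons Suc rooted_at_Cons_Suc
        by (rule sets_PiM_pmf_component[where P = "\<lambda>s c. length s = d \<and> rooted_at c (map (tgw_child v) (rev s) @ vs') w k'"])
          (intro sets_PiM_pmf_Collect_conj sets_PiM_pmf_Collect_const Cons.IH)
    qed
  qed
qed simp

section \<open>Bounded depth off the spine makes the exploration finite\<close>

fun reaches_depth :: "(tgw_vertex \<Rightarrow> nat list) \<Rightarrow> nat \<Rightarrow> tgw_vertex \<Rightarrow> bool" where
  "reaches_depth c 0 v \<longleftrightarrow> True"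
| "reaches_depth c (Suc h) v \<longleftrightarrow> (\<exists>l\<in>set (c v). reaches_depth c h (tgw_child v l))"

lemma sets_reaches_depth: "{c. reaches_depth c h v} \<in> sets (PiM_pmf p)"
proof (induction h arbitrary: v)
  case 0
  then show ?case using sets_PiM_pmf_Collect_const[of True] by simp
next
  case (Suc h)
  have "{c. \<exists>l\<in>set s. reaches_depth c h (tgw_child v l)} \<in> sets (PiM_pmf p)" for s
  proof -
    have "{c. \<exists>l\<in>set s. reaches_depth c h (tgw_child v l)} = (\<Union>l\<in>set s. {c. reaches_depth c h (tgw_child v l)})"
      by auto
    then show ?thesis using Suc.IH by (simp add: sets.finite_UN)
  qed
  then show ?case
    unfolding reaches_depth.simps
    by (rule sets_PiM_pmf_component[where P = "\<lambda>s c. \<exists>l\<in>set s. reaches_depth c h (tgw_child v l)"])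
qed

lemma explores_append:
  "explores c vs w \<Longrightarrow> explores c vs' w' \<Longrightarrow> explores c (vs @ vs') (w @ w')"
proof (induction w arbitrary: vs)
  case (Cons d w)
  obtain v us where vs: "vs = v # us" using Cons.prems(1) by (cases vs) auto
  have "explores c ((map (tgw_child v) (rev (c v)) @ us) @ vs') (w @ w')"
    using Cons.prems by (intro Cons.IH) (simp_all add: vs explores_Cons_Cons)
  then show ?case using Cons.prems(1) by (simp add: vs explores_Cons_Cons)
qed simp

lemma explores_concat:
  assumes "\<And>v. v \<in> set vs \<Longrightarrow> \<exists>w. explores c [v] w"
  shows "\<exists>w. explores c vs w"
  using assms
proof (induction vs)
  case Nil
  show ?case by (rule exI[of _ "[]"]) simp
next
  case (Cons v vs)
  obtain w where "explores c [v] w" using Cons.prems[of v] by auto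
  moreover obtain w' where "explores c vs w'" using Cons.IH Cons.prems by (meson list.set_intros(2))
  ultimately have "explores c ([v] @ vs) (w @ w')" by (rule explores_append)
  then show ?case by auto
qed

lemma explores_singleton:
  assumes "\<And>l. l \<in> set (c v) \<Longrightarrow> \<exists>w. explores c [tgw_child v l] w"
  shows "\<exists>w. explores c [v] w"
proof -
  have "\<exists>w. explores c (map (tgw_child v) (rev (c v))) w"
    by (rule explores_concat) (use assms in \<open>auto simp del: split_paired_All\<close>)
  then obtain w where "explores c (map (tgw_child v) (rev (c v))) w" by blast
  then have "explores c [v] (length (c v) # w)" by (simp add: explores_Cons_Cons)
  then show ?thesis by blast
qed

lemma explores_if_bounded_depth: "\<not> reaches_depth c h v \<Longrightarrow> \<exists>w. explores c [v] w"
proof (induction h arbitrary: v)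
  case (Suc h)
  show ?case
  proof (rule explores_singleton)
    fix l assume "l \<in> set (c v)"
    then have "\<not> reaches_depth c h (tgw_child v l)" using Suc.prems by auto
    then show "\<exists>w. explores c [tgw_child v l] w" by (rule Suc.IH)
  qed
qed simp

text \<open>A child of an ancestor is either the previous ancestor or off the spine, so induction on
  the distance to the root leaves only subtrees of bounded depth.\<close>

lemma explores_spine:
  assumes "\<And>v. off_spine v \<Longrightarrow> \<exists>h. \<not> reaches_depth c h v"
  shows "\<exists>w. explores c [(a, [])] w"
proof (induction a)
  case 0
  have "off_spine (0, [])" by (simp add: off_spine_def)
  then obtain h where "\<not> reaches_depth c h (0, [])" using assms by blast
  then show ?case by (rule explores_if_bounded_depth)
next
  case (Suc a)
  show ?case
  proof (rule explores_singleton)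
    fix l
    show "\<exists>w. explores c [tgw_child (Suc a, []) l] w"
    proof (cases "l = 0")
      case True
      then show ?thesis using Suc by (simp add: tgw_child_def)
    next
      case False
      then have "off_spine (tgw_child (Suc a, []) l)" by (simp add: tgw_child_def off_spine_def)
      then show ?thesis using assms explores_if_bounded_depth by blast
    qed
  qed
qed

lemma rooted_at_exists:
  assumes "proper_labels n c" "\<And>v. off_spine v \<Longrightarrow> \<exists>h. \<not> reaches_depth c h v"
  shows "\<exists>w k. rooted_at c [(n, [])] w k"
proof -
  obtain w where w: "explores c [(n, [])] w" using explores_spine[OF assms(2)] by blast
  interpret exploration n c w by unfold_locales fact+
  have "(0, []) \<in> tgw_verts n c" by (simp add: tgw_verts.ancestor)
  then obtain k where "k < length w" "visited k = (0, [])" unfolding tgw_verts_eq by force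
  then have "rooted_at c [(n, [])] w k" using w by (simp add: rooted_at_def visited_def stack_def)
  then show ?thesis by blast
qed

subsection \<open>The mass of a word under the Galton-Watson tree\<close>

lemma nn_integral_pmf_singleton:
  "(\<integral>\<^sup>+e. (if e = d then c else 0) \<partial>measure_pmf \<mu>) = ennreal (pmf \<mu> d) * c"
proof -
  have "(\<integral>\<^sup>+e. (if e = d then c else 0) \<partial>measure_pmf \<mu>) = (\<integral>\<^sup>+e. c * indicator {d} e \<partial>measure_pmf \<mu>)"
    by (intro nn_integral_cong) (auto split: split_indicator)
  also have "\<dots> = c * emeasure (measure_pmf \<mu>) {d}"
    by (rule nn_integral_cmult_indicator) simp
  finally show ?thesis by (simp add: emeasure_pmf_single mult.commute)
qed

lemma map_pmf_length_ordered_children: "map_pmf length (ordered_children \<mu>) = \<mu>"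
proof -
  have "map_pmf length (pmf_of_set (permutations_of_set {..<d})) = return_pmf d" for d :: nat
  proof -
    have "map_pmf length (pmf_of_set (permutations_of_set {..<d})) =
        map_pmf (\<lambda>_. d) (pmf_of_set (permutations_of_set {..<d}))"
      by (intro map_pmf_cong) (auto dest: length_finite_permutations_of_set)
    then show ?thesis by simp
  qed
  then show ?thesis by (simp add: ordered_children_def map_bind_pmf bind_return_pmf')
qed

lemma nn_integral_length_ordered_children:
  "(\<integral>\<^sup>+s. f (length s) \<partial>measure_pmf (ordered_children \<mu>)) = (\<integral>\<^sup>+d. f d \<partial>measure_pmf \<mu>)"
  by (metis map_pmf_length_ordered_children nn_integral_map_pmf)

lemma distinct_ordered_children: "s \<in> set_pmf (ordered_children \<mu>) \<Longrightarrow> distinct s"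
  by (auto simp: ordered_children_def dest: permutations_of_setD)

text \<open>The position of the spine child (label 0) among the children pushed on the stack.\<close>

definition zero_pos :: "nat list \<Rightarrow> nat" where
  "zero_pos s = length (takeWhile ((<) 0) (rev s))"

lemma zero_pos_less: "0 \<in> set s \<Longrightarrow> zero_pos s < length s \<and> rev s ! zero_pos s = 0"
proof -
  assume "0 \<in> set s"
  then obtain us vs where uv: "rev s = us @ 0 # vs" "0 \<notin> set us" by (metis set_rev split_list_first)
  have "takeWhile ((<) 0) (us @ 0 # vs) = us" using uv(2) by (subst takeWhile_append2) (auto intro: gr0I)
  then have "zero_pos s = length us" by (simp add: zero_pos_def uv(1))
  moreover have "length s = length (us @ 0 # vs)" by (metis length_rev uv(1))
  ultimately show ?thesis by (simp add: uv(1))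
qed

text \<open>A permutation amounts to an arrangement of the nonzero labels together with the place
  where 0 is inserted, so each place occurs \<open>fact (d - 1)\<close> times.\<close>

lemma sum_zero_pos:
  fixes f :: "nat \<Rightarrow> 'b::comm_semiring_1"
  assumes "0 < d"
  shows "(\<Sum>s\<in>permutations_of_set {..<d}. f (zero_pos s)) = of_nat (fact (d - 1)) * (\<Sum>j<d. f j)"
proof -
  have A: "insert 0 {1..<d} = {..<d}" using assms by auto
  let ?ins = "\<lambda>(r, j). rev (take j r @ 0 # drop j r)"
  have "(\<Sum>s\<in>permutations_of_set {..<d}. f (zero_pos s)) =
      (\<Sum>(r, j)\<in>permutations_of_set {1..<d} \<times> {..<d}. f j)"
  proof (rule sum.reindex_bij_witness[where i = ?ins and j = "\<lambda>s. (remove1 0 (rev s), zero_pos s)"])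
    fix s assume s: "s \<in> permutations_of_set {..<d}"
    then have s': "set s = {..<d}" "distinct s" "length s = d"
      using permutations_of_setD[OF s] length_finite_permutations_of_set[OF s] by auto
    then have "0 \<in> set (rev s)" using assms by auto
    then obtain us vs where uv: "rev s = us @ 0 # vs" "0 \<notin> set us" by (metis split_list_first)
    have tw: "takeWhile ((<) 0) (us @ 0 # vs) = us" using uv(2) by (subst takeWhile_append2) (auto intro: gr0I)
    have zp: "zero_pos s = length us" by (simp add: zero_pos_def uv(1) tw)
    have rm: "remove1 0 (rev s) = us @ vs" using uv by (simp add: remove1_append)
    show "?ins (remove1 0 (rev s), zero_pos s) = s" using uv(1) zp rm by (metis append_eq_conv_conj old.prod.case rev_rev_ident)
    have ds: "distinct (rev s)" using s' by simp
    have "set (us @ vs) = {1..<d}"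
    proof -
      have "insert 0 (set (us @ vs)) = {..<d}" using s'(1) uv(1) by (metis list.simps(15) set_append set_rev Un_insert_right)
      moreover have "0 \<notin> set (us @ vs)" using ds uv by auto
      ultimately show ?thesis using A by (metis Diff_insert_absorb atLeastLessThan_iff not_one_le_zero)
    qed
    moreover have "distinct (us @ vs)" using ds uv by auto
    moreover have "zero_pos s < d" using zp s'(3) uv(1) by (metis length_rev length_append length_Cons less_add_Suc1 add_Suc_right)
    ultimately show "(remove1 0 (rev s), zero_pos s) \<in> permutations_of_set {1..<d} \<times> {..<d}"
      by (simp add: rm permutations_of_set_def)
    show "(case (remove1 0 (rev s), zero_pos s) of (r, j) \<Rightarrow> f j) = f (zero_pos s)" by simp
  next
    fix p assume p: "p \<in> permutations_of_set {1..<d} \<times> {..<d}"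
    obtain r j where rj: "p = (r, j)" by (cases p)
    have r: "set r = {1..<d}" "distinct r" "length r = d - 1" "j \<le> length r"
      using p rj permutations_of_setD[of r "{1..<d}"] length_finite_permutations_of_set[of r "{1..<d}"] by auto
    have nz: "0 \<notin> set r" using r by auto
    then have nz': "0 \<notin> set (take j r)" "0 \<notin> set (drop j r)" by (auto dest: in_set_takeD in_set_dropD)
    have tw: "takeWhile ((<) 0) (take j r @ 0 # drop j r) = take j r"
      using nz' by (subst takeWhile_append2) (auto intro: gr0I)
    have zp: "zero_pos (?ins p) = j" using r by (simp add: zero_pos_def rj tw min_absorb2)
    have rm: "remove1 0 (rev (?ins p)) = r" using nz' by (simp add: rj remove1_append)
    show "(remove1 0 (rev (?ins p)), zero_pos (?ins p)) = p" using zp rm rj by simp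
    have "set (take j r) \<union> set (drop j r) = set r" by (metis append_take_drop_id set_append)
    then have "set (?ins p) = {..<d}" using r(1) A rj by (simp add: Un_commute)
    moreover have "distinct (?ins p)"
      using nz' r(2) set_take_disj_set_drop_if_distinct[of r j j] by (simp add: rj Int_commute)
    ultimately show "?ins p \<in> permutations_of_set {..<d}" by (simp add: permutations_of_set_def)
  qed
  also have "\<dots> = of_nat (fact (d - 1)) * (\<Sum>j<d. f j)"
    by (subst sum.cartesian_product[symmetric]) simp
  finally show ?thesis .
qed

text \<open>Among the \<open>fact d\<close> orders, \<open>fact (d - 1)\<close> put label 0 at a
  given place: the position of the spine child is uniform, whence the division by
  \<open>d\<close>.\<close>

lemma nn_integral_zero_pos_ordered_children:
  assumes "0 < d"
  shows "(\<integral>\<^sup>+s. (if length s = d then f (zero_pos s) else 0) \<partial>measure_pmf (ordered_children \<mu>)) =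
    ennreal (pmf \<mu> d) * ((\<Sum>j<d. f j) / of_nat d)"
proof -
  let ?S = "\<lambda>e. permutations_of_set {..<e::nat}"
  have "(\<integral>\<^sup>+s. (if length s = d then f (zero_pos s) else 0) \<partial>measure_pmf (pmf_of_set (?S e))) =
      (if e = d then (\<Sum>j<d. f j) / of_nat d else 0)" for e
  proof -
    have "(\<integral>\<^sup>+s. (if length s = d then f (zero_pos s) else 0) \<partial>measure_pmf (pmf_of_set (?S e))) =
      (\<Sum>s\<in>?S e. (if length s = d then f (zero_pos s) else 0)) / of_nat (fact e)"
      by (subst nn_integral_pmf_of_set) auto
    also have "(\<Sum>s\<in>?S e. (if length s = d then f (zero_pos s) else 0)) =
        (if e = d then \<Sum>s\<in>?S d. f (zero_pos s) else 0)"
      by (auto intro!: sum.cong sum.neutral dest: length_finite_permutations_of_set)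
    also have "(if e = d then \<Sum>s\<in>?S d. f (zero_pos s) else 0) / of_nat (fact e) =
        (if e = d then (\<Sum>j<d. f j) / of_nat d else 0)"
    proof -
      have "(fact d :: nat) = d * fact (d - 1)" using fact_reduce[OF assms, where 'a = nat] by simp
      have cancel: "of_nat n * S / of_nat (d * n) = S / (of_nat d :: ennreal)" if "n \<noteq> 0" for n :: nat and S
        using that divide_mult_eq[of "of_nat n" S "of_nat d"] by (simp add: mult.commute)
      have "(\<Sum>s\<in>?S d. f (zero_pos s)) / of_nat (fact d) = (\<Sum>j<d. f j) / of_nat d"
        unfolding sum_zero_pos[OF assms] \<open>fact d = d * fact (d - 1)\<close> by (rule cancel) simp
      then show ?thesis by simp
    qed
    finally show ?thesis .
  qed
  then have "(\<integral>\<^sup>+s. (if length s = d then f (zero_pos s) else 0) \<partial>measure_pmf (ordered_children \<mu>)) =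
      (\<integral>\<^sup>+e. (if e = d then (\<Sum>j<d. f j) / of_nat d else 0) \<partial>measure_pmf \<mu>)"
    by (simp add: ordered_children_def)
  also have "\<dots> = ennreal (pmf \<mu> d) * ((\<Sum>j<d. f j) / of_nat d)"
    by (rule nn_integral_pmf_singleton)
  finally show ?thesis .
qed

locale subcritical =
  fixes \<pi> :: "nat pmf"
  assumes integrable_offspring: "integrable (measure_pmf \<pi>) real"
    and mean_pos: "0 < offspring_mean \<pi>" and mean_less_1: "offspring_mean \<pi> < 1"
begin

abbreviation m :: ennreal where "m \<equiv> ennreal (offspring_mean \<pi>)"

lemma nn_integral_offspring: "(\<integral>\<^sup>+k. of_nat k \<partial>measure_pmf \<pi>) = m"
  using nn_integral_eq_integral[OF integrable_offspring]
  by (simp add: offspring_mean_def ennreal_of_nat_eq_real_of_nat)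

lemma pmf_size_biased: "pmf (size_biased \<pi>) k = real k * pmf \<pi> k / offspring_mean \<pi>"
  unfolding size_biased_def
proof (rule pmf_embed_pmf)
  show "0 \<le> real k * pmf \<pi> k / offspring_mean \<pi>" for k using mean_pos by simp
  have "(\<integral>\<^sup>+k. ennreal (real k * pmf \<pi> k / offspring_mean \<pi>) \<partial>count_space UNIV) =
      (\<integral>\<^sup>+k. ennreal (1 / offspring_mean \<pi>) * (ennreal (pmf \<pi> k) * of_nat k) \<partial>count_space UNIV)"
    using mean_pos
    by (intro nn_integral_cong)
      (simp add: ennreal_of_nat_eq_real_of_nat mult.commute flip: ennreal_mult)
  also have "\<dots> = ennreal (1 / offspring_mean \<pi>) * m"
    by (simp add: nn_integral_cmult nn_integral_offspring flip: nn_integral_measure_pmf)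
  also have "\<dots> = 1" using mean_pos by (simp flip: ennreal_mult)
  finally show "(\<integral>\<^sup>+k. ennreal (real k * pmf \<pi> k / offspring_mean \<pi>) \<partial>count_space UNIV) = 1" .
qed

lemma set_pmf_size_biased: "d \<in> set_pmf (size_biased \<pi>) \<Longrightarrow> 0 < d"
  by (cases d) (auto simp: set_pmf_iff pmf_size_biased)

abbreviation labels :: "(tgw_vertex \<Rightarrow> nat list) measure" where
  "labels \<equiv> PiM_pmf (label_law \<pi>)"

lemma label_law_off_spine: "off_spine v \<Longrightarrow> label_law \<pi> v = ordered_children \<pi>"
  by (simp add: label_law_def)

lemma label_law_spine: "label_law \<pi> (Suc a, []) = ordered_children (size_biased \<pi>)"
  by (simp add: label_law_def off_spine_def)

lemma distinct_label_law: "s \<in> set_pmf (label_law \<pi> v) \<Longrightarrow> distinct s"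
  by (auto simp: label_law_def dest: distinct_ordered_children)

lemma zero_in_label_law: "s \<in> set_pmf (label_law \<pi> (Suc a, [])) \<Longrightarrow> 0 \<in> set s"
  by (auto simp: label_law_spine ordered_children_def dest!: set_pmf_size_biased dest: permutations_of_setD)

text \<open>Each popped vertex is a fresh coordinate and contributes \<open>pmf \<pi> d\<close>,
  because the event asks only for the number of children and not for their order. The cylinder holds
  the labels already read, so \<open>F\<close> and \<open>g\<close> vary in the induction.\<close>

lemma emeasure_explores:
  assumes "frontier F vs" "\<forall>v\<in>set vs. off_spine v"
  shows "emeasure labels (cylinder F g \<inter> {c. explores c vs w}) \<le>
    cylinder_weight (label_law \<pi>) F g * list_weight \<pi> w"
  using assms
proof (induction w arbitrary: vs F g)
  case Nil
  have "emeasure labels (cylinder F g \<inter> {c. explores c vs []}) \<le> emeasure labels (cylinder F g)"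
    using Nil.prems by (intro emeasure_mono sets_cylinder) (auto simp: frontier_finite)
  then show ?case using Nil.prems by (simp add: emeasure_cylinder frontier_finite)
next
  case (Cons d w)
  show ?case
  proof (cases vs)
    case (Cons v vs')
    let ?P = "\<lambda>s c. length s = d \<and> explores c (map (tgw_child v) (rev s) @ vs') w"
    let ?B = "\<lambda>s. if length s = d then list_weight \<pi> w else 0"
    have F: "frontier F (v # vs')" and off: "off_spine v" "\<forall>v\<in>set vs'. off_spine v"
      using Cons.prems Cons by auto
    have "emeasure labels (cylinder F g \<inter> {c. ?P (c v) c}) \<le>
        cylinder_weight (label_law \<pi>) F g * (\<integral>\<^sup>+s. ?B s \<partial>measure_pmf (label_law \<pi> v))"
    proof (rule emeasure_cylinder_step[where P = ?P and B = ?B, OF frontier_finite[OF F] frontier_Cons_notin[OF F]])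
      show "{c. ?P s c} \<in> sets labels" for s
        by (intro sets_PiM_pmf_Collect_conj sets_PiM_pmf_Collect_const sets_explores)
      fix s assume s: "s \<in> set_pmf (label_law \<pi> v)"
      show "emeasure labels (cylinder (insert v F) (g(v := s)) \<inter> {c. ?P s c}) \<le>
          cylinder_weight (label_law \<pi>) (insert v F) (g(v := s)) * ?B s"
      proof (cases "length s = d")
        case True
        have "frontier (insert v F) (map (tgw_child v) (rev s) @ vs')"
          using frontier_step[OF F] distinct_label_law[OF s] .
        moreover have "\<forall>u\<in>set (map (tgw_child v) (rev s) @ vs'). off_spine u"
          using off off_spine_child[OF off(1)] by auto
        ultimately have "emeasure labels (cylinder (insert v F) (g(v := s)) \<inter>
              {c. explores c (map (tgw_child v) (rev s) @ vs') w}) \<le>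
            cylinder_weight (label_law \<pi>) (insert v F) (g(v := s)) * list_weight \<pi> w"
          by (rule Cons.IH)
        then show ?thesis using True by simp
      qed simp
    qed
    also have "(\<integral>\<^sup>+s. ?B s \<partial>measure_pmf (label_law \<pi> v)) = ennreal (pmf \<pi> d) * list_weight \<pi> w"
      unfolding label_law_off_spine[OF off(1)]
      by (subst nn_integral_length_ordered_children[where f = "\<lambda>e. if e = d then list_weight \<pi> w else 0"])
        (rule nn_integral_pmf_singleton)
    finally show ?thesis by (simp add: Cons explores_Cons_Cons)
  qed simp
qed

text \<open>Bounds the probability of exploring \<open>w\<close>, with the root at index \<open>k\<close>, from a stack whose entry \<open>j\<close> is
  the \<open>a\<close>-th ancestor. Summed over \<open>a\<close> with weights \<open>m ^ a\<close> and over \<open>j\<close>, the size bias disappears.\<close>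

fun spine_bound :: "nat \<Rightarrow> nat \<Rightarrow> nat list \<Rightarrow> nat \<Rightarrow> ennreal" where
  "spine_bound a j [] k = 0"
| "spine_bound 0 0 (d # w) 0 = list_weight \<pi> (d # w)"
| "spine_bound 0 0 (d # w) (Suc k) = 0"
| "spine_bound (Suc a) 0 (d # w) 0 = 0"
| "spine_bound (Suc a) 0 (d # w) (Suc k) =
     ennreal (pmf \<pi> d) * ((\<Sum>j<d. spine_bound a j w k) / m)"
| "spine_bound a (Suc j) (d # w) 0 = 0"
| "spine_bound a (Suc j) (d # w) (Suc k) = ennreal (pmf \<pi> d) * spine_bound a (d + j) w k"

text \<open>Only the stack position \<open>j\<close> and the generation \<open>a\<close> of the
  spine entry have to be tracked: all other entries have nonempty addresses, hence the offspring law
  \<open>\<pi>\<close>. The cases are a top entry that is the root, a proper ancestor, or off the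
  ancestral line.\<close>

lemma emeasure_rooted_at:
  assumes "frontier F vs" "j < length vs" "vs ! j = (a, [])"
    "\<And>i. i < length vs \<Longrightarrow> i \<noteq> j \<Longrightarrow> snd (vs ! i) \<noteq> []"
  shows "emeasure labels (cylinder F g \<inter> {c. rooted_at c vs w k}) \<le>
    cylinder_weight (label_law \<pi>) F g * spine_bound a j w k"
  using assms
proof (induction w arbitrary: vs j a k F g)
  case Nil
  then show ?case by simp
next
  case (Cons d w)
  obtain v vs' where vs: "vs = v # vs'" using Cons.prems(2) by (cases vs) auto
  have F: "frontier F (v # vs')" using Cons.prems(1) vs by simp
  have step: "emeasure labels (cylinder F g \<inter> {c. rooted_at c vs (d # w) (Suc k')}) \<le>
      cylinder_weight (label_law \<pi>) F g * (\<integral>\<^sup>+s. (if length s = d then B s else 0) \<partial>measure_pmf (label_law \<pi> v))"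
    if B: "\<And>s. s \<in> set_pmf (label_law \<pi> v) \<Longrightarrow> length s = d \<Longrightarrow> frontier (insert v F) (map (tgw_child v) (rev s) @ vs') \<Longrightarrow>
      emeasure labels (cylinder (insert v F) (g(v := s)) \<inter> {c. rooted_at c (map (tgw_child v) (rev s) @ vs') w k'}) \<le>
      cylinder_weight (label_law \<pi>) (insert v F) (g(v := s)) * B s" for B k'
  proof -
    let ?P = "\<lambda>s c. length s = d \<and> rooted_at c (map (tgw_child v) (rev s) @ vs') w k'"
    have "emeasure labels (cylinder F g \<inter> {c. ?P (c v) c}) \<le>
        cylinder_weight (label_law \<pi>) F g * (\<integral>\<^sup>+s. (if length s = d then B s else 0) \<partial>measure_pmf (label_law \<pi> v))"
    proof (rule emeasure_cylinder_step[where P = ?P and B = "\<lambda>s. if length s = d then B s else 0", OF frontier_finite[OF F] frontier_Cons_notin[OF F]])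
      show "{c. ?P s c} \<in> sets labels" for s
        by (intro sets_PiM_pmf_Collect_conj sets_PiM_pmf_Collect_const sets_rooted_at)
      fix s assume s: "s \<in> set_pmf (label_law \<pi> v)"
      show "emeasure labels (cylinder (insert v F) (g(v := s)) \<inter> {c. ?P s c}) \<le>
          cylinder_weight (label_law \<pi>) (insert v F) (g(v := s)) * (if length s = d then B s else 0)"
      proof (cases "length s = d")
        case True
        then show ?thesis
          using B[OF s] frontier_step[OF F distinct_label_law[OF s]] by simp
      qed simp
    qed
    then show ?thesis by (simp add: vs rooted_at_Cons_Suc)
  qed
  show ?case
  proof (cases j)
    case 0
    have v: "v = (a, [])" using Cons.prems(3) vs 0 by simp
    have vs': "\<forall>u\<in>set vs'. snd u \<noteq> []"
      using Cons.prems(4) vs 0 by (metis in_set_conv_nth length_Cons nat.simps(3) not_less_eq nth_Cons_Suc)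
    show ?thesis
    proof (cases a)
      case a0: 0
      show ?thesis
      proof (cases k)
        case k0: 0
        \<comment> \<open>The root is on top at index 0. As it counts as off the spine, the whole
          remaining exploration obeys the plain Galton-Watson bound.\<close>
        have off: "\<forall>u\<in>set vs. off_spine u" using vs v vs' a0 by (auto simp: off_spine_def)
        have "emeasure labels (cylinder F g \<inter> {c. rooted_at c vs (d # w) k}) \<le>
            emeasure labels (cylinder F g \<inter> {c. explores c vs (d # w)})"
          using Cons.prems(1)
          by (intro emeasure_mono sets.Int sets_cylinder sets_explores) (auto simp: rooted_at_def frontier_finite)
        also have "\<dots> \<le> cylinder_weight (label_law \<pi>) F g * list_weight \<pi> (d # w)"
          by (rule emeasure_explores[OF Cons.prems(1) off])
        finally show ?thesis using 0 a0 k0 by simp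
      next
        case (Suc k')
        \<comment> \<open>Once the root has been popped, every entry has a nonempty address, so the
          root cannot turn up at a later index.\<close>
        have "snd u \<noteq> []" if "u \<in> set (map (tgw_child v) (rev s) @ vs')" for u s
          using that vs' v a0 by (auto simp: tgw_child_def)
        then have "\<not> rooted_at c vs (d # w) k" for c
          using not_rooted_at vs Suc rooted_at_Cons_Suc by metis
        then show ?thesis by simp
      qed
    next
      case (Suc a')
      show ?thesis
      proof (cases k)
        case k0: 0
        then have "\<not> rooted_at c vs (d # w) k" for c
          using vs v Suc by (simp add: rooted_at_Cons_0)
        then show ?thesis by simp
      next
        case k: (Suc k')
        have "emeasure labels (cylinder F g \<inter> {c. rooted_at c vs (d # w) (Suc k')}) \<le>
          cylinder_weight (label_law \<pi>) F g *
            (\<integral>\<^sup>+s. (if length s = d then spine_bound a' (zero_pos s) w k' else 0) \<partial>measure_pmf (label_law \<pi> v))"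
        proof (rule step)
          fix s
          assume s: "s \<in> set_pmf (label_law \<pi> v)" "length s = d"
            and F': "frontier (insert v F) (map (tgw_child v) (rev s) @ vs')"
          let ?vs = "map (tgw_child v) (rev s) @ vs'"
          have 0: "0 \<in> set s" using s(1) v Suc zero_in_label_law by simp
          have zp: "zero_pos s < length s" "rev s ! zero_pos s = 0" using zero_pos_less[OF 0] by auto
          show "emeasure labels (cylinder (insert v F) (g(v := s)) \<inter> {c. rooted_at c ?vs w k'}) \<le>
            cylinder_weight (label_law \<pi>) (insert v F) (g(v := s)) * spine_bound a' (zero_pos s) w k'"
          proof (rule Cons.IH[OF F'])
            show "zero_pos s < length ?vs" using zp by simp
            show "?vs ! zero_pos s = (a', [])"
              using zp v Suc by (simp add: nth_append tgw_child_def)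
            fix i assume i: "i < length ?vs" "i \<noteq> zero_pos s"
            show "snd (?vs ! i) \<noteq> []"
            proof (cases "i < length s")
              case True
              have "distinct (rev s)" using distinct_label_law[OF s(1)] by simp
              then have "rev s ! i \<noteq> 0" using zp i(2) True nth_eq_iff_index_eq[of "rev s" i "zero_pos s"] by simp
              then show ?thesis using True v Suc by (simp add: nth_append tgw_child_def)
            next
              case False
              then have "?vs ! i \<in> set vs'" using i(1) by (simp add: nth_append)
              then show ?thesis using vs' by blast
            qed
          qed
        qed
        also have "(\<integral>\<^sup>+s. (if length s = d then spine_bound a' (zero_pos s) w k' else 0) \<partial>measure_pmf (label_law \<pi> v)) =
            spine_bound a j (d # w) k"
        proof (cases "d = 0")
          case True
          have "(if length s = d then spine_bound a' (zero_pos s) w k' else 0) = 0"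
            if "s \<in> set_pmf (label_law \<pi> v)" for s
            using that v Suc True zero_in_label_law[of s a'] by auto
          then have "(\<integral>\<^sup>+s. (if length s = d then spine_bound a' (zero_pos s) w k' else 0) \<partial>measure_pmf (label_law \<pi> v)) =
            (\<integral>\<^sup>+s. 0 \<partial>measure_pmf (label_law \<pi> v))"
            by (intro nn_integral_cong_AE) (simp add: AE_measure_pmf_iff)
          then show ?thesis using True Suc k 0 by simp
        next
          case False
          define S where "S = (\<Sum>j<d. spine_bound a' j w k')"
          \<comment> \<open>The size bias \<open>d / m\<close> meets the factor \<open>1 / d\<close>
            of the uniform position. The remaining \<open>1 / m\<close> waits for a power of
            \<open>m\<close> in \<open>sum_spine_bound\<close>.\<close>
          have "ennreal (pmf (size_biased \<pi>) d) * (S / of_nat d) = ennreal (pmf \<pi> d) * (S / m)"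
          proof -
            have "ennreal (pmf (size_biased \<pi>) d) = ennreal (pmf \<pi> d) * (of_nat d * inverse m)"
              using mean_pos by (simp add: pmf_size_biased ennreal_of_nat_eq_real_of_nat inverse_ennreal divide_inverse mult_ac flip: ennreal_mult)
            then have "ennreal (pmf (size_biased \<pi>) d) * (S / of_nat d) =
                (ennreal (pmf \<pi> d) * (S / m)) * (of_nat d / of_nat d)"
              by (simp only: divide_ennreal_def mult_ac)
            moreover have "(of_nat d / of_nat d :: ennreal) = 1"
              using False by (intro ennreal_divide_self) (auto simp: of_nat_less_top)
            ultimately show ?thesis by simp
          qed
          then show ?thesis
            using False Suc k 0 v
            by (simp add: label_law_spine nn_integral_zero_pos_ordered_children[where f = "\<lambda>j. spine_bound a' j w k'"] S_def)
        qed
        finally show ?thesis using k by simp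
      qed
    qed
  next
    case (Suc j')
    have v: "snd v \<noteq> []" using Cons.prems(4)[of 0] vs Suc by simp
    show ?thesis
    proof (cases k)
      case 0
      then have "\<not> rooted_at c vs (d # w) k" for c
        using vs v by (auto simp: rooted_at_Cons_0)
      then show ?thesis by simp
    next
      case k: (Suc k')
      have off: "off_spine v" using v by (simp add: off_spine_def)
      have "emeasure labels (cylinder F g \<inter> {c. rooted_at c vs (d # w) (Suc k')}) \<le>
        cylinder_weight (label_law \<pi>) F g *
          (\<integral>\<^sup>+s. (if length s = d then spine_bound a (d + j') w k' else 0) \<partial>measure_pmf (label_law \<pi> v))"
      proof (rule step)
        fix s
        assume s: "s \<in> set_pmf (label_law \<pi> v)" "length s = d"
          and F': "frontier (insert v F) (map (tgw_child v) (rev s) @ vs')"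
        let ?vs = "map (tgw_child v) (rev s) @ vs'"
        show "emeasure labels (cylinder (insert v F) (g(v := s)) \<inter> {c. rooted_at c ?vs w k'}) \<le>
          cylinder_weight (label_law \<pi>) (insert v F) (g(v := s)) * spine_bound a (d + j') w k'"
        proof (rule Cons.IH[OF F'])
          \<comment> \<open>Popping the top and pushing \<open>d\<close> children moves the spine
            entry from position \<open>Suc j'\<close> to \<open>d + j'\<close>.\<close>
          show "d + j' < length ?vs" using s Cons.prems(2) vs Suc by simp
          show "?vs ! (d + j') = (a, [])" using s Cons.prems(3) vs Suc by (simp add: nth_append)
          fix i assume i: "i < length ?vs" "i \<noteq> d + j'"
          show "snd (?vs ! i) \<noteq> []"
          proof (cases "i < d")
            case True
            then show ?thesis using snd_child_nonempty[OF v] s by (simp add: nth_append)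
          next
            case False
            then show ?thesis using Cons.prems(4)[of "Suc (i - d)"] vs Suc i s by (simp add: nth_append)
          qed
        qed
      qed
      also have "(\<integral>\<^sup>+s. (if length s = d then spine_bound a (d + j') w k' else 0) \<partial>measure_pmf (label_law \<pi> v)) =
          ennreal (pmf \<pi> d) * spine_bound a (d + j') w k'"
        unfolding label_law_off_spine[OF off]
        by (subst nn_integral_length_ordered_children[where f = "\<lambda>e. if e = d then spine_bound a (d + j') w k' else 0"])
          (rule nn_integral_pmf_singleton)
      also have "\<dots> = spine_bound a j (d # w) k"
        using Suc k by simp
      finally show ?thesis using k by simp
    qed
  qed
qed

text \<open>One letter \<open>d\<close> spreads the term \<open>j = 0\<close> over the positions
  \<open>0, ..., d - 1\<close>, where lowering \<open>a\<close> by one frees a factor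
  \<open>m\<close> against \<open>1 / m\<close>, and shifts the other terms to
  \<open>d, ..., d + l - 2\<close>. Together these positions are covered once each, so the induction
  hypothesis with \<open>d + l - 1\<close> in place of \<open>l\<close> leaves exactly the factor
  \<open>pmf \<pi> d\<close>. At \<open>k = 0\<close> only \<open>a = j = 0\<close>
  contributes.\<close>

lemma sum_spine_bound: "(\<Sum>j<l. \<Sum>a<A. m ^ a * spine_bound a j w k) \<le> list_weight \<pi> w"
proof (induction w arbitrary: l A k)
  case (Cons d w)
  let ?p = "ennreal (pmf \<pi> d)"
  show ?case
  proof (cases k)
    case 0
    have "(\<Sum>a<A. m ^ a * spine_bound a j (d # w) k) \<le> (if j = 0 then list_weight \<pi> (d # w) else 0)" for j
    proof (cases j)
      case j0: 0
      show ?thesis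
      proof (cases A)
        case (Suc A')
        then show ?thesis using 0 j0 by (simp add: sum.lessThan_Suc_shift del: sum.lessThan_Suc)
      qed simp
    qed (simp add: 0)
    then have "(\<Sum>j<l. \<Sum>a<A. m ^ a * spine_bound a j (d # w) k) \<le> (\<Sum>j<l. if j = 0 then list_weight \<pi> (d # w) else 0)"
      by (intro sum_mono)
    also have "\<dots> \<le> list_weight \<pi> (d # w)" by simp
    finally show ?thesis .
  next
    case (Suc k')
    show ?thesis
    proof (cases l)
      case l: (Suc l')
      let ?T = "\<lambda>j. \<Sum>a<A. m ^ a * spine_bound a j w k'"
      have first: "(\<Sum>a<A. m ^ a * spine_bound a 0 (d # w) k) \<le> ?p * (\<Sum>j<d. ?T j)"
      proof (cases A)
        case A: (Suc A')
        have "(\<Sum>a<A. m ^ a * spine_bound a 0 (d # w) k) =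
            (\<Sum>a<A'. m ^ Suc a * (?p * ((\<Sum>j<d. spine_bound a j w k') / m)))"
          using Suc A by (simp add: sum.lessThan_Suc_shift del: sum.lessThan_Suc)
        also have "\<dots> = (\<Sum>a<A'. ?p * (m ^ a * (\<Sum>j<d. spine_bound a j w k')))"
        proof (intro sum.cong refl)
          fix a
          have "m * (S / m) = S" for S
            using mean_pos by (simp add: ennreal_times_divide ennreal_mult_divide_eq mult.commute)
          then show "m ^ Suc a * (?p * ((\<Sum>j<d. spine_bound a j w k') / m)) =
              ?p * (m ^ a * (\<Sum>j<d. spine_bound a j w k'))"
            by (metis (no_types, lifting) mult.left_commute power_Suc2 mult.assoc)
        qed
        also have "\<dots> = ?p * (\<Sum>j<d. \<Sum>a<A'. m ^ a * spine_bound a j w k')"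
          by (subst sum.swap) (simp add: sum_distrib_left)
        also have "\<dots> \<le> ?p * (\<Sum>j<d. ?T j)"
          unfolding A by (intro mult_left_mono sum_mono sum_mono2) auto
        finally show ?thesis .
      qed simp
      have "(\<Sum>j<l. \<Sum>a<A. m ^ a * spine_bound a j (d # w) k) =
          (\<Sum>a<A. m ^ a * spine_bound a 0 (d # w) k) + (\<Sum>j<l'. \<Sum>a<A. m ^ a * spine_bound a (Suc j) (d # w) k)"
        unfolding l by (rule sum.lessThan_Suc_shift)
      also have "(\<Sum>j<l'. \<Sum>a<A. m ^ a * spine_bound a (Suc j) (d # w) k) = ?p * (\<Sum>j<l'. ?T (d + j))"
        by (simp add: Suc sum_distrib_left mult_ac)
      also have "(\<Sum>j<l'. ?T (d + j)) = (\<Sum>j=d..<d + l'. ?T j)"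
        using sum.shift_bounds_nat_ivl[of ?T 0 d l'] by (simp add: lessThan_atLeast0 add.commute)
      finally have "(\<Sum>j<l. \<Sum>a<A. m ^ a * spine_bound a j (d # w) k) \<le>
          ?p * (\<Sum>j<d. ?T j) + ?p * (\<Sum>j=d..<d + l'. ?T j)"
        using first by (simp add: add_right_mono)
      also have "\<dots> = ?p * (\<Sum>j<d + l'. ?T j)"
      proof -
        have "(\<Sum>j<d. ?T j) + (\<Sum>j=d..<d + l'. ?T j) = (\<Sum>j<d + l'. ?T j)"
          unfolding lessThan_atLeast0 by (rule sum.atLeastLessThan_concat) auto
        then show ?thesis by (simp only: distrib_left[symmetric])
      qed
      also have "\<dots> \<le> ?p * list_weight \<pi> w" by (intro mult_left_mono Cons.IH) auto
      finally show ?thesis by simp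
    qed simp
  qed
qed simp

text \<open>First moment bound: \<open>m ^ h\<close> is the expected size of generation
  \<open>h\<close>. A union bound over the children is averaged over their number, which has mean
  \<open>m\<close>.\<close>

lemma emeasure_reaches_depth:
  assumes "finite F" "\<forall>f\<in>F. (v, f) \<notin> below" "off_spine v"
  shows "emeasure labels (cylinder F g \<inter> {c. reaches_depth c h v}) \<le>
    cylinder_weight (label_law \<pi>) F g * m ^ h"
  using assms
proof (induction h arbitrary: v F g)
  case 0
  then show ?case by (simp add: emeasure_cylinder)
next
  case (Suc h)
  let ?P = "\<lambda>s c. \<exists>l\<in>set s. reaches_depth c h (tgw_child v l)"
  let ?B = "\<lambda>s. of_nat (length s) * m ^ h"
  have vF: "v \<notin> F" using Suc.prems(2) by auto
  have meas: "{c. ?P s c} \<in> sets labels" for s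
  proof -
    have "{c. ?P s c} = (\<Union>l\<in>set s. {c. reaches_depth c h (tgw_child v l)})" by auto
    then show ?thesis by (simp add: sets.finite_UN sets_reaches_depth)
  qed
  have "emeasure labels (cylinder F g \<inter> {c. ?P (c v) c}) \<le>
      cylinder_weight (label_law \<pi>) F g * (\<integral>\<^sup>+s. ?B s \<partial>measure_pmf (label_law \<pi> v))"
  proof (rule emeasure_cylinder_step[where P = ?P and B = ?B, OF Suc.prems(1) vF meas])
    fix s
    let ?C = "cylinder (insert v F) (g(v := s))"
    let ?W = "cylinder_weight (label_law \<pi>) (insert v F) (g(v := s))"
    have fin: "finite (insert v F)" using Suc.prems(1) by simp
    have "?C \<inter> {c. ?P s c} = (\<Union>l\<in>set s. ?C \<inter> {c. reaches_depth c h (tgw_child v l)})" by auto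
    moreover have "emeasure labels (\<Union>l\<in>set s. ?C \<inter> {c. reaches_depth c h (tgw_child v l)}) \<le>
        (\<Sum>l\<in>set s. emeasure labels (?C \<inter> {c. reaches_depth c h (tgw_child v l)}))"
      using fin by (intro emeasure_subadditive_finite image_subsetI sets.Int sets_cylinder sets_reaches_depth) auto
    ultimately have "emeasure labels (?C \<inter> {c. ?P s c}) \<le>
        (\<Sum>l\<in>set s. emeasure labels (?C \<inter> {c. reaches_depth c h (tgw_child v l)}))"
      by (simp only:)
    also have "\<dots> \<le> (\<Sum>l\<in>set s. ?W * m ^ h)"
    proof (intro sum_mono Suc.IH fin)
      fix l
      have "(tgw_child v l, f) \<notin> below" if "f \<in> F" for f
        using Suc.prems(2) that below_trans[OF below_child[of v l]] by blast
      then show "\<forall>f\<in>insert v F. (tgw_child v l, f) \<notin> below" using not_child_below by auto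
      show "off_spine (tgw_child v l)" using Suc.prems(3) by (rule off_spine_child)
    qed
    also have "\<dots> = of_nat (card (set s)) * (?W * m ^ h)" by simp
    also have "\<dots> \<le> of_nat (length s) * (?W * m ^ h)"
      by (intro mult_right_mono) (auto simp: card_length)
    finally show "emeasure labels (?C \<inter> {c. ?P s c}) \<le> ?W * ?B s" by (simp add: mult_ac)
  qed
  also have "(\<integral>\<^sup>+s. ?B s \<partial>measure_pmf (label_law \<pi> v)) = m ^ Suc h"
    unfolding label_law_off_spine[OF Suc.prems(3)]
    by (subst nn_integral_length_ordered_children[where f = "\<lambda>e. of_nat e * m ^ h"])
      (simp add: nn_integral_multc nn_integral_offspring)
  finally show ?case by simp
qed

lemma AE_bounded_depth:
  assumes "off_spine v"
  shows "AE c in labels. \<exists>h. \<not> reaches_depth c h v"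
proof (rule AE_I)
  show "{c \<in> space labels. \<not> (\<exists>h. \<not> reaches_depth c h v)} \<subseteq> (\<Inter>h. {c. reaches_depth c h v})" by auto
  show "(\<Inter>h. {c. reaches_depth c h v}) \<in> sets labels"
    by (intro sets.countable_INT') (auto simp: sets_reaches_depth)
  have le: "emeasure labels (\<Inter>h. {c. reaches_depth c h v}) \<le> ennreal (offspring_mean \<pi> ^ h)" for h
  proof -
    have "emeasure labels (\<Inter>h. {c. reaches_depth c h v}) \<le> emeasure labels {c. reaches_depth c h v}"
      by (intro emeasure_mono sets_reaches_depth) auto
    also have "\<dots> \<le> m ^ h" using emeasure_reaches_depth[of "{}" v _ h] assms by simp
    finally show ?thesis using mean_pos by (simp add: ennreal_power)
  qed
  have "(\<lambda>h. offspring_mean \<pi> ^ h) \<longlonglongrightarrow> 0"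
    using mean_pos mean_less_1 by (intro LIMSEQ_realpow_zero) auto
  then have "(\<lambda>h. ennreal (offspring_mean \<pi> ^ h)) \<longlonglongrightarrow> ennreal 0" by (rule tendsto_ennrealI)
  then have "emeasure labels (\<Inter>h. {c. reaches_depth c h v}) \<le> ennreal 0"
    using le by (intro LIMSEQ_le_const[of _ "ennreal 0"]) auto
  then show "emeasure labels (\<Inter>h. {c. reaches_depth c h v}) = 0" by simp
qed

lemma AE_proper_labels: "AE c in labels. \<forall>n. proper_labels n c"
proof -
  have "AE c in labels. c v \<in> set_pmf (label_law \<pi> v)" for v
    by (rule AE_PiM_component) (auto simp: prob_space_measure_pmf AE_measure_pmf)
  then have "AE c in labels. \<forall>v. c v \<in> set_pmf (label_law \<pi> v)"
    by (simp add: AE_all_countable)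
  then show ?thesis
  proof (rule AE_mp, intro AE_I2 impI allI)
    fix c n assume c: "\<forall>v. c v \<in> set_pmf (label_law \<pi> v)"
    have "0 \<in> set (c (a, []))" if "0 < a" for a
      using that c zero_in_label_law[of "c (a, [])" "a - 1"] by simp
    then show "proper_labels n c"
      using c distinct_label_law unfolding proper_labels_def by blast
  qed
qed

lemma AE_rooted_at: "AE c in labels. \<forall>n. proper_labels n c \<and> (\<exists>w k. rooted_at c [(n, [])] w k)"
proof -
  have "AE c in labels. \<forall>v. off_spine v \<longrightarrow> (\<exists>h. \<not> reaches_depth c h v)"
    unfolding AE_all_countable using AE_bounded_depth by auto
  with AE_proper_labels show ?thesis
    by eventually_elim (use rooted_at_exists in blast)
qed

section \<open>Joint law of the number of ancestors and the labels\<close>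

abbreviation tgw_space :: "(nat \<times> (tgw_vertex \<Rightarrow> nat list)) measure" where
  "tgw_space \<equiv> measure_pmf (geometric_pmf (1 - offspring_mean \<pi>)) \<Otimes>\<^sub>M labels"

lemma prob_space_tgw_space: "prob_space tgw_space"
  by (intro prob_space_pair prob_space_measure_pmf prob_space_PiM_pmf)

lemma space_tgw_space [simp]: "space tgw_space = UNIV"
  by (simp add: space_pair_measure)

lemma AE_tgw_space:
  "AE p in tgw_space. proper_labels (fst p) (snd p) \<and> (\<exists>w k. rooted_at (snd p) [(fst p, [])] w k)"
proof -
  interpret G: prob_space "measure_pmf (geometric_pmf (1 - offspring_mean \<pi>))" by (rule prob_space_measure_pmf)
  interpret L: prob_space labels by (rule prob_space_PiM_pmf)
  obtain N where N: "N \<in> sets labels" "emeasure labels N = 0"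
    "{c. \<not> (\<forall>n. proper_labels n c \<and> (\<exists>w k. rooted_at c [(n, [])] w k))} \<subseteq> N"
    using AE_rooted_at by (auto elim!: AE_E)
  show ?thesis
  proof (rule AE_I)
    show "UNIV \<times> N \<in> sets tgw_space" using N(1) by (intro pair_measureI) auto
    show "emeasure tgw_space (UNIV \<times> N) = 0"
      using N by (subst L.emeasure_pair_measure_Times) auto
    show "{p \<in> space tgw_space. \<not> (proper_labels (fst p) (snd p) \<and> (\<exists>w k. rooted_at (snd p) [(fst p, [])] w k))} \<subseteq> UNIV \<times> N"
      using N(3) by (auto simp: subset_iff)
  qed
qed

lemma sets_tgw_space_rooted_at: "{p. rooted_at (snd p) [(fst p, [])] w k} \<in> sets tgw_space"
proof -
  have "{p. rooted_at (snd p) [(fst p, [])] w k} = (\<Union>n. {n} \<times> {c. rooted_at c [(n, [])] w k})" by auto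
  also have "\<dots> \<in> sets tgw_space"
    by (intro sets.countable_UN') (auto intro!: pair_measureI sets_rooted_at)
  finally show ?thesis .
qed

text \<open>The geometric law gives \<open>n\<close> ancestors the weight
  \<open>m ^ n * (1 - m)\<close>, which supplies the powers in \<open>sum_spine_bound\<close>; the
  initial stack has one entry, whence \<open>l = 1\<close>.\<close>

lemma emeasure_tgw_space_rooted_at:
  "emeasure tgw_space {p. rooted_at (snd p) [(fst p, [])] w k} \<le>
    ennreal (1 - offspring_mean \<pi>) * list_weight \<pi> w"
proof -
  interpret L: prob_space labels by (rule prob_space_PiM_pmf)
  let ?G = "geometric_pmf (1 - offspring_mean \<pi>)"
  have "emeasure tgw_space {p. rooted_at (snd p) [(fst p, [])] w k} =
      (\<integral>\<^sup>+n. emeasure labels {c. rooted_at c [(n, [])] w k} \<partial>measure_pmf ?G)"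
    by (subst L.emeasure_pair_measure_alt[OF sets_tgw_space_rooted_at]) (simp add: vimage_def)
  also have "\<dots> \<le> (\<integral>\<^sup>+n. spine_bound n 0 w k \<partial>measure_pmf ?G)"
  proof (rule nn_integral_mono)
    fix n
    have "frontier {} [(n, [])]" by (simp add: frontier_def)
    then show "emeasure labels {c. rooted_at c [(n, [])] w k} \<le> spine_bound n 0 w k"
      using emeasure_rooted_at[of "{}" "[(n, [])]" 0 n undefined w k] by simp
  qed
  also have "\<dots> = (\<Sum>n. ennreal (pmf ?G n) * spine_bound n 0 w k)"
    by (simp add: nn_integral_measure_pmf nn_integral_count_space_nat)
  also have "\<dots> = (\<Sum>n. ennreal (1 - offspring_mean \<pi>) * (m ^ n * spine_bound n 0 w k))"
  proof (intro suminf_cong)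
    fix n
    have "pmf ?G n = offspring_mean \<pi> ^ n * (1 - offspring_mean \<pi>)"
      using mean_pos mean_less_1 by simp
    then show "ennreal (pmf ?G n) * spine_bound n 0 w k =
        ennreal (1 - offspring_mean \<pi>) * (m ^ n * spine_bound n 0 w k)"
      using mean_pos mean_less_1 by (simp add: ennreal_mult ennreal_power mult_ac)
  qed
  also have "\<dots> = ennreal (1 - offspring_mean \<pi>) * (\<Sum>n. m ^ n * spine_bound n 0 w k)"
    by simp
  also have "(\<Sum>n. m ^ n * spine_bound n 0 w k) \<le> list_weight \<pi> w"
  proof (rule suminf_le_const)
    show "(\<Sum>a<A. m ^ a * spine_bound a 0 w k) \<le> list_weight \<pi> w" for A
      using sum_spine_bound[where l = 1 and A = A and w = w and k = k] by simp
  qed simp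
  finally show ?thesis by (simp add: mult_left_mono)
qed

end

subsection \<open>The mass of a word under the increments\<close>

definition block :: "int \<Rightarrow> 'b list \<Rightarrow> (int \<Rightarrow> 'b) set" where
  "block k z = {x. \<forall>i<length z. x (k + int i) = z ! i}"

lemma
  fixes \<rho> :: "'b pmf"
  assumes F: "finite F" "F \<subseteq> {..<k}"
  shows sets_cylinder_block: "cylinder F g \<inter> block k z \<in> sets (PiM_pmf (\<lambda>_. \<rho>))"
    and emeasure_cylinder_block:
      "emeasure (PiM_pmf (\<lambda>_. \<rho>)) (cylinder F g \<inter> block k z) = cylinder_weight (\<lambda>_. \<rho>) F g * list_weight \<rho> z"
proof -
  let ?J = "(\<lambda>i. k + int i) ` {..<length z}"
  let ?g = "\<lambda>i. if i < k then g i else z ! nat (i - k)"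
  have disj: "F \<inter> ?J = {}" using F(2) by auto
  have eq: "cylinder F g \<inter> block k z = cylinder (F \<union> ?J) ?g"
    using F(2) by (auto simp: cylinder_def block_def)
  have fin: "finite (F \<union> ?J)" using F(1) by simp
  show "cylinder F g \<inter> block k z \<in> sets (PiM_pmf (\<lambda>_. \<rho>))"
    unfolding eq by (rule sets_cylinder[OF fin])
  have "(\<Prod>i\<in>F. ennreal (pmf \<rho> (?g i))) = (\<Prod>i\<in>F. ennreal (pmf \<rho> (g i)))"
    using F(2) by (intro prod.cong) auto
  moreover have "(\<Prod>i\<in>?J. ennreal (pmf \<rho> (?g i))) = list_weight \<rho> z"
    by (subst prod.reindex) (auto simp: inj_on_def list_weight_nth)
  ultimately show "emeasure (PiM_pmf (\<lambda>_. \<rho>)) (cylinder F g \<inter> block k z) =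
      cylinder_weight (\<lambda>_. \<rho>) F g * list_weight \<rho> z"
    unfolding eq emeasure_cylinder[OF fin]
    using F(1) disj by (simp add: cylinder_weight_def prod.union_disjoint)
qed

text \<open>Not a probability measure: the words of each fixed length already have total mass 1.
  Useful bounds come from prefix-free sets.\<close>

definition list_measure :: "'b pmf \<Rightarrow> 'b list measure" where
  "list_measure \<rho> = density (count_space UNIV) (list_weight \<rho>)"

lemma sets_list_measure [simp]: "sets (list_measure \<rho>) = UNIV"
  by (simp add: list_measure_def)

lemma emeasure_list_measure:
  "emeasure (list_measure \<rho>) A = (\<integral>\<^sup>+z. list_weight \<rho> z \<partial>count_space A)"
  by (simp add: list_measure_def emeasure_density nn_integral_count_space_indicator)

lemma emeasure_list_measure_Cons:
  "emeasure (list_measure \<rho>) ((#) a ` A) = ennreal (pmf \<rho> a) * emeasure (list_measure \<rho>) A"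
proof -
  have "bij_betw ((#) a) A ((#) a ` A)" by (simp add: bij_betw_def)
  then show ?thesis
    unfolding emeasure_list_measure
    by (subst nn_integral_bij_count_space[symmetric]) (auto simp: nn_integral_cmult)
qed

lemma emeasure_list_measure_rev:
  "emeasure (list_measure \<rho>) (rev ` A) = emeasure (list_measure \<rho>) A"
proof -
  have "bij_betw rev A (rev ` A)" by (simp add: bij_betw_def)
  then have "(\<integral>\<^sup>+z. list_weight \<rho> z \<partial>count_space (rev ` A)) = (\<integral>\<^sup>+z. list_weight \<rho> (rev z) \<partial>count_space A)"
    by (rule nn_integral_bij_count_space[symmetric])
  then show ?thesis by (simp add: emeasure_list_measure)
qed

text \<open>Kraft's inequality.\<close>

lemma emeasure_list_measure_prefix_free:
  fixes \<rho> :: "'b::countable pmf"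
  assumes "\<And>z z'. z \<in> A \<Longrightarrow> z' \<in> A \<Longrightarrow> length z \<le> length z' \<Longrightarrow> take (length z) z' = z \<Longrightarrow> z = z'"
  shows "emeasure (list_measure \<rho>) A \<le> 1"
proof -
  \<comment> \<open>The weight of \<open>z\<close> is the probability that an i.i.d. sequence starts
    with \<open>z\<close>. For a prefix-free set these events are disjoint.\<close>
  interpret P: prob_space "PiM_pmf (\<lambda>_::int. \<rho>)" by (rule prob_space_PiM_pmf)
  have block: "block 0 z \<in> sets (PiM_pmf (\<lambda>_. \<rho>))"
    "emeasure (PiM_pmf (\<lambda>_. \<rho>)) (block 0 z) = list_weight \<rho> z" for z
    using sets_cylinder_block[of "{}" 0 _ z \<rho>] emeasure_cylinder_block[of "{}" 0 \<rho> _ z] by auto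
  have le: "z = z'" if "z \<in> A" "z' \<in> A" "length z \<le> length z'" "x \<in> block 0 z" "x \<in> block 0 z'" for z z' x
  proof (rule assms[OF that(1-3)])
    show "take (length z) z' = z" using that(3-5) by (intro nth_equalityI) (auto simp: block_def)
  qed
  have "disjoint_family_on (block 0) A"
    unfolding disjoint_family_on_def using le by (metis disjoint_iff nat_le_linear)
  then have "emeasure (PiM_pmf (\<lambda>_. \<rho>)) (\<Union>z\<in>A. block 0 z) = (\<integral>\<^sup>+z. list_weight \<rho> z \<partial>count_space A)"
    using block by (subst emeasure_UN_countable) auto
  then show ?thesis unfolding emeasure_list_measure by (metis P.emeasure_le_1)
qed

definition first_passage :: "int list set" where
  "first_passage = {y. y \<noteq> [] \<and> 0 \<le> sum_list y \<and> (\<forall>p. 0 < p \<and> p < length y \<longrightarrow> sum_list (take p y) < 0)}"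

definition first_hit :: "int \<Rightarrow> int list set" where
  "first_hit t = {z. sum_list z = t \<and> (\<forall>p<length z. t < sum_list (take p z))}"

text \<open>Read backwards, a path from its start to its first nonnegative value is its last step \<open>a\<close>
  followed by a path that first hits a level at distance at most \<open>a\<close>.\<close>

lemma rev_first_passage: "rev ` first_passage \<subseteq> (\<Union>a. \<Union>h\<in>{0..a}. (#) a ` first_hit (h - a))"
proof
  fix z assume "z \<in> rev ` first_passage"
  then have z: "rev z \<in> first_passage" by auto
  then obtain a z' where az: "z = a # z'" by (cases z) (auto simp: first_passage_def)
  define h where "h = sum_list z"
  have h: "0 \<le> h" using z by (simp add: first_passage_def h_def)
  \<comment> \<open>The last \<open>Suc p\<close> steps of the path carry it from a negative value
    to \<open>h\<close>, so they sum to more than \<open>h\<close>. Removing the very last step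
    \<open>a\<close> yields the hitting condition for level \<open>h - a\<close>.\<close>
  have pre: "h < sum_list (take (Suc p) z)" if "p < length z'" for p
  proof -
    let ?q = "length z - Suc p"
    have q: "0 < ?q" "?q < length (rev z)" using that az by auto
    then have "sum_list (take ?q (rev z)) < 0" using z unfolding first_passage_def by blast
    moreover have "take ?q (rev z) = rev (drop (Suc p) z)" using that az by (simp add: take_rev)
    moreover have "sum_list z = sum_list (take (Suc p) z) + sum_list (drop (Suc p) z)"
      by (metis append_take_drop_id sum_list_append)
    ultimately show ?thesis by (simp add: h_def)
  qed
  have "h - a < sum_list (take p z')" if "p < length z'" for p
    using pre[OF that] az by simp
  moreover have "sum_list z' = h - a" by (simp add: h_def az)
  ultimately have "z' \<in> first_hit (h - a)" by (simp add: first_hit_def)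
  moreover have "h \<le> a"
  proof (cases z')
    case Nil
    then show ?thesis by (simp add: h_def az)
  next
    case (Cons b us)
    then show ?thesis using pre[of 0] az by simp
  qed
  ultimately show "z \<in> (\<Union>a. \<Union>h\<in>{0..a}. (#) a ` first_hit (h - a))"
    using h az by (intro UN_I[of a] UN_I[of h]) auto
qed

text \<open>Reversal preserves weights. For a last step \<open>a \<ge> 0\<close> the overshoot
  \<open>h\<close> has the \<open>a + 1\<close> values from 0 to \<open>a\<close>, and each leaves a
  prefix-free set \<open>first_hit (h - a)\<close>, of mass at most 1 by Kraft's inequality.\<close>

lemma emeasure_first_passage:
  "emeasure (list_measure \<rho>) first_passage \<le> (\<integral>\<^sup>+a. of_nat (nat (a + 1)) \<partial>measure_pmf \<rho>)"
proof -
  have hit: "emeasure (list_measure \<rho>) (first_hit t) \<le> 1" for t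
  proof (rule emeasure_list_measure_prefix_free, rule ccontr)
    fix z z' assume *: "z \<in> first_hit t" "z' \<in> first_hit t" "length z \<le> length z'" "take (length z) z' = z" "z \<noteq> z'"
    then have "length z < length z'" by (metis le_neq_implies_less order_refl take_all)
    then have "t < sum_list (take (length z) z')" using *(2) by (simp add: first_hit_def)
    then show False using * by (simp add: first_hit_def)
  qed
  have "emeasure (list_measure \<rho>) first_passage = emeasure (list_measure \<rho>) (rev ` first_passage)"
    by (rule emeasure_list_measure_rev[symmetric])
  also have "\<dots> \<le> emeasure (list_measure \<rho>) (\<Union>a. \<Union>h\<in>{0..a}. (#) a ` first_hit (h - a))"
    by (intro emeasure_mono rev_first_passage) simp
  also have "\<dots> \<le> (\<integral>\<^sup>+a. emeasure (list_measure \<rho>) (\<Union>h\<in>{0..a}. (#) a ` first_hit (h - a)) \<partial>count_space UNIV)"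
    by (rule emeasure_UN_le) auto
  also have "\<dots> \<le> (\<integral>\<^sup>+a. ennreal (pmf \<rho> a) * of_nat (nat (a + 1)) \<partial>count_space UNIV)"
  proof (rule nn_integral_mono)
    fix a
    have "emeasure (list_measure \<rho>) (\<Union>h\<in>{0..a}. (#) a ` first_hit (h - a)) \<le>
        (\<Sum>h\<in>{0..a}. emeasure (list_measure \<rho>) ((#) a ` first_hit (h - a)))"
      by (rule emeasure_subadditive_finite) auto
    also have "\<dots> \<le> (\<Sum>h\<in>{0..a}. ennreal (pmf \<rho> a) * 1)"
      unfolding emeasure_list_measure_Cons by (intro sum_mono mult_left_mono hit) simp
    also have "\<dots> = ennreal (pmf \<rho> a) * of_nat (nat (a + 1))"
      by (simp add: mult.commute)
    finally show "emeasure (list_measure \<rho>) (\<Union>h\<in>{0..a}. (#) a ` first_hit (h - a)) \<le>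
        ennreal (pmf \<rho> a) * of_nat (nat (a + 1))" .
  qed
  also have "\<dots> = (\<integral>\<^sup>+a. of_nat (nat (a + 1)) \<partial>measure_pmf \<rho>)"
    by (simp add: nn_integral_measure_pmf)
  finally show ?thesis .
qed

lemma sum_list_block:
  assumes "x \<in> block k z"
  shows "sum x {k..<k + int (length z)} = sum_list z"
proof -
  have "sum x {k..<k + int (length z)} = (\<Sum>i<length z. x (k + int i))"
    by (rule sum.reindex_bij_witness[of _ "\<lambda>i. k + int i" "\<lambda>j. nat (j - k)"]) auto
  also have "\<dots> = sum_list z"
    using assms by (simp add: block_def sum_list_sum_nth lessThan_atLeast0)
  finally show ?thesis .
qed

lemma first_passage_block:
  assumes "k < j" "0 \<le> sum x {k..<j}"
  shows "\<exists>y\<in>first_passage. x \<in> block k y"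
proof -
  let ?Q = "\<lambda>n. 0 < n \<and> 0 \<le> sum x {k..<k + int n}"
  define n where "n = (LEAST n. ?Q n)"
  have "?Q (nat (j - k))" using assms by simp
  then have n: "?Q n" unfolding n_def by (rule LeastI)
  have min: "sum x {k..<k + int p} < 0" if "0 < p" "p < n" for p
    using not_less_Least[of p ?Q] that unfolding n_def by auto
  define y where "y = map (\<lambda>i. x (k + int i)) [0..<n]"
  have take: "x \<in> block k (take p y)" for p by (simp add: block_def y_def)
  have len: "length y = n" by (simp add: y_def)
  have sum: "sum_list (take p y) = sum x {k..<k + int p}" if "p \<le> n" for p
    using sum_list_block[OF take[of p]] that len by simp
  then have "sum_list y = sum x {k..<k + int n}" using len by (metis order_refl take_all)
  then have "y \<in> first_passage" using n min len sum by (auto simp: first_passage_def)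
  then show ?thesis using take[of n] len by auto
qed

lemma sets_nonneg_passage:
  fixes k :: int and \<rho> :: "int pmf"
  shows "{x. \<exists>j>k. 0 \<le> sum x {k..<j}} \<in> sets (PiM_pmf (\<lambda>_. \<rho>))"
proof -
  have "{x. \<exists>j>k. 0 \<le> sum x {k..<j}} = (\<Union>y\<in>first_passage. block k y)"
  proof
    show "(\<Union>y\<in>first_passage. block k y) \<subseteq> {x. \<exists>j>k. 0 \<le> sum x {k..<j}}"
    proof
      fix x assume "x \<in> (\<Union>y\<in>first_passage. block k y)"
      then obtain y where "y \<in> first_passage" "x \<in> block k y" by blast
      then have "k < k + int (length y)" "0 \<le> sum x {k..<k + int (length y)}"
        by (simp_all add: first_passage_def sum_list_block)
      then show "x \<in> {x. \<exists>j>k. 0 \<le> sum x {k..<j}}" by blast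
    qed
  qed (use first_passage_block in blast)
  also have "\<dots> \<in> sets (PiM_pmf (\<lambda>_. \<rho>))"
    using sets_cylinder_block[of "{}" k _ _ \<rho>] by (intro sets.countable_UN') auto
  finally show ?thesis .
qed

context subcritical
begin

abbreviation steps :: "(int \<Rightarrow> int) measure" where
  "steps \<equiv> PiM_pmf (\<lambda>_. map_pmf (\<lambda>d. int d - 1) \<pi>)"

text \<open>\<open>F\<close> lies to the left of \<open>k\<close>, so the cylinder is independent of
  the walk started at \<open>k\<close>. A step \<open>a = d - 1\<close> counts
  \<open>nat (a + 1) = d\<close> times, which turns the bound for first passages into the mean
  \<open>m\<close>.\<close>

lemma emeasure_cylinder_nonneg_passage:
  assumes F: "finite F" "F \<subseteq> {..<k}"
  shows "emeasure steps (cylinder F g \<inter> {x. \<exists>j>k. 0 \<le> sum x {k..<j}}) \<le>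
    cylinder_weight (\<lambda>_. map_pmf (\<lambda>d. int d - 1) \<pi>) F g * m"
proof -
  let ?\<rho> = "map_pmf (\<lambda>d. int d - 1) \<pi>"
  have "cylinder F g \<inter> {x. \<exists>j>k. 0 \<le> sum x {k..<j}} \<subseteq> (\<Union>y\<in>first_passage. cylinder F g \<inter> block k y)"
    using first_passage_block by blast
  then have "emeasure steps (cylinder F g \<inter> {x. \<exists>j>k. 0 \<le> sum x {k..<j}}) \<le>
      emeasure steps (\<Union>y\<in>first_passage. cylinder F g \<inter> block k y)"
    using sets_cylinder_block[OF F] by (intro emeasure_mono sets.countable_UN') auto
  also have "\<dots> \<le> (\<integral>\<^sup>+y. emeasure steps (cylinder F g \<inter> block k y) \<partial>count_space first_passage)"
    using sets_cylinder_block[OF F] by (intro emeasure_UN_le) auto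
  also have "\<dots> = cylinder_weight (\<lambda>_. ?\<rho>) F g * emeasure (list_measure ?\<rho>) first_passage"
    unfolding emeasure_cylinder_block[OF F] emeasure_list_measure by (rule nn_integral_cmult) simp
  also have "\<dots> \<le> cylinder_weight (\<lambda>_. ?\<rho>) F g * m"
  proof (rule mult_left_mono)
    have "emeasure (list_measure ?\<rho>) first_passage \<le> (\<integral>\<^sup>+a. of_nat (nat (a + 1)) \<partial>measure_pmf ?\<rho>)"
      by (rule emeasure_first_passage)
    also have "\<dots> = m" by (simp add: nn_integral_offspring)
    finally show "emeasure (list_measure ?\<rho>) first_passage \<le> m" .
  qed simp
  finally show ?thesis .
qed

text \<open>The letters occupy positions left of \<open>k\<close>, and the excluded passage event
  uses the increments from \<open>k\<close> on. Removing it costs at most the fraction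
  \<open>m\<close> of the cylinder.\<close>

lemma
  shows sets_encodes: "{x. encodes x w k} \<in> sets steps"
    and emeasure_encodes: "ennreal (1 - offspring_mean \<pi>) * list_weight \<pi> w \<le> emeasure steps {x. encodes x w k}"
proof -
  let ?\<rho> = "map_pmf (\<lambda>d. int d - 1) \<pi>"
  interpret S: prob_space steps by (rule prob_space_PiM_pmf)
  let ?F = "(\<lambda>i. int k - 1 - int i) ` {..<length w}"
  let ?g = "\<lambda>z. int (w ! nat (int k - 1 - z)) - 1"
  let ?E = "{x::int \<Rightarrow> int. \<exists>j>int k. 0 \<le> sum x {int k..<j}}"
  have F: "finite ?F" "?F \<subseteq> {..<int k}" by auto
  have eq: "{x. encodes x w k} = cylinder ?F ?g - (cylinder ?F ?g \<inter> ?E)"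
    by (auto simp: encodes_def cylinder_def not_le)
  have C: "cylinder ?F ?g \<in> sets steps" and CE: "cylinder ?F ?g \<inter> ?E \<in> sets steps"
    by (intro sets.Int sets_cylinder[OF F(1)] sets_nonneg_passage)+
  then show "{x. encodes x w k} \<in> sets steps" unfolding eq by blast
  have "pmf ?\<rho> (int d - 1) = pmf \<pi> d" for d
    by (rule pmf_map_inj') (auto simp: inj_def)
  then have W: "cylinder_weight (\<lambda>_. ?\<rho>) ?F ?g = list_weight \<pi> w"
    unfolding cylinder_weight_def
    by (subst prod.reindex) (auto simp: inj_on_def list_weight_nth)
  have "ennreal (1 - offspring_mean \<pi>) * list_weight \<pi> w = list_weight \<pi> w - list_weight \<pi> w * m"
  proof -
    \<comment> \<open>Distributing over a difference in \<open>ennreal\<close> requires a finite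
      factor; here it is the probability of a cylinder.\<close>
    have "list_weight \<pi> w \<noteq> \<top>"
      using W emeasure_cylinder[OF F(1), of "\<lambda>_. ?\<rho>" ?g] S.emeasure_finite by metis
    then have "list_weight \<pi> w * (1 - m) = list_weight \<pi> w * 1 - list_weight \<pi> w * m"
      by (intro ennreal_right_diff_distrib)
    moreover have "ennreal (1 - offspring_mean \<pi>) = 1 - m"
      using mean_pos by (simp add: ennreal_minus flip: ennreal_1)
    ultimately show ?thesis by (simp add: mult.commute)
  qed
  also have "\<dots> \<le> emeasure steps (cylinder ?F ?g) - emeasure steps (cylinder ?F ?g \<inter> ?E)"
    using emeasure_cylinder_nonneg_passage[OF F, of ?g] W emeasure_cylinder[OF F(1), of "\<lambda>_. ?\<rho>" ?g]
    by (simp add: ennreal_minus_mono)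
  also have "\<dots> = emeasure steps {x. encodes x w k}"
    unfolding eq using C CE by (intro emeasure_Diff[symmetric]) auto
  finally show "ennreal (1 - offspring_mean \<pi>) * list_weight \<pi> w \<le> emeasure steps {x. encodes x w k}" .
qed

end

subsection \<open>Measurability of isomorphism classes\<close>

lemma rep_ftree_iso_class:
  assumes T: "family_tree T"
  shows "family_tree (rep_ftree (iso_class T))" "T \<simeq> rep_ftree (iso_class T)"
proof -
  let ?S = "SOME S :: nat rotree. family_tree S \<and> T \<simeq> S"
  have S: "family_tree ?S" "T \<simeq> ?S" using someI_ex[OF nat_representative[OF T]] by blast+
  have R: "family_tree (rep_ftree (iso_class T)) \<and> rep_ftree (iso_class T) \<simeq> ?S"
    using Quotient3_rep_abs[OF Quotient3_ftree, of ?S] S(1) rotree_iso_refl[of ?S]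
    unfolding iso_class_def by blast
  then show "family_tree (rep_ftree (iso_class T))" by blast
  then have "the_root (rep_ftree (iso_class T)) \<in> verts (rep_ftree (iso_class T))"
    by (simp only: family_tree_def)
  then show "T \<simeq> rep_ftree (iso_class T)" using R S(2) rotree_iso_sym rotree_iso_trans by blast
qed

lemma root_ball_rep_ftree:
  assumes "family_tree T"
  shows "root_ball r T \<simeq> root_ball r (rep_ftree (iso_class T))"
  using rep_ftree_iso_class[OF assms] assms
  by (intro rotree_iso_root_ball) (auto simp: family_tree_def)

text \<open>The choice in \<open>iso_class\<close> then runs over an empty predicate and returns one
  fixed value. Measurability must hold on the whole label space, including labels that yield no
  Family Tree, so this value has to be constant.\<close>

lemma iso_class_not_family_tree:
  assumes T: "\<not> family_tree T" "the_root T \<in> verts T"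
    "arcs T \<subseteq> verts T \<times> verts T" "sib T \<subseteq> verts T \<times> verts T"
  shows "iso_class T = abs_ftree (SOME S. False)"
proof -
  have "\<not> (family_tree S \<and> T \<simeq> S)" for S :: "nat rotree"
    using family_tree_iso[OF _ rotree_iso_sym[OF _ T(2)] T(3,4)] T(1) by blast
  then have "(\<lambda>S :: nat rotree. family_tree S \<and> T \<simeq> S) = (\<lambda>_. False)" by blast
  then show ?thesis by (simp only: iso_class_def)
qed

lemma finite_adj_image:
  assumes "family_tree T"
  shows "finite (adj T `` {v})"
proof (cases "v \<in> verts T")
  case True
  have sv: "single_valued (arcs T)" using assms by (simp add: family_tree_def)
  have "finite (arcs T `` {v})"
  proof (cases "\<exists>u. (v, u) \<in> arcs T")
    case True
    then obtain u where "(v, u) \<in> arcs T" by blast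
    then have "arcs T `` {v} \<subseteq> {u}" using single_valuedD[OF sv] by blast
    then show ?thesis by (rule finite_subset) simp
  next
    case False
    then have "arcs T `` {v} = {}" by blast
    then show ?thesis by simp
  qed
  moreover have "adj T `` {v} = arcs T `` {v} \<union> children T v" by (auto simp: adj_def children_def)
  ultimately show ?thesis using assms True by (simp add: family_tree_def)
next
  case False
  then have "adj T `` {v} = {}" using assms by (auto simp: family_tree_def adj_def)
  then show ?thesis by simp
qed

lemma finite_verts_root_ball:
  assumes "family_tree T"
  shows "finite (verts (root_ball r T))"
proof -
  have "finite {v. (the_root T, v) \<in> adj T ^^ n}" for n
  proof (induction n)
    case (Suc n)
    have "{v. (the_root T, v) \<in> adj T ^^ Suc n} = (\<Union>w\<in>{w. (the_root T, w) \<in> adj T ^^ n}. adj T `` {w})"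
      by auto
    then show ?case using Suc finite_adj_image[OF assms] by simp
  qed simp
  moreover have "verts (root_ball r T) = (\<Union>n\<in>{..r}. {v. (the_root T, v) \<in> adj T ^^ n})"
    by (auto simp: root_ball_simps)
  ultimately show ?thesis by simp
qed

lemma measurable_relpow:
  fixes R :: "'a \<Rightarrow> ('v::countable \<times> 'v) set"
  assumes [measurable]: "\<And>u v. Measurable.pred M (\<lambda>x. (u, v) \<in> R x)"
  shows "Measurable.pred M (\<lambda>x. (u, v) \<in> R x ^^ n)"
proof (induction n arbitrary: v)
  case (Suc n)
  note Suc [measurable]
  have "(u, v) \<in> R x ^^ Suc n \<longleftrightarrow> (\<exists>w. (u, w) \<in> R x ^^ n \<and> (w, v) \<in> R x)" for x by auto
  then show ?case by simp
qed simp

text \<open>With a countable vertex type and a deterministic root, measurability can be tested on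
  single vertices and pairs. This covers both the integers of the record graph and the addresses of
  the Galton-Watson tree.\<close>

locale measurable_rotree =
  fixes M :: "'a measure" and T :: "'a \<Rightarrow> 'v::countable rotree" and r :: 'v
  assumes root: "\<And>x. x \<in> space M \<Longrightarrow> the_root (T x) = r"
    and verts [measurable]: "\<And>v. Measurable.pred M (\<lambda>x. v \<in> verts (T x))"
    and arcs [measurable]: "\<And>u v. Measurable.pred M (\<lambda>x. (u, v) \<in> arcs (T x))"
    and sib [measurable]: "\<And>u v. Measurable.pred M (\<lambda>x. (u, v) \<in> sib (T x))"
begin

lemma measurable_adj [measurable]: "Measurable.pred M (\<lambda>x. (u, v) \<in> adj (T x))"
  by (simp add: adj_def)

lemmas measurable_adj_relpow [measurable] = measurable_relpow[OF measurable_adj]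
lemmas measurable_arcs_relpow [measurable] = measurable_relpow[OF arcs]

text \<open>Over a countable vertex type the definition unfolds into countable quantifiers: closures
  become unions of powers, and finiteness of a set of children becomes containment in the set of
  some list.\<close>

lemma measurable_family_tree: "Measurable.pred M (\<lambda>x. family_tree (T x))"
proof -
  have "family_tree S \<longleftrightarrow>
     the_root S \<in> verts S \<and> (\<forall>u v. (u, v) \<in> arcs S \<longrightarrow> u \<in> verts S \<and> v \<in> verts S) \<and>
     (\<forall>u v w. (u, v) \<in> arcs S \<longrightarrow> (u, w) \<in> arcs S \<longrightarrow> v = w) \<and>
     (\<forall>n v. 0 < n \<longrightarrow> (v, v) \<notin> arcs S ^^ n) \<and>
     (\<forall>v. v \<in> verts S \<longrightarrow> (\<exists>n. (the_root S, v) \<in> adj S ^^ n)) \<and>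
     (\<forall>v. v \<in> verts S \<longrightarrow> (\<exists>us. \<forall>u. (u, v) \<in> arcs S \<longrightarrow> u \<in> set us)) \<and>
     (\<forall>u w. (u, w) \<in> sib S \<longrightarrow> (\<exists>v. (u, v) \<in> arcs S \<and> (w, v) \<in> arcs S)) \<and>
     (\<forall>v. v \<in> verts S \<longrightarrow>
       (\<forall>u. (u, v) \<in> arcs S \<longrightarrow> (u, u) \<in> sib S) \<and>
       (\<forall>u w y. (u, v) \<in> arcs S \<longrightarrow> (w, v) \<in> arcs S \<longrightarrow> (y, v) \<in> arcs S \<longrightarrow>
          (u, w) \<in> sib S \<longrightarrow> (w, y) \<in> sib S \<longrightarrow> (u, y) \<in> sib S) \<and>
       (\<forall>u w. (u, v) \<in> arcs S \<longrightarrow> (w, v) \<in> arcs S \<longrightarrow> (u, w) \<in> sib S \<longrightarrow> (w, u) \<in> sib S \<longrightarrow> u = w) \<and>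
       (\<forall>u w. (u, v) \<in> arcs S \<longrightarrow> (w, v) \<in> arcs S \<longrightarrow> u \<noteq> w \<longrightarrow> (u, w) \<in> sib S \<or> (w, u) \<in> sib S))"
    for S :: "'v rotree"
  proof -
    have "arcs S \<subseteq> verts S \<times> verts S \<longleftrightarrow> (\<forall>u v. (u, v) \<in> arcs S \<longrightarrow> u \<in> verts S \<and> v \<in> verts S)" by auto
    moreover have "single_valued (arcs S) \<longleftrightarrow> (\<forall>u v w. (u, v) \<in> arcs S \<longrightarrow> (u, w) \<in> arcs S \<longrightarrow> v = w)"
      by (auto simp: single_valued_def)
    moreover have "acyclic (arcs S) \<longleftrightarrow> (\<forall>n v. 0 < n \<longrightarrow> (v, v) \<notin> arcs S ^^ n)"
      unfolding acyclic_def trancl_power by meson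
    moreover have "(\<forall>v\<in>verts S. (the_root S, v) \<in> (adj S)\<^sup>*) \<longleftrightarrow>
        (\<forall>v. v \<in> verts S \<longrightarrow> (\<exists>n. (the_root S, v) \<in> adj S ^^ n))"
      by (simp add: rtrancl_power Ball_def)
    moreover have "finite (children S v) \<longleftrightarrow> (\<exists>us. \<forall>u. (u, v) \<in> arcs S \<longrightarrow> u \<in> set us)" for v
    proof
      assume "finite (children S v)"
      then obtain us where "set us = children S v" using finite_list by blast
      then show "\<exists>us. \<forall>u. (u, v) \<in> arcs S \<longrightarrow> u \<in> set us" by (auto simp: children_def)
    next
      assume "\<exists>us. \<forall>u. (u, v) \<in> arcs S \<longrightarrow> u \<in> set us"
      then obtain us where "children S v \<subseteq> set us" by (auto simp: children_def)
      then show "finite (children S v)" by (rule finite_subset) simp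
    qed
    moreover have "sib S \<subseteq> {(u, w). \<exists>v. u \<in> children S v \<and> w \<in> children S v} \<longleftrightarrow>
        (\<forall>u w. (u, w) \<in> sib S \<longrightarrow> (\<exists>v. (u, v) \<in> arcs S \<and> (w, v) \<in> arcs S))"
      by (auto simp: children_def)
    moreover have "linear_order_on (children S v) (Restr (sib S) (children S v)) \<longleftrightarrow>
       (\<forall>u. (u, v) \<in> arcs S \<longrightarrow> (u, u) \<in> sib S) \<and>
       (\<forall>u w y. (u, v) \<in> arcs S \<longrightarrow> (w, v) \<in> arcs S \<longrightarrow> (y, v) \<in> arcs S \<longrightarrow>
          (u, w) \<in> sib S \<longrightarrow> (w, y) \<in> sib S \<longrightarrow> (u, y) \<in> sib S) \<and>
       (\<forall>u w. (u, v) \<in> arcs S \<longrightarrow> (w, v) \<in> arcs S \<longrightarrow> (u, w) \<in> sib S \<longrightarrow> (w, u) \<in> sib S \<longrightarrow> u = w) \<and>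
       (\<forall>u w. (u, v) \<in> arcs S \<longrightarrow> (w, v) \<in> arcs S \<longrightarrow> u \<noteq> w \<longrightarrow> (u, w) \<in> sib S \<or> (w, u) \<in> sib S)" for v
      unfolding order_on_defs refl_on_def trans_def antisym_def total_on_def children_def by blast
    ultimately show ?thesis unfolding family_tree_def by (simp only: Ball_def)
  qed
  then have "Measurable.pred M (\<lambda>x. family_tree (T x)) \<longleftrightarrow> Measurable.pred M (\<lambda>x.
     r \<in> verts (T x) \<and> (\<forall>u v. (u, v) \<in> arcs (T x) \<longrightarrow> u \<in> verts (T x) \<and> v \<in> verts (T x)) \<and>
     (\<forall>u v w. (u, v) \<in> arcs (T x) \<longrightarrow> (u, w) \<in> arcs (T x) \<longrightarrow> v = w) \<and>
     (\<forall>n v. 0 < n \<longrightarrow> (v, v) \<notin> arcs (T x) ^^ n) \<and>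
     (\<forall>v. v \<in> verts (T x) \<longrightarrow> (\<exists>n. (r, v) \<in> adj (T x) ^^ n)) \<and>
     (\<forall>v. v \<in> verts (T x) \<longrightarrow> (\<exists>us. \<forall>u. (u, v) \<in> arcs (T x) \<longrightarrow> u \<in> set us)) \<and>
     (\<forall>u w. (u, w) \<in> sib (T x) \<longrightarrow> (\<exists>v. (u, v) \<in> arcs (T x) \<and> (w, v) \<in> arcs (T x))) \<and>
     (\<forall>v. v \<in> verts (T x) \<longrightarrow>
       (\<forall>u. (u, v) \<in> arcs (T x) \<longrightarrow> (u, u) \<in> sib (T x)) \<and>
       (\<forall>u w y. (u, v) \<in> arcs (T x) \<longrightarrow> (w, v) \<in> arcs (T x) \<longrightarrow> (y, v) \<in> arcs (T x) \<longrightarrow>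
          (u, w) \<in> sib (T x) \<longrightarrow> (w, y) \<in> sib (T x) \<longrightarrow> (u, y) \<in> sib (T x)) \<and>
       (\<forall>u w. (u, v) \<in> arcs (T x) \<longrightarrow> (w, v) \<in> arcs (T x) \<longrightarrow> (u, w) \<in> sib (T x) \<longrightarrow> (w, u) \<in> sib (T x) \<longrightarrow> u = w) \<and>
       (\<forall>u w. (u, v) \<in> arcs (T x) \<longrightarrow> (w, v) \<in> arcs (T x) \<longrightarrow> u \<noteq> w \<longrightarrow> (u, w) \<in> sib (T x) \<or> (w, u) \<in> sib (T x))))"
    by (intro measurable_cong) (simp add: root)
  also have "\<dots>" by measurable
  finally show ?thesis .
qed

lemma measurable_verts_root_ball [measurable]:
  "Measurable.pred M (\<lambda>x. v \<in> verts (root_ball s (T x)))"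
proof -
  have "Measurable.pred M (\<lambda>x. v \<in> verts (root_ball s (T x))) \<longleftrightarrow>
      Measurable.pred M (\<lambda>x. \<exists>n\<in>{..s}. (r, v) \<in> adj (T x) ^^ n)"
    by (intro measurable_cong) (auto simp: root_ball_simps root)
  also have "\<dots>" by measurable
  finally show ?thesis .
qed

text \<open>The balls around the root take countably many values, so every open set, being a union of
  sets of trees with a prescribed ball, has a measurable preimage.\<close>

lemma measurable_iso_class:
  assumes fam: "\<And>x. x \<in> space M \<Longrightarrow> family_tree (T x)"
  shows "(\<lambda>x. iso_class (T x)) \<in> borel_measurable M"
proof (rule borel_measurableI)
  fix U :: "ftree set" assume U: "open U"
  define key where "key s x = (verts (root_ball s (T x)), arcs (root_ball s (T x)), sib (root_ball s (T x)))" for s x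
  \<comment> \<open>Collects the balls of radius \<open>s\<close> that force the class into
    \<open>U\<close>: every \<open>x\<close> with such a ball is sent into \<open>U\<close>, so the
    whole fibre belongs to the preimage.\<close>
  define K where "K s = {\<kappa> \<in> Collect finite \<times> Collect finite \<times> Collect finite.
    \<forall>x\<in>space M. key s x = \<kappa> \<longrightarrow> iso_class (T x) \<in> U}" for s
  have key_fin: "key s x \<in> Collect finite \<times> Collect finite \<times> Collect finite" if "x \<in> space M" for s x
  proof -
    have "finite (verts (root_ball s (T x)))" using fam[OF that] by (rule finite_verts_root_ball)
    then show ?thesis by (simp add: key_def root_ball_simps(2,3))
  qed
  have key_iso: "root_ball s (T x) = root_ball s (T y)" if "x \<in> space M" "y \<in> space M" "key s x = key s y" for s x y
    using that root by (intro rotree.equality) (auto simp: key_def root_ball_simps(4))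
  have "(\<lambda>x. iso_class (T x)) -` U \<inter> space M = (\<Union>s. \<Union>\<kappa>\<in>K s. {x \<in> space M. key s x = \<kappa>})"
  proof
    show "(\<lambda>x. iso_class (T x)) -` U \<inter> space M \<subseteq> (\<Union>s. \<Union>\<kappa>\<in>K s. {x \<in> space M. key s x = \<kappa>})"
    proof
      fix x assume "x \<in> (\<lambda>x. iso_class (T x)) -` U \<inter> space M"
      then have x: "iso_class (T x) \<in> U" "x \<in> space M" by auto
      then obtain s where s: "\<And>t. root_ball s (rep_ftree t) \<simeq> root_ball s (rep_ftree (iso_class (T x))) \<Longrightarrow> t \<in> U"
        using U unfolding open_ftree_def by blast
      have "iso_class (T y) \<in> U" if y: "y \<in> space M" "key s y = key s x" for y
      proof (rule s)
        have "the_root (root_ball s (T y)) \<in> verts (root_ball s (T y))"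
          by (auto simp: root_ball_simps intro!: exI[of _ 0])
        then have "root_ball s (rep_ftree (iso_class (T y))) \<simeq> root_ball s (T y)"
          by (rule rotree_iso_sym[OF root_ball_rep_ftree[OF fam[OF y(1)]]])
        also have "root_ball s (T y) = root_ball s (T x)" by (rule key_iso[OF y(1) x(2) y(2)])
        finally show "root_ball s (rep_ftree (iso_class (T y))) \<simeq> root_ball s (rep_ftree (iso_class (T x)))"
          using root_ball_rep_ftree[OF fam[OF x(2)]] by (rule rotree_iso_trans)
      qed
      then have "key s x \<in> K s" using key_fin[OF x(2)] by (auto simp: K_def)
      then show "x \<in> (\<Union>s. \<Union>\<kappa>\<in>K s. {x \<in> space M. key s x = \<kappa>})" using x(2) by blast
    qed
  qed (auto simp: K_def)
  also have "\<dots> \<in> sets M"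
  proof (intro sets.countable_UN' image_subsetI)
    show "countable (K s)" for s
      by (rule countable_subset[of _ "Collect finite \<times> Collect finite \<times> Collect finite"])
        (auto simp: K_def intro!: countable_SIGMA countable_Collect_finite)
    fix s :: nat and \<kappa> :: "'v set \<times> ('v \<times> 'v) set \<times> ('v \<times> 'v) set"
    obtain V E S where \<kappa>: "\<kappa> = (V, E, S)" by (cases \<kappa>)
    have "{x \<in> space M. key s x = \<kappa>} = {x \<in> space M.
        (\<forall>v. v \<in> verts (root_ball s (T x)) \<longleftrightarrow> v \<in> V) \<and>
        (\<forall>u v. ((u, v) \<in> arcs (T x) \<and> u \<in> verts (root_ball s (T x)) \<and> v \<in> verts (root_ball s (T x))) \<longleftrightarrow> (u, v) \<in> E) \<and>
        (\<forall>u v. ((u, v) \<in> sib (T x) \<and> u \<in> verts (root_ball s (T x)) \<and> v \<in> verts (root_ball s (T x))) \<longleftrightarrow> (u, v) \<in> S)}"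
      unfolding key_def \<kappa> root_ball_simps(2,3) by auto
    also have "\<dots> \<in> sets M" by measurable
    finally show "{x \<in> space M. key s x = \<kappa>} \<in> sets M" .
  qed simp_all
  finally show "(\<lambda>x. iso_class (T x)) -` U \<inter> space M \<in> sets M" .
qed

end

subsection \<open>Comparison of the two laws\<close>

lemma measurable_sum_PiM_pmf [measurable]:
  fixes \<rho> :: "int pmf"
  assumes "finite F"
  shows "(\<lambda>x::int \<Rightarrow> int. sum x F) \<in> PiM_pmf (\<lambda>_. \<rho>) \<rightarrow>\<^sub>M count_space UNIV"
  using assms
proof (induction F rule: finite_induct)
  case (insert i F)
  have "(\<lambda>x. a + sum x F) \<in> PiM_pmf (\<lambda>_. \<rho>) \<rightarrow>\<^sub>M count_space UNIV" for a
    by (rule measurable_compose[OF insert.IH]) simp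
  then have "(\<lambda>x. x i + sum x F) \<in> PiM_pmf (\<lambda>_. \<rho>) \<rightarrow>\<^sub>M count_space UNIV"
    by (rule measurable_compose_countable[where f = "\<lambda>a x. a + sum x F"]) measurable
  then show ?case using insert.hyps by simp
qed simp

lemma measurable_iso_class_record_tree:
  fixes \<rho> :: "int pmf"
  shows "(\<lambda>x. iso_class (record_tree x)) \<in> borel_measurable (PiM_pmf (\<lambda>_. \<rho>))"
proof -
  let ?N = "PiM_pmf (\<lambda>_::int. \<rho>)"
  have sign: "Measurable.pred ?N (\<lambda>x. 0 \<le> sum x {a..<b})" "Measurable.pred ?N (\<lambda>x. sum x {a..<b} < 0)" for a b
    by measurable
  have rec [measurable]: "Measurable.pred ?N (\<lambda>x. (u, v) \<in> record_arcs x)" for u v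
    unfolding record_arcs_iff using sign by measurable
  have V: "v \<in> verts (record_tree x) \<longleftrightarrow> (\<exists>n. (0, v) \<in> (record_arcs x \<union> (record_arcs x)\<inverse>) ^^ n)" for x v
    by (simp add: record_tree_def Let_def rtrancl_power)
  have [measurable]: "Measurable.pred ?N (\<lambda>x. (u, v) \<in> (record_arcs x \<union> (record_arcs x)\<inverse>) ^^ n)" for u v n
    by (rule measurable_relpow) simp
  have verts [measurable]: "Measurable.pred ?N (\<lambda>x. v \<in> verts (record_tree x))" for v
    unfolding V by measurable
  have A: "(u, v) \<in> arcs (record_tree x) \<longleftrightarrow> (u, v) \<in> record_arcs x \<and> u \<in> verts (record_tree x) \<and> v \<in> verts (record_tree x)" for x u v
    by (auto simp: record_tree_def Let_def)
  have arcs [measurable]: "Measurable.pred ?N (\<lambda>x. (u, v) \<in> arcs (record_tree x))" for u v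
    unfolding A by measurable
  have S: "(u, w) \<in> sib (record_tree x) \<longleftrightarrow> u \<le> w \<and> (\<exists>v. (u, v) \<in> arcs (record_tree x) \<and> (w, v) \<in> arcs (record_tree x))" for x u w
    by (simp add: record_tree_def Let_def)
  interpret measurable_rotree ?N record_tree 0
  proof
    show "the_root (record_tree x) = 0" for x by (simp add: record_tree_def Let_def)
    show "Measurable.pred ?N (\<lambda>x. (u, w) \<in> sib (record_tree x))" for u w
      unfolding S by measurable
  qed (fact verts arcs)+
  show ?thesis by (rule measurable_iso_class) (rule family_tree_record_tree)
qed

text \<open>Cuts the inductive set into countably many stages, so that membership becomes a
  countable union of measurable conditions.\<close>

primrec tgw_verts_within :: "nat \<Rightarrow> (tgw_vertex \<Rightarrow> nat list) \<Rightarrow> nat \<Rightarrow> tgw_vertex \<Rightarrow> bool" where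
  "tgw_verts_within n c 0 v \<longleftrightarrow> fst v \<le> n \<and> snd v = []"
| "tgw_verts_within n c (Suc h) v \<longleftrightarrow> (\<exists>u l. v = tgw_child u l \<and> tgw_verts_within n c h u \<and> l \<in> set (c u))"

lemma tgw_verts_iff: "v \<in> tgw_verts n c \<longleftrightarrow> (\<exists>h. tgw_verts_within n c h v)"
proof
  assume "v \<in> tgw_verts n c"
  then show "\<exists>h. tgw_verts_within n c h v"
  proof induction
    case (ancestor a)
    then show ?case by (intro exI[of _ 0]) simp
  next
    case (child v l)
    then obtain h where "tgw_verts_within n c h v" by blast
    then have "tgw_verts_within n c (Suc h) (tgw_child v l)" using child.hyps by (simp only: tgw_verts_within.simps) blast
    then show ?case by blast
  qed
next
  have "v \<in> tgw_verts n c" if "tgw_verts_within n c h v" for h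
    using that
  proof (induction h arbitrary: v)
    case 0
    then show ?case using tgw_verts.ancestor[of "fst v" n c] by (cases v) simp
  next
    case (Suc h)
    then show ?case using tgw_verts.child by (simp only: tgw_verts_within.simps) blast
  qed
  then show "\<exists>h. tgw_verts_within n c h v \<Longrightarrow> v \<in> tgw_verts n c" by blast
qed

context subcritical
begin

lemma measurable_iso_class_tgw_tree:
  "(\<lambda>p. iso_class (tgw_tree (fst p) (snd p))) \<in> borel_measurable tgw_space"
proof -
  let ?T = "\<lambda>p. tgw_tree (fst p) (snd p)"
  have [measurable]: "fst \<in> tgw_space \<rightarrow>\<^sub>M count_space UNIV"
    using measurable_fst[of "measure_pmf (geometric_pmf (1 - offspring_mean \<pi>))" labels]
    by (simp cong: measurable_cong_sets)
  have label [measurable]: "(\<lambda>p. snd p v) \<in> tgw_space \<rightarrow>\<^sub>M count_space UNIV" for v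
    by (rule measurable_compose[OF measurable_snd]) simp
  have label_pred [measurable]: "Measurable.pred tgw_space (\<lambda>p. Q (snd p v))" for v and Q :: "nat list \<Rightarrow> bool"
    by (rule measurable_compose[OF label]) simp
  have within [measurable]: "Measurable.pred tgw_space (\<lambda>p. tgw_verts_within (fst p) (snd p) h v)" for h v
  proof (induction h arbitrary: v)
    case (Suc h)
    note Suc [measurable]
    show ?case unfolding tgw_verts_within.simps by measurable
  qed simp
  have vertsT: "v \<in> verts (?T p) \<longleftrightarrow> (\<exists>h. tgw_verts_within (fst p) (snd p) h v)" for v p
    by (simp add: tgw_tree_def tgw_verts_iff)
  have arcsT: "(u, v) \<in> arcs (?T p) \<longleftrightarrow> (\<exists>l. u = tgw_child v l \<and> v \<in> verts (?T p) \<and> l \<in> set (snd p v))" for u v p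
    by (auto simp: tgw_tree_def simp del: split_paired_Ex)
  have sibT: "(u, w) \<in> sib (?T p) \<longleftrightarrow> (\<exists>v i j. v \<in> verts (?T p) \<and>
      (u = tgw_child v (snd p v ! i) \<and> w = tgw_child v (snd p v ! j) \<and> i \<le> j \<and> j < length (snd p v)))" for u w p
    by (auto simp: tgw_tree_def simp del: split_paired_Ex)
  have verts [measurable]: "Measurable.pred tgw_space (\<lambda>p. v \<in> verts (?T p))" for v
    unfolding vertsT by measurable
  interpret measurable_rotree tgw_space ?T "(0, [])"
  proof
    show "the_root (?T p) = (0, [])" for p by (simp add: tgw_tree_def)
    show "Measurable.pred tgw_space (\<lambda>p. (u, v) \<in> arcs (?T p))" for u v
      unfolding arcsT by measurable
    show "Measurable.pred tgw_space (\<lambda>p. (u, w) \<in> sib (?T p))" for u w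
      unfolding sibT by measurable
  qed (fact verts)
  \<comment> \<open>Improper labels need not give a family tree; \<^const>\<open>iso_class\<close> is then a junk constant.\<close>
  let ?S = "\<lambda>p. if family_tree (?T p) then ?T p else tgw_tree 0 (\<lambda>_. [])"
  have [measurable]: "Measurable.pred tgw_space (\<lambda>p. family_tree (?T p))" by (rule measurable_family_tree)
  interpret S: measurable_rotree tgw_space ?S "(0, [])"
    by unfold_locales (auto simp: root if_distrib[of verts] if_distrib[of arcs] if_distrib[of sib] if_distrib[of the_root]
      if_distrib[of "\<lambda>A. _ \<in> A"] tgw_tree_def[of 0])
  have "family_tree (?S p)" for p
    using family_tree_tgw_tree[of "\<lambda>_. []" 0] by simp
  then have [measurable]: "(\<lambda>p. iso_class (?S p)) \<in> borel_measurable tgw_space" by (rule S.measurable_iso_class)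
  have "iso_class (?T p) = (if family_tree (?T p) then iso_class (?S p) else abs_ftree (SOME S. False))" for p
  proof (cases "family_tree (?T p)")
    case False
    have "iso_class (?T p) = abs_ftree (SOME S. False)"
    proof (rule iso_class_not_family_tree[OF False])
      show "the_root (?T p) \<in> verts (?T p)" by (simp add: tgw_tree_def tgw_verts.ancestor)
      show "arcs (?T p) \<subseteq> verts (?T p) \<times> verts (?T p)"
        by (auto simp: tgw_tree_def simp del: split_paired_Ex intro: tgw_verts.child)
      show "sib (?T p) \<subseteq> verts (?T p) \<times> verts (?T p)"
        by (auto simp: tgw_tree_def simp del: split_paired_Ex intro!: tgw_verts.child)
    qed
    then show ?thesis using False by simp
  qed simp
  then have "(\<lambda>p. iso_class (?T p)) = (\<lambda>p. if family_tree (?T p) then iso_class (?S p) else abs_ftree (SOME S. False))"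
    by (rule ext)
  also have "\<dots> \<in> borel_measurable tgw_space" by measurable
  finally show ?thesis .
qed

lemma TGWT_eq: "TGWT \<pi> = distr tgw_space borel (\<lambda>p. iso_class (tgw_tree (fst p) (snd p)))"
proof -
  have "(\<lambda>(a, u). measure_pmf (ordered_children (if 0 < a \<and> u = [] then size_biased \<pi> else \<pi>))) =
      (\<lambda>v. measure_pmf (label_law \<pi> v))"
    by (auto simp: label_law_def off_spine_def fun_eq_iff)
  then show ?thesis unfolding TGWT_def by (simp add: case_prod_unfold)
qed

text \<open>A code determines the isomorphism class: if some labels with this code give a tree in
  \<open>A\<close>, then so does every walk that it encodes. Summing the masses of these codes
  bounds TGWT from above and, since codes are unique, equals the probability of a union of disjoint
  events for the walk.\<close>

lemma TGWT_le_record_tree: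
  assumes A: "A \<in> sets borel"
  shows "emeasure (TGWT \<pi>) A \<le> emeasure (distr steps borel (\<lambda>x. iso_class (record_tree x))) A"
proof -
  let ?h = "\<lambda>p. iso_class (tgw_tree (fst p) (snd p))" and ?f = "\<lambda>x. iso_class (record_tree x)"
  let ?D = "\<lambda>(w, k). {p. rooted_at (snd p) [(fst p, [])] w k}"
  let ?E = "\<lambda>(w, k). {x. encodes x w k}"
  define I where "I = {(w, k). \<exists>n c. proper_labels n c \<and> rooted_at c [(n, [])] w k \<and> iso_class (tgw_tree n c) \<in> A}"
  have I: "lukasiewicz w \<and> k < length w \<and> (\<forall>x. encodes x w k \<longrightarrow> ?f x \<in> A)" if wk: "(w, k) \<in> I" for w k
  proof -
    obtain n c where nc: "proper_labels n c" "rooted_at c [(n, [])] w k" "iso_class (tgw_tree n c) \<in> A"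
      using wk unfolding I_def mem_Collect_eq prod.case by blast
    interpret exploration n c w using nc by unfold_locales (auto simp: rooted_at_def)
    have k: "k < length w" "visited k = (0, [])"
      using nc(2) by (auto simp: rooted_at_def visited_def stack_def)
    have fam: "family_tree (tgw_tree n c)"
      using nc(1) by (intro family_tree_tgw_tree) (auto simp: proper_labels_def)
    have "?f x = iso_class (tgw_tree n c)" if "encodes x w k" for x
      using record_tree_iso[OF that k] iso_class_eq_iff[OF family_tree_record_tree fam] by blast
    then show ?thesis using lukasiewicz k(1) nc(3) by simp
  qed
  have Dm: "?D i \<in> sets tgw_space" for i by (cases i) (simp add: sets_tgw_space_rooted_at)
  have Em: "?E i \<in> sets steps" for i by (cases i) (simp add: sets_encodes)
  have "emeasure (TGWT \<pi>) A = emeasure tgw_space (?h -` A)"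
    unfolding TGWT_eq using A by (simp add: emeasure_distr measurable_iso_class_tgw_tree)
  also have "\<dots> \<le> emeasure tgw_space (\<Union>i\<in>I. ?D i)"
  proof (rule emeasure_mono_AE)
    show "AE p in tgw_space. p \<in> ?h -` A \<longrightarrow> p \<in> (\<Union>i\<in>I. ?D i)"
      using AE_tgw_space
    proof eventually_elim
      case (elim p)
      then obtain w k where wk: "rooted_at (snd p) [(fst p, [])] w k" "proper_labels (fst p) (snd p)" by blast
      show ?case
      proof
        assume "p \<in> ?h -` A"
        then have "(w, k) \<in> I" using wk unfolding I_def by auto
        then show "p \<in> (\<Union>i\<in>I. ?D i)" using wk(1) by blast
      qed
    qed
    show "(\<Union>i\<in>I. ?D i) \<in> sets tgw_space" using Dm by (intro sets.countable_UN') auto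
  qed
  also have "\<dots> \<le> (\<integral>\<^sup>+i. emeasure tgw_space (?D i) \<partial>count_space I)"
    using Dm by (intro emeasure_UN_le) auto
  also have "\<dots> \<le> (\<integral>\<^sup>+i. emeasure steps (?E i) \<partial>count_space I)"
  proof (rule nn_integral_mono)
    fix i :: "nat list \<times> nat"
    obtain w k where [simp]: "i = (w, k)" by (cases i)
    show "emeasure tgw_space (?D i) \<le> emeasure steps (?E i)"
      using order_trans[OF emeasure_tgw_space_rooted_at[of w k] emeasure_encodes[of w k]] by simp
  qed
  also have "\<dots> = emeasure steps (\<Union>i\<in>I. ?E i)"
  proof (rule emeasure_UN_countable[symmetric])
    have "i = i'" if i: "i \<in> I" "i' \<in> I" and x: "x \<in> ?E i" "x \<in> ?E i'" for i i' x
    proof -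
      obtain w k w' k' where wk: "i = (w, k)" "i' = (w', k')" by (cases i, cases i')
      then show ?thesis using I[of w k] I[of w' k'] i x encodes_unique[of w k x w' k'] by simp
    qed
    then show "disjoint_family_on ?E I" unfolding disjoint_family_on_def by blast
  qed (use Em in auto)
  also have "\<dots> \<le> emeasure steps (?f -` A \<inter> space steps)"
  proof (rule emeasure_mono)
    show "?f -` A \<inter> space steps \<in> sets steps"
      using measurable_iso_class_record_tree A by (rule measurable_sets)
  qed (use I in fastforce)
  also have "\<dots> = emeasure (distr steps borel ?f) A"
    using A by (simp add: emeasure_distr measurable_iso_class_record_tree)
  finally show ?thesis .
qed

theorem distr_record_tree: "distr steps borel (\<lambda>x. iso_class (record_tree x)) = TGWT \<pi>"
proof -
  let ?R = "distr steps borel (\<lambda>x. iso_class (record_tree x))"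
  interpret R: prob_space ?R
    by (intro prob_space.prob_space_distr prob_space_PiM_pmf measurable_iso_class_record_tree)
  interpret G: prob_space "TGWT \<pi>"
    unfolding TGWT_eq by (intro prob_space.prob_space_distr prob_space_tgw_space measurable_iso_class_tgw_tree)
  have sets: "sets (TGWT \<pi>) = sets borel" and space: "space (TGWT \<pi>) = UNIV" by (simp_all add: TGWT_eq)
  have le: "G.prob A \<le> R.prob A" if "A \<in> sets borel" for A
    using TGWT_le_record_tree[OF that] by (simp add: R.emeasure_eq_measure G.emeasure_eq_measure)
  show ?thesis
  proof (rule measure_eqI)
    fix A assume "A \<in> sets ?R"
    then have A: "A \<in> sets borel" by simp
    have "G.prob (UNIV - A) = 1 - G.prob A" using G.prob_compl[of A] A by (simp add: sets space)
    moreover have "R.prob (UNIV - A) = 1 - R.prob A" using R.prob_compl[of A] A by simp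
    moreover have "G.prob (UNIV - A) \<le> R.prob (UNIV - A)" using A by (intro le) auto
    ultimately have "R.prob A = G.prob A" using le[OF A] by simp
    then show "emeasure ?R A = emeasure (TGWT \<pi>) A" by (simp add: R.emeasure_eq_measure G.emeasure_eq_measure)
  qed (simp add: sets)
qed

end

section \<open>From the given increments to the canonical product space\<close>

lemma distr_increments:
  assumes X: "skip_free_left_increments M X"
    and law: "distr M (count_space UNIV) (\<lambda>\<omega>. X 0 \<omega> + 1) = measure_pmf (map_pmf int \<pi>)"
  shows "distr M (PiM_pmf (\<lambda>_. map_pmf (\<lambda>d. int d - 1) \<pi>)) (\<lambda>\<omega> n. X n \<omega>) = PiM_pmf (\<lambda>_. map_pmf (\<lambda>d. int d - 1) \<pi>)"
    and "(\<lambda>\<omega> n. X n \<omega>) \<in> M \<rightarrow>\<^sub>M PiM_pmf (\<lambda>_. map_pmf (\<lambda>d. int d - 1) \<pi>)"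
proof -
  let ?\<rho> = "map_pmf (\<lambda>d. int d - 1) \<pi>" and ?C = "count_space (UNIV :: int set)"
  interpret prob_space M using X by (simp add: skip_free_left_increments_def)
  have indep: "indep_vars (\<lambda>_. ?C) X UNIV" and ident: "\<And>n. distr M ?C (X n) = distr M ?C (X 0)"
    using X by (simp_all add: skip_free_left_increments_def)
  have meas [measurable]: "X n \<in> M \<rightarrow>\<^sub>M ?C" for n using indep by (simp add: indep_vars_def)
  have "distr M ?C (X 0) = distr (distr M ?C (\<lambda>\<omega>. X 0 \<omega> + 1)) ?C (\<lambda>y. y - 1)"
    by (subst distr_distr) (simp_all add: comp_def)
  also have "\<dots> = measure_pmf ?\<rho>"
    unfolding law map_pmf_rep_eq[symmetric] by (simp add: map_pmf_comp)
  finally have X0: "distr M ?C (X n) = measure_pmf ?\<rho>" for n using ident by simp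
  have sets: "sets (PiM_pmf (\<lambda>_::int. ?\<rho>)) = sets (\<Pi>\<^sub>M _\<in>UNIV. ?C)"
    by (intro sets_PiM_cong) auto
  have "(\<lambda>\<omega> n. X n \<omega>) \<in> M \<rightarrow>\<^sub>M (\<Pi>\<^sub>M _\<in>UNIV. ?C)"
    by (rule measurable_PiM_single') auto
  then show "(\<lambda>\<omega> n. X n \<omega>) \<in> M \<rightarrow>\<^sub>M PiM_pmf (\<lambda>_. ?\<rho>)"
    using sets by (simp cong: measurable_cong_sets)
  have "distr M (PiM_pmf (\<lambda>_. ?\<rho>)) (\<lambda>\<omega> n. X n \<omega>) = distr M (\<Pi>\<^sub>M _\<in>UNIV. ?C) (\<lambda>\<omega>. \<lambda>n\<in>UNIV. X n \<omega>)"
    using sets by (intro distr_cong) auto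
  also have "\<dots> = (\<Pi>\<^sub>M n\<in>UNIV. distr M ?C (X n))"
    using indep_vars_iff_distr_eq_PiM[where I = UNIV and M' = "\<lambda>_. ?C" and X = X] indep by simp
  finally show "distr M (PiM_pmf (\<lambda>_. ?\<rho>)) (\<lambda>\<omega> n. X n \<omega>) = PiM_pmf (\<lambda>_. ?\<rho>)"
    by (simp add: X0)
qed

text \<open>As \<open>offspring_mean \<pi>\<close> is the mean of \<open>X 0 + 1\<close>, negative
  drift makes it less than 1. Were it 0, the nonnegative variable \<open>X 0 + 1\<close> would
  vanish almost surely, against \<open>nontrivial\<close>.\<close>

lemma subcritical_offspring:
  assumes X: "skip_free_left_increments M X"
    and nontrivial: "measure M {\<omega>\<in>space M. X 0 \<omega> = -1} < 1"
    and drift: "(\<integral>\<omega>. real_of_int (X 0 \<omega>) \<partial>M) < 0"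
    and law: "distr M (count_space UNIV) (\<lambda>\<omega>. X 0 \<omega> + 1) = measure_pmf (map_pmf int \<pi>)"
  shows "subcritical \<pi>"
proof -
  interpret prob_space M using X by (simp add: skip_free_left_increments_def)
  have meas [measurable]: "X 0 \<in> M \<rightarrow>\<^sub>M count_space UNIV"
    using X by (simp add: skip_free_left_increments_def indep_vars_def)
  have int: "integrable M (\<lambda>\<omega>. real_of_int (X 0 \<omega>))"
    and ge: "\<And>\<omega>. \<omega> \<in> space M \<Longrightarrow> -1 \<le> X 0 \<omega>"
    using X by (simp_all add: skip_free_left_increments_def)
  have int1: "integrable M (\<lambda>\<omega>. real_of_int (X 0 \<omega> + 1))" using int by simp
  then have "integrable (distr M (count_space UNIV) (\<lambda>\<omega>. X 0 \<omega> + 1)) real_of_int"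
    by (subst integrable_distr_eq) auto
  then have integrable: "integrable (measure_pmf \<pi>) real"
    unfolding law by (simp add: integrable_map_pmf_eq)
  have mean: "offspring_mean \<pi> = (\<integral>\<omega>. real_of_int (X 0 \<omega> + 1) \<partial>M)"
  proof -
    have "(\<integral>\<omega>. real_of_int (X 0 \<omega> + 1) \<partial>M) = (\<integral>y. real_of_int y \<partial>distr M (count_space UNIV) (\<lambda>\<omega>. X 0 \<omega> + 1))"
      by (subst integral_distr) auto
    also have "\<dots> = offspring_mean \<pi>" unfolding law by (simp add: offspring_mean_def)
    finally show ?thesis by simp
  qed
  also have "\<dots> = (\<integral>\<omega>. real_of_int (X 0 \<omega>) \<partial>M) + 1"
    using int by (simp add: prob_space)
  finally have "offspring_mean \<pi> < 1" using drift by simp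
  moreover have "0 \<le> offspring_mean \<pi>" by (simp add: offspring_mean_def)
  moreover have "offspring_mean \<pi> \<noteq> 0"
  proof
    assume "offspring_mean \<pi> = 0"
    moreover have "AE \<omega> in M. 0 \<le> real_of_int (X 0 \<omega> + 1)"
    proof (rule AE_I2)
      fix \<omega> assume "\<omega> \<in> space M"
      from ge[OF this] show "0 \<le> real_of_int (X 0 \<omega> + 1)" by linarith
    qed
    ultimately have "AE \<omega> in M. real_of_int (X 0 \<omega> + 1) = 0"
      using integral_nonneg_eq_0_iff_AE[OF int1] mean by simp
    then have "AE \<omega> in M. X 0 \<omega> = -1" by eventually_elim linarith
    then have "prob {\<omega>\<in>space M. X 0 \<omega> = -1} = 1" by (subst prob_Collect_eq_1) auto
    then show False using nontrivial by simp
  qed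
  ultimately show ?thesis using integrable by unfold_locales auto
qed

theorem theorem48:
  fixes M :: "'a measure" and X :: "int \<Rightarrow> 'a \<Rightarrow> int" and \<pi> :: "nat pmf"
  assumes "skip_free_left_increments M X"
    and "measure M {\<omega>\<in>space M. X 0 \<omega> = -1} < 1"
    and "(\<integral>\<omega>. real_of_int (X 0 \<omega>) \<partial>M) < 0"
    and "distr M (count_space UNIV) (\<lambda>\<omega>. X 0 \<omega> + 1) = measure_pmf (map_pmf int \<pi>)"
  shows "(\<lambda>\<omega>. iso_class (record_tree (\<lambda>n. X n \<omega>))) \<in> measurable M borel \<and>
    distr M borel (\<lambda>\<omega>. iso_class (record_tree (\<lambda>n. X n \<omega>))) = TGWT \<pi>"
proof -
  interpret subcritical \<pi> by (rule subcritical_offspring[OF assms])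
  note X = distr_increments[OF assms(1,4)]
  note f = measurable_iso_class_record_tree[of "map_pmf (\<lambda>d. int d - 1) \<pi>"]
  have "distr M borel (\<lambda>\<omega>. iso_class (record_tree (\<lambda>n. X n \<omega>))) =
      distr (distr M steps (\<lambda>\<omega> n. X n \<omega>)) borel (\<lambda>x. iso_class (record_tree x))"
    by (subst distr_distr[OF f X(2)]) (simp add: comp_def)
  then show ?thesis
    using measurable_compose[OF X(2) f] by (simp add: X(1) distr_record_tree)
qed

end
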